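(* Let $n>1$ be an integer. Let $(D,J)$ be a model domain in $\mathbb{C}^n$. Let $p\in\partial D$ and let $U$ be an open ball in $\mathbb{C}^n$ centered at $p$. Let $f:U\to\mathbb{C}^n$ be a map of class $\mathcal{C}^4$ which is pseudo-holomorphic on $U$, i.e. $\mathrm{d}f_z\circ J_z=J_{f(z)}\circ \mathrm{d}f_z$ for all $z\in U$, and such that $f(U\cap\partial D)\subset\partial D$. If $f$ is a local diffeomorphism at $p$, then $f$ extends to an automorphism of $(D,J)$; that is, there exists a $J$-automorphism $\Phi$ of $D$ such that $\Phi=f$ on $U\cap D$.
   Context: **Almost complex structures.** An almost complex structure $J$ on a smooth manifold $M$ of real dimension $2n$ is a smooth vector bundle isomorphism $J:TM\to TM$ with $J^2=-I$. A $\mathcal{C}^1$ map $f:(M,J)\to(M',J')$ is pseudo-holomorphic (or $(J,J')$-holomorphic) if $\mathrm{d}f_z\circ J_z=J'_{f(z)}\circ\mathrm{d}f_z$ for all $z\in M$. A bijective pseudo-holomorphic map $(M,J)\to(M,J)$ is called a $J$-automorphism of $M$; an automorphism of $(D,J)$ is a $J$-automorphism of the domain $D$ equipped with the restriction of $J$. **Model structures.** Write $z=(z',z_n)\in\mathbb{C}^n$ with $z'=(z_1,\dots,z_{n-1})$, and identify $\mathbb{C}^n$ with $\mathbb{R}^{2n}$ via the coordinates $(x_1,y_1,\dots,x_n,y_n)$, $z_j=x_j+iy_j$. Let $J_{st}^{(n)}$ be the standard complex structure of $\mathbb{C}^n$. An almost complex structure $J$ on $\mathbb{C}^n$ (so $J(z)^2=-I$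 for all $z$) is a model structure if $J(z)=J_{st}^{(n)}+L(z)$, where $L=(L_{j,k})_{1\le j,k\le 2n}$ is a real matrix such that - $L_{j,k}=0$ if $1\le j\le 2n-2$ and $1\le k\le 2n$; - $L_{j,k}=\sum_{l=1}^{n-1}\left(a^{j,k}_l z_l+\overline{a^{j,k}_l}\,\overline{z_l}\right)$ with $a^{j,k}_l\in\mathbb{C}$, if $j\in\{2n-1,2n\}$ and $1\le k\le 2n-2$; - $L_{j,k}=0$ if $j,k\in\{2n-1,2n\}$. **Strict pseudoconvexity.** Let $\Gamma=\{r=0\}$ be a smooth real hypersurface of an almost complex manifold $(M,J)$, and for $q\in\Gamma$ put $H^J_q\Gamma=T_q\Gamma\cap J T_q\Gamma$. For a 1-form $\varphi$ set $(J^\star\varphi)X=\varphi(JX)$. The Levi form of $\Gamma$ at $q$ is defined for $X_q\in H^J_q\Gamma$ by $\mathcal{L}^J_\Gamma(X_q)=(J^\star \mathrm{d}r)[X,JX]_q$, where $X$ is any vector field in $H^J\Gamma$ with $X(q)=X_q$ (the value does not depend on the choice of $X$). $\Gamma$ is strictly $J$-pseudoconvex at $q$ if $\mathcal{L}^J_\Gamma(X_q)>0$ for every nonzero $X_q\in H^J_q\Gamma$. A domain $D=\{r<0\}$ is said to be strictly $J$-pseudoconvex near a boundary point if its boundary $\{r=0\}$, with defining function $r$, is strictly $J$-pseudoconvex at all points of the boundary in a neighborhood of that point. **Model domains.** A model domain in $\mathbb{C}^n$ is a pair $(D,J)$ where $J$ is a model structure on $\mathbb{C}^n$, $D=\{z\in\mathbb{C}^n:\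 \mathrm{Re}(z_n)+P(z',\overline{z'})<0\}$ with $P$ a real-valued homogeneous polynomial of degree two on $\mathbb{C}^{n-1}$ (in $z',\overline{z'}$), and $D$ is strictly $J$-pseudoconvex in a neighborhood of the origin. *)

theory Defs
  imports "HOL-Analysis.Analysis"
begin

section \<open>Maps of class C^k\<close>

text \<open>Intended for open sets S of a finite-dimensional space; there, having all directional
  derivatives of class C^k is the same as having a derivative of class C^k.\<close>

primrec Ck_on :: "nat \<Rightarrow> 'a::euclidean_space set \<Rightarrow> ('a \<Rightarrow> 'b::real_normed_vector) \<Rightarrow> bool" where
  "Ck_on 0 S f \<longleftrightarrow> continuous_on S f"
| "Ck_on (Suc k) S f \<longleftrightarrow>
     (\<forall>x\<in>S. f differentiable (at x)) \<and>
     (\<forall>v. Ck_on k S (\<lambda>x. frechet_derivative f (at x) v))"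

definition smooth_on :: "'a::euclidean_space set \<Rightarrow> ('a \<Rightarrow> 'b::real_normed_vector) \<Rightarrow> bool" where
  "smooth_on S f \<longleftrightarrow> (\<forall>k. Ck_on k S f)"

text \<open>For a map of class C^k with k \<ge> 1, a local inverse of class C^1 is automatically of class C^k,
  so that requiring C^1 here does not depend on the regularity of the map.\<close>

definition local_diffeomorphism_at ::
    "('a::euclidean_space \<Rightarrow> 'b::euclidean_space) \<Rightarrow> 'a \<Rightarrow> bool" where
  "local_diffeomorphism_at f p \<longleftrightarrow>
     (\<exists>V W g. open V \<and> open W \<and> p \<in> V \<and> homeomorphism V W f g \<and> Ck_on 1 V f \<and> Ck_on 1 W g)"

section \<open>Almost complex structures\<close>

text \<open>The tangent bundle of an open set S of a Euclidean space is trivial, so a bundle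
  endomorphism is a family of linear maps. All notions below concern open subsets.\<close>

definition almost_complex_structure_on ::
    "'a::euclidean_space set \<Rightarrow> ('a \<Rightarrow> 'a \<Rightarrow> 'a) \<Rightarrow> bool" where
  "almost_complex_structure_on S J \<longleftrightarrow>
     (\<forall>z\<in>S. linear (J z) \<and> (\<forall>v. J z (J z v) = - v)) \<and> (\<forall>v. smooth_on S (\<lambda>z. J z v))"

definition pseudo_holomorphic ::
    "'a::euclidean_space set \<Rightarrow> ('a \<Rightarrow> 'a \<Rightarrow> 'a) \<Rightarrow>
     'b::euclidean_space set \<Rightarrow> ('b \<Rightarrow> 'b \<Rightarrow> 'b) \<Rightarrow> ('a \<Rightarrow> 'b) \<Rightarrow> bool" where
  "pseudo_holomorphic S J S' J' f \<longleftrightarrow>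
     f ` S \<subseteq> S' \<and> Ck_on 1 S f \<and>
     (\<forall>z\<in>S. frechet_derivative f (at z) \<circ> J z = J' (f z) \<circ> frechet_derivative f (at z))"

definition J_automorphism ::
    "'a::euclidean_space set \<Rightarrow> ('a \<Rightarrow> 'a \<Rightarrow> 'a) \<Rightarrow> ('a \<Rightarrow> 'a) \<Rightarrow> bool" where
  "J_automorphism D J f \<longleftrightarrow> bij_betw f D D \<and> pseudo_holomorphic D J D J f"

section \<open>Levi form and strict pseudoconvexity\<close>

text \<open>Here r is a defining function of the hypersurface {r = 0}: it is smooth, and its derivative
  does not vanish at the points of that set. Thus the tangent space is the kernel of dr.\<close>

definition tangent_space :: "('a::euclidean_space \<Rightarrow> real) \<Rightarrow> 'a \<Rightarrow> 'a set" where
  "tangent_space r q = {v. frechet_derivative r (at q) v = 0}"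

definition J_tangent_space ::
    "('a::euclidean_space \<Rightarrow> 'a \<Rightarrow> 'a) \<Rightarrow> ('a \<Rightarrow> real) \<Rightarrow> 'a \<Rightarrow> 'a set" where
  "J_tangent_space J r q = tangent_space r q \<inter> J q ` tangent_space r q"

definition lie_bracket ::
    "('a::euclidean_space \<Rightarrow> 'a) \<Rightarrow> ('a \<Rightarrow> 'a) \<Rightarrow> 'a \<Rightarrow> 'a" where
  "lie_bracket X Y q =
     frechet_derivative Y (at q) (X q) - frechet_derivative X (at q) (Y q)"

text \<open>A section of the J-tangent bundle of {r = 0} near q, represented by an extension to a
  neighbourhood of q in the ambient space. The vector fields X and JX being tangent to {r = 0},
  their bracket at q does not depend on the extension.\<close>

definition J_tangent_field_near ::
    "('a::euclidean_space \<Rightarrow> 'a \<Rightarrow> 'a) \<Rightarrow> ('a \<Rightarrow> real) \<Rightarrow> 'a \<Rightarrow> ('a \<Rightarrow> 'a) \<Rightarrow> bool" where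
  "J_tangent_field_near J r q X \<longleftrightarrow>
     (\<exists>V. open V \<and> q \<in> V \<and> smooth_on V X \<and>
          (\<forall>z\<in>V. r z = 0 \<longrightarrow> X z \<in> J_tangent_space J r z))"

definition levi_form ::
    "('a::euclidean_space \<Rightarrow> 'a \<Rightarrow> 'a) \<Rightarrow> ('a \<Rightarrow> real) \<Rightarrow> 'a \<Rightarrow> 'a \<Rightarrow> real" where
  "levi_form J r q v =
     (THE c. \<exists>X. J_tangent_field_near J r q X \<and> X q = v \<and>
        c = frechet_derivative r (at q) (J q (lie_bracket X (\<lambda>z. J z (X z)) q)))"

definition strictly_pseudoconvex_at ::
    "('a::euclidean_space \<Rightarrow> 'a \<Rightarrow> 'a) \<Rightarrow> ('a \<Rightarrow> real) \<Rightarrow> 'a \<Rightarrow> bool" where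
  "strictly_pseudoconvex_at J r q \<longleftrightarrow>
     (\<forall>v \<in> J_tangent_space J r q. v \<noteq> 0 \<longrightarrow> levi_form J r q v > 0)"

definition strictly_pseudoconvex_near ::
    "('a::euclidean_space \<Rightarrow> 'a \<Rightarrow> 'a) \<Rightarrow> ('a \<Rightarrow> real) \<Rightarrow> 'a \<Rightarrow> bool" where
  "strictly_pseudoconvex_near J r p \<longleftrightarrow>
     (\<exists>V. open V \<and> p \<in> V \<and> (\<forall>q\<in>V. r q = 0 \<longrightarrow> strictly_pseudoconvex_at J r q))"

section \<open>Model structures and model domains\<close>

text \<open>Complex n-space with points z = (z', z_n), where n = CARD('m) + 1. Types being nonempty,
  n > 1 holds automatically, and every n > 1 occurs.\<close>

type_synonym 'm cspace = "(complex ^ 'm) \<times> complex"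

definition J_st :: "'m::finite cspace \<Rightarrow> 'm cspace" where
  "J_st v = (\<i> *s fst v, \<i> * snd v)"

text \<open>The standard basis vectors are the coordinate vectors of x_1, y_1, ..., x_n, y_n. The basis
  vectors e with fst e = 0 are those of the last two coordinates, and the ones with snd e = 0 are
  the others. The matrix entry with row e and column e' of a linear map A is A e' \<bullet> e.\<close>

definition model_structure :: "('m::finite cspace \<Rightarrow> 'm cspace \<Rightarrow> 'm cspace) \<Rightarrow> bool" where
  "model_structure J \<longleftrightarrow>
     almost_complex_structure_on UNIV J \<and>
     (\<exists>a :: 'm cspace \<Rightarrow> 'm cspace \<Rightarrow> 'm \<Rightarrow> complex.
        \<forall>z. \<forall>e\<in>Basis. \<forall>e'\<in>Basis.
          complex_of_real ((J z e' - J_st e') \<bullet> e) =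
            (if fst e = 0 \<and> snd e' = 0
             then (\<Sum>l\<in>UNIV. a e e' l * fst z $ l + cnj (a e e' l) * cnj (fst z $ l))
             else 0))"

definition real_homogeneous_quadratic :: "(complex ^ 'm::finite \<Rightarrow> real) \<Rightarrow> bool" where
  "real_homogeneous_quadratic P \<longleftrightarrow>
     (\<exists>A B C :: 'm \<Rightarrow> 'm \<Rightarrow> complex. \<forall>w.
        complex_of_real (P w) =
          (\<Sum>i\<in>UNIV. \<Sum>j\<in>UNIV.
             A i j * (w $ i) * (w $ j) + B i j * (w $ i) * cnj (w $ j)
               + C i j * cnj (w $ i) * cnj (w $ j)))"

definition model_domain ::
    "'m::finite cspace set \<Rightarrow> ('m cspace \<Rightarrow> 'm cspace \<Rightarrow> 'm cspace) \<Rightarrow> bool" where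
  "model_domain D J \<longleftrightarrow>
     model_structure J \<and>
     (\<exists>P. real_homogeneous_quadratic P \<and>
          D = {z. Re (snd z) + P (fst z) < 0} \<and>
          strictly_pseudoconvex_near J (\<lambda>z. Re (snd z) + P (fst z)) 0)"

end

theory Submission
  imports Defs "HOL-Complex_Analysis.Complex_Analysis"
begin

text \<open>A polynomial change of coordinates z_n \<mapsto> z_n + k(z',z') brings (D,J) to the form
  D = {Re z_n + H(z',z') < 0} with H Hermitian, and Jv = (iv', iv_n + \<beta>(z',v')) with \<beta> alternating and
  antilinear in both arguments; the Levi form at 0 is 4H, so H is positive definite. J-holomorphic discs
  in these coordinates can be taken real affine, which gives unique continuation, so it is enough to
  find the automorphism near p.

  If \<beta> = 0, then f is a holomorphic map of a piece of the sphere, and the theorem is that of Poincare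
  and Alexander. Polarizing the boundary condition, f maps Segre varieties (complex hyperplanes) into
  Segre varieties. With p = f(p) = 0, first derivatives at 0 determine f on z_n = 0, then f up to a
  scalar factor, and comparing two points on a common Segre variety determines that factor. So f is
  projective, and given by a similitude of the Hermitian form 2H(z',w') + z_n cnj(w_0) + z_0 cnj(w_n).

  If \<beta> \<noteq> 0, symmetry of second derivatives, applied to the equation for J-holomorphic maps, forces f' to be
  independent of z_n and df_n/dz_n to be constant. Then the boundary condition makes the derivative of
  f' a constant multiple of an H-isometry at each point near p, and hence constant there. So f is affine.\<close>

section \<open>Calculus of maps of class C^k\<close>

text \<open>The dichotomy rests on a clash of symmetries: the failure of the second derivative of
  \<open>f\<close> to be complex linear must be symmetric in its two arguments
  (\<open>symmetric_defect\<close>), whereas its terms in \<beta> of the two arguments are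
  alternating, so that these cancel or vanish. For nonzero \<beta> this rigidity takes the place of
  complex analysis. For \<beta> = 0 it says nothing, and the group is larger: a projective map
  fixing 0 with given first derivatives there still has a free parameter, a purely imaginary C whose
  product with z_n may be added to the denominator. Hence the scalar factor needs an argument of its
  own.

  Holomorphic functions occur in one variable only; polarization and unique continuation are reduced
  to curves and discs. Homogeneous coordinates control the denominators: a negative vector of the
  Hermitian form cannot lie at infinity, where the form is 2H and hence nonnegative. So the map of a
  similitude is defined on all of D, but f is compared with it on U after clearing
  denominators.\<close>

lemma Ck_on_cong:
  assumes "open S" "\<And>x. x \<in> S \<Longrightarrow> f x = g x"
  shows "Ck_on k S f \<longleftrightarrow> Ck_on k S g"
  using assms
proof (induction k arbitrary: f g)
  case 0
  then show ?case by (simp cong: continuous_on_cong)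
next
  case (Suc k)
  have imp: "Ck_on (Suc k) S g'" if *: "Ck_on (Suc k) S f'" "\<And>x. x \<in> S \<Longrightarrow> f' x = g' x" for f' g' :: "'a \<Rightarrow> 'b"
  proof -
    have der: "(g' has_derivative frechet_derivative f' (at x)) (at x)" if "x \<in> S" for x
      using * that \<open>open S\<close>
      by (metis Ck_on.simps(2) frechet_derivative_works has_derivative_transform_within_open)
    then have eq: "frechet_derivative g' (at x) = frechet_derivative f' (at x)" if "x \<in> S" for x
      using frechet_derivative_at that by metis
    have "Ck_on k S (\<lambda>x. frechet_derivative g' (at x) v)" for v
      using Suc.IH[of "\<lambda>x. frechet_derivative f' (at x) v" "\<lambda>x. frechet_derivative g' (at x) v"]
        *(1) \<open>open S\<close> eq by simp
    then show ?thesis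
      using der unfolding Ck_on.simps differentiable_def by blast
  qed
  show ?case
    using imp[of f g] imp[of g f] Suc.prems by metis
qed

lemma Ck_on_SucD:
  assumes "Ck_on (Suc k) S f" "x \<in> S"
  shows "(f has_derivative frechet_derivative f (at x)) (at x)"
  using assms by (simp add: frechet_derivative_works)

lemma Ck_on_SucI:
  assumes "open S" "\<And>x. x \<in> S \<Longrightarrow> (f has_derivative f' x) (at x)"
    and "\<And>v. Ck_on k S (\<lambda>x. f' x v)"
  shows "Ck_on (Suc k) S f"
proof -
  have "Ck_on k S (\<lambda>x. frechet_derivative f (at x) v)" for v
    using Ck_on_cong[OF assms(1), of "\<lambda>x. f' x v" "\<lambda>x. frechet_derivative f (at x) v"]
      assms(2,3) frechet_derivative_at by metis
  then show ?thesis
    using assms(2) by (auto simp: differentiable_def)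
qed

lemma Ck_on_Suc_imp: "Ck_on (Suc k) S f \<Longrightarrow> Ck_on k S f"
proof (induction k arbitrary: f)
  case 0
  then show ?case
    by (auto intro!: continuous_at_imp_continuous_on differentiable_imp_continuous_within)
next
  case (Suc k)
  then show ?case by (metis Ck_on.simps(2))
qed

lemma Ck_on_mono: "Ck_on k S f \<Longrightarrow> j \<le> k \<Longrightarrow> Ck_on j S f"
  by (induction k) (auto simp: le_Suc_eq simp del: Ck_on.simps dest: Ck_on_Suc_imp)

lemma Ck_on_subset: "Ck_on k S f \<Longrightarrow> T \<subseteq> S \<Longrightarrow> Ck_on k T f"
  by (induction k arbitrary: f) (auto intro: continuous_on_subset)

lemma Ck_on_const: "Ck_on k S (\<lambda>x. c)"
  by (induction k arbitrary: c) auto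

lemma Ck_on_bounded_linear:
  assumes "bounded_linear L" "open S" "Ck_on k S f"
  shows "Ck_on k S (\<lambda>x. L (f x))"
  using assms(3)
proof (induction k arbitrary: f)
  case 0
  then show ?case
    using assms(1) by (simp add: bounded_linear.continuous_on)
next
  case (Suc k)
  show ?case
  proof (rule Ck_on_SucI[OF \<open>open S\<close>])
    show "((\<lambda>x. L (f x)) has_derivative (\<lambda>v. L (frechet_derivative f (at x) v))) (at x)"
      if "x \<in> S" for x
      using bounded_linear.has_derivative[OF assms(1) Ck_on_SucD[OF Suc.prems that]] .
    show "Ck_on k S (\<lambda>x. L (frechet_derivative f (at x) v))" for v
      using Suc by simp
  qed
qed

lemma Ck_on_ident: "Ck_on k S (\<lambda>x. x)"
  by (cases k) (auto simp: Ck_on_const)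

lemma Ck_on_linear:
  fixes L :: "'a::euclidean_space \<Rightarrow> 'b::real_normed_vector"
  assumes "linear L" "open S"
  shows "Ck_on k S L"
  using Ck_on_bounded_linear[OF _ assms(2) Ck_on_ident] assms(1) linear_conv_bounded_linear by blast

lemma Ck_on_add:
  assumes "open S" "Ck_on k S f" "Ck_on k S g"
  shows "Ck_on k S (\<lambda>x. f x + g x)"
  using assms(2,3)
proof (induction k arbitrary: f g)
  case 0
  then show ?case by (simp add: continuous_on_add)
next
  case (Suc k)
  show ?case
  proof (rule Ck_on_SucI[OF \<open>open S\<close>])
    show "((\<lambda>x. f x + g x) has_derivative
        (\<lambda>v. frechet_derivative f (at x) v + frechet_derivative g (at x) v)) (at x)"
      if "x \<in> S" for x
      by (intro has_derivative_add Ck_on_SucD[OF Suc.prems(1) that] Ck_on_SucD[OF Suc.prems(2) that])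
    show "Ck_on k S (\<lambda>x. frechet_derivative f (at x) v + frechet_derivative g (at x) v)" for v
      using Suc by simp
  qed
qed

lemma Ck_on_sum:
  assumes "open S" "\<And>i. i \<in> I \<Longrightarrow> Ck_on k S (f i)"
  shows "Ck_on k S (\<lambda>x. \<Sum>i\<in>I. f i x)"
  using assms(2)
  by (induction I rule: infinite_finite_induct) (auto intro: Ck_on_const Ck_on_add[OF assms(1)])

lemma Ck_on_bounded_bilinear:
  assumes B: "bounded_bilinear B" and "open S" "Ck_on k S f" "Ck_on k S g"
  shows "Ck_on k S (\<lambda>x. B (f x) (g x))"
  using assms(3,4)
proof (induction k arbitrary: f g)
  case 0
  then show ?case by (simp add: bounded_bilinear.continuous_on[OF B])
next
  case (Suc k)
  show ?case
  proof (rule Ck_on_SucI[OF \<open>open S\<close>])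
    show "((\<lambda>x. B (f x) (g x)) has_derivative
        (\<lambda>v. B (f x) (frechet_derivative g (at x) v) + B (frechet_derivative f (at x) v) (g x))) (at x)"
      if "x \<in> S" for x
      by (intro bounded_bilinear.FDERIV[OF B] Ck_on_SucD[OF Suc.prems(1) that] Ck_on_SucD[OF Suc.prems(2) that])
    have "Ck_on k S f" "Ck_on k S g"
      using Suc.prems by (auto intro: Ck_on_Suc_imp simp del: Ck_on.simps)
    then show "Ck_on k S (\<lambda>x. B (f x) (frechet_derivative g (at x) v) + B (frechet_derivative f (at x) v) (g x))" for v
      using Suc.prems by (intro Ck_on_add[OF \<open>open S\<close>] Suc.IH) auto
  qed
qed

lemma Ck_on_compose:
  fixes f :: "'a::euclidean_space \<Rightarrow> 'b::euclidean_space" and g :: "'b \<Rightarrow> 'c::real_normed_vector"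
  assumes "open S" "open T" "Ck_on k S f" "Ck_on k T g" "f ` S \<subseteq> T"
  shows "Ck_on k S (\<lambda>x. g (f x))"
  using assms(3,4)
proof (induction k arbitrary: g)
  case 0
  then show ?case
    using continuous_on_compose2[of T g S f] assms(5) by auto
next
  case (Suc k)
  let ?F = "\<lambda>x. frechet_derivative f (at x)" and ?G = "\<lambda>y. frechet_derivative g (at y)"
  \<comment> \<open>In the chain rule the argument of the derivative of \<open>g\<close> moves with
    x, whereas \<open>Ck_on\<close> speaks of fixed directions. Expanding in the basis leaves
    products of functions of class C^k.\<close>
  have expand: "?G (f x) (?F x v) = (\<Sum>b\<in>Basis. (?F x v \<bullet> b) *\<^sub>R ?G (f x) b)" if "x \<in> S" for x v
  proof -
    have "linear (?G (f x))"
      using Ck_on_SucD[OF Suc.prems(2)] that assms(5) has_derivative_linear by blast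
    then have "?G (f x) (\<Sum>b\<in>Basis. (?F x v \<bullet> b) *\<^sub>R b) = (\<Sum>b\<in>Basis. (?F x v \<bullet> b) *\<^sub>R ?G (f x) b)"
      by (simp add: linear_sum linear_scale)
    then show ?thesis by (simp add: euclidean_representation)
  qed
  show ?case
  proof (rule Ck_on_SucI[OF \<open>open S\<close>])
    show "((\<lambda>x. g (f x)) has_derivative (\<lambda>v. ?G (f x) (?F x v))) (at x)" if "x \<in> S" for x
      using diff_chain_at[OF Ck_on_SucD[OF Suc.prems(1) that] Ck_on_SucD[OF Suc.prems(2)]] that assms(5)
      by (auto simp: o_def)
    have "Ck_on k S (\<lambda>x. \<Sum>b\<in>Basis. (?F x v \<bullet> b) *\<^sub>R ?G (f x) b)" for v
    proof (intro Ck_on_sum[OF \<open>open S\<close>] Ck_on_bounded_bilinear[OF bounded_bilinear_scaleR \<open>open S\<close>])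
      show "Ck_on k S (\<lambda>x. ?F x v \<bullet> b)" for b
        using Suc.prems(1) by (intro Ck_on_bounded_linear[OF bounded_linear_inner_left \<open>open S\<close>]) simp
      show "Ck_on k S (\<lambda>x. ?G (f x) b)" for b
        using Suc.prems Ck_on_Suc_imp[OF Suc.prems(1)] by (intro Suc.IH) auto
    qed
    then show "Ck_on k S (\<lambda>x. ?G (f x) (?F x v))" for v
      using Ck_on_cong[OF \<open>open S\<close>, of "\<lambda>x. ?G (f x) (?F x v)"] expand by (metis (no_types, lifting))
  qed
qed

lemma pseudo_holomorphicI:
  assumes "open S" "f ` S \<subseteq> S'" "\<And>z. z \<in> S \<Longrightarrow> (f has_derivative f' z) (at z)"
    and "\<And>v. continuous_on S (\<lambda>z. f' z v)" "\<And>z v. z \<in> S \<Longrightarrow> f' z (J z v) = J' (f z) (f' z v)"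
  shows "pseudo_holomorphic S J S' J' f"
proof -
  have "frechet_derivative f (at z) = f' z" if "z \<in> S" for z
    using assms(3)[OF that] frechet_derivative_at by metis
  then show ?thesis
    using assms Ck_on_SucI[of S f f' 0] by (auto simp: pseudo_holomorphic_def fun_eq_iff)
qed

lemma pseudo_holomorphicD:
  assumes "pseudo_holomorphic S J S' J' f" "z \<in> S"
  shows "(f has_derivative frechet_derivative f (at z)) (at z)"
    and "frechet_derivative f (at z) (J z v) = J' (f z) (frechet_derivative f (at z) v)"
    and "f z \<in> S'"
  using assms Ck_on_SucD[of 0 S f z] by (auto simp: pseudo_holomorphic_def fun_eq_iff)

lemma pseudo_holomorphic_subset:
  assumes "pseudo_holomorphic S J S' J' f" "T \<subseteq> S" "f ` T \<subseteq> T'"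
  shows "pseudo_holomorphic T J T' J' f"
  using assms Ck_on_subset[of 1 S f T] unfolding pseudo_holomorphic_def by blast

lemma pseudo_holomorphic_compose:
  assumes "open S" "open S'" "pseudo_holomorphic S J S' J' f" "pseudo_holomorphic S' J' S'' J'' g"
  shows "pseudo_holomorphic S J S'' J'' (\<lambda>x. g (f x))"
proof -
  have C: "Ck_on 1 S (\<lambda>x. g (f x))"
    using assms by (intro Ck_on_compose[of S S' 1 f g]) (auto simp: pseudo_holomorphic_def)
  have eq: "frechet_derivative (\<lambda>x. g (f x)) (at z) = (\<lambda>v. frechet_derivative g (at (f z)) (frechet_derivative f (at z) v))"
    if "z \<in> S" for z
    using diff_chain_at[OF pseudo_holomorphicD(1)[OF assms(3) that]
        pseudo_holomorphicD(1)[OF assms(4) pseudo_holomorphicD(3)[OF assms(3) that]]]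
      frechet_derivative_at by (fastforce simp: o_def)
  show ?thesis
    unfolding pseudo_holomorphic_def
    using C eq pseudo_holomorphicD[OF assms(3)] pseudo_holomorphicD[OF assms(4)]
    by (auto simp: fun_eq_iff)
qed

subsection \<open>Symmetry of the second derivative\<close>

text \<open>The mean value theorem is applied in the direction v, to a difference in the direction
  w, so that only the derivative of \<open>f1 y v\<close> at x enters. Since the second difference
  is symmetric in v and w, exchanging them yields the symmetry of the second derivative.\<close>

lemma second_difference_quotient:
  fixes f :: "'a::real_normed_vector \<Rightarrow> real"
  assumes U: "open U" "x \<in> U" and f1: "\<And>y. y \<in> U \<Longrightarrow> (f has_derivative f1 y) (at y)"
    and f2: "((\<lambda>y. f1 y v) has_derivative S) (at x)"
  shows "((\<lambda>t. (f (x + t *\<^sub>R v + t *\<^sub>R w) - f (x + t *\<^sub>R v) - f (x + t *\<^sub>R w) + f x) / t\<^sup>2)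
          \<longlongrightarrow> S w) (at_right 0)"
proof (rule tendstoI)
  fix e :: real assume "e > 0"
  define M where "M = norm v + norm w + 1"
  have "M > 0" by (simp add: M_def add_nonneg_pos)
  \<comment> \<open>Two first-order errors of at most \<open>e' * (t * M)\<close> each will occur,
    together at most half of \<open>t * e\<close>.\<close>
  define e' where "e' = e / (4 * M)"
  have "e' > 0" using \<open>e > 0\<close> \<open>M > 0\<close> by (simp add: e'_def)
  interpret S: bounded_linear S using f2 has_derivative_bounded_linear by blast
  obtain d where d: "d > 0" "\<And>y. norm (y - x) < d \<Longrightarrow>
      norm (f1 y v - f1 x v - S (y - x)) \<le> e' * norm (y - x)"
    using f2 \<open>e' > 0\<close> unfolding has_derivative_at_alt by blast
  obtain r where r: "r > 0" "ball x r \<subseteq> U" using U open_contains_ball by blast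
  have "\<forall>\<^sub>F t in at_right 0. 0 < t \<and> t < min d r / M"
    using d r \<open>M > 0\<close> by (intro eventually_at_right_less eventually_conj eventually_at_right[THEN iffD2] exI[of _ "min d r / M"]) auto
  then show "\<forall>\<^sub>F t in at_right 0. dist ((f (x + t *\<^sub>R v + t *\<^sub>R w) - f (x + t *\<^sub>R v) - f (x + t *\<^sub>R w) + f x) / t\<^sup>2) (S w) < e"
  proof eventually_elim
    case (elim t)
    then have t: "t > 0" "t * M < d" "t * M < r" using \<open>M > 0\<close> by (auto simp: field_simps)
    have small: "norm (s *\<^sub>R v + u *\<^sub>R w) \<le> t * M" if "0 \<le> s" "s \<le> t" "0 \<le> u" "u \<le> t" for s u
    proof -
      have "norm (s *\<^sub>R v + u *\<^sub>R w) \<le> s * norm v + u * norm w"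
        using that norm_triangle_ineq[of "s *\<^sub>R v" "u *\<^sub>R w"] by simp
      also have "\<dots> \<le> t * norm v + t * norm w"
        using that by (intro add_mono mult_right_mono) auto
      also have "\<dots> \<le> t * M" using t by (simp add: M_def algebra_simps)
      finally show ?thesis .
    qed
    have inU: "x + (s *\<^sub>R v + u *\<^sub>R w) \<in> U" if "0 \<le> s" "s \<le> t" "0 \<le> u" "u \<le> t" for s u
    proof -
      have "dist (x + (s *\<^sub>R v + u *\<^sub>R w)) x < r"
        unfolding dist_norm add_diff_cancel_left' using small[OF that] t by linarith
      then show ?thesis using r by (auto simp: dist_commute)
    qed
    define g where "g s = f (x + (s *\<^sub>R v + t *\<^sub>R w)) - f (x + (s *\<^sub>R v + 0 *\<^sub>R w))" for s
    have "\<exists>z. 0 < z \<and> z < t \<and> g t - g 0 = (t - 0) * (f1 (x + (z *\<^sub>R v + t *\<^sub>R w)) v - f1 (x + (z *\<^sub>R v + 0 *\<^sub>R w)) v)"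
    proof (rule MVT2[OF t(1)])
      fix s assume s: "0 \<le> s" "s \<le> t"
      have "((\<lambda>s. f (x + (s *\<^sub>R v + u *\<^sub>R w))) has_real_derivative f1 (x + (s *\<^sub>R v + u *\<^sub>R w)) v) (at s)"
        if "0 \<le> u" "u \<le> t" for u
      proof -
        have lin: "linear (f1 (x + (s *\<^sub>R v + u *\<^sub>R w)))"
          using f1[OF inU] s that has_derivative_linear by blast
        have "((\<lambda>s. f (x + (s *\<^sub>R v + u *\<^sub>R w))) has_derivative (\<lambda>h. f1 (x + (s *\<^sub>R v + u *\<^sub>R w)) (h *\<^sub>R v))) (at s)"
          by (rule has_derivative_compose[where g = f and f = "\<lambda>s. x + (s *\<^sub>R v + u *\<^sub>R w)"])
            (use f1[OF inU] s that in \<open>auto intro!: derivative_eq_intros\<close>)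
        moreover have "(\<lambda>h. f1 (x + (s *\<^sub>R v + u *\<^sub>R w)) (h *\<^sub>R v)) = (*) (f1 (x + (s *\<^sub>R v + u *\<^sub>R w)) v)"
          by (simp add: fun_eq_iff linear_scale[OF lin])
        ultimately show ?thesis
          unfolding has_field_derivative_def by simp
      qed
      from DERIV_diff[OF this[of t] this[of 0]] t
      show "(g has_real_derivative f1 (x + (s *\<^sub>R v + t *\<^sub>R w)) v - f1 (x + (s *\<^sub>R v + 0 *\<^sub>R w)) v) (at s)"
        unfolding g_def[abs_def] by auto
    qed
    then obtain z where z: "0 < z" "z < t"
      "g t - g 0 = t * (f1 (x + (z *\<^sub>R v + t *\<^sub>R w)) v - f1 (x + (z *\<^sub>R v + 0 *\<^sub>R w)) v)" by auto
    have est: "\<bar>f1 (x + (z *\<^sub>R v + u *\<^sub>R w)) v - f1 x v - S (z *\<^sub>R v + u *\<^sub>R w)\<bar> \<le> e' * (t * M)"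
      if "0 \<le> u" "u \<le> t" for u
      using d(2)[of "x + (z *\<^sub>R v + u *\<^sub>R w)"] small[of z u] that z t \<open>e' > 0\<close>
      by (auto intro: order_trans[OF _ mult_left_mono])
    have "\<bar>f1 (x + (z *\<^sub>R v + t *\<^sub>R w)) v - f1 (x + (z *\<^sub>R v + 0 *\<^sub>R w)) v - t * S w\<bar> \<le> 2 * (e' * (t * M))"
      using est[of t] est[of 0] t by (simp add: S.add S.scaleR)
    then have "t * \<bar>f1 (x + (z *\<^sub>R v + t *\<^sub>R w)) v - f1 (x + (z *\<^sub>R v + 0 *\<^sub>R w)) v - t * S w\<bar> \<le> t * (2 * (e' * (t * M)))"
      using t by (intro mult_left_mono) auto
    moreover have "t * \<bar>f1 (x + (z *\<^sub>R v + t *\<^sub>R w)) v - f1 (x + (z *\<^sub>R v + 0 *\<^sub>R w)) v - t * S w\<bar> = \<bar>g t - g 0 - t\<^sup>2 * S w\<bar>"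
    proof -
      have "\<bar>t * a\<bar> = t * \<bar>a\<bar>" for a :: real using t by (simp add: abs_mult)
      from this[symmetric] show ?thesis
        unfolding z(3) by (simp only: power2_eq_square right_diff_distrib mult.assoc)
    qed
    ultimately have "\<bar>g t - g 0 - t\<^sup>2 * S w\<bar> \<le> t\<^sup>2 * (2 * e' * M)" by (simp add: power2_eq_square algebra_simps)
    also have "\<dots> < t\<^sup>2 * e" using t \<open>e > 0\<close> \<open>M > 0\<close> by (simp add: e'_def)
    finally have "\<bar>(g t - g 0 - t\<^sup>2 * S w) / t\<^sup>2\<bar> < e" using t by (simp add: abs_divide field_simps)
    moreover have "(g t - g 0 - t\<^sup>2 * S w) / t\<^sup>2 = (g t - g 0) / t\<^sup>2 - S w" using t by (simp add: field_simps)
    moreover have "g t - g 0 = f (x + t *\<^sub>R v + t *\<^sub>R w) - f (x + t *\<^sub>R v) - f (x + t *\<^sub>R w) + f x"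
      by (simp add: g_def add.assoc)
    ultimately show ?case unfolding dist_real_def by (simp only:)
  qed
qed

lemma symmetric_second_derivative:
  fixes f :: "'a::real_normed_vector \<Rightarrow> 'b::euclidean_space"
  assumes U: "open U" "x \<in> U" and f1: "\<And>y. y \<in> U \<Longrightarrow> (f has_derivative f1 y) (at y)"
    and f2: "\<And>v. ((\<lambda>y. f1 y v) has_derivative (\<lambda>w. S w v)) (at x)"
  shows "S v w = S w v"
proof (rule euclidean_eqI)
  fix b :: 'b assume "b \<in> Basis"
  let ?f = "\<lambda>y. f y \<bullet> b"
  have g1: "(?f has_derivative (\<lambda>h. f1 y h \<bullet> b)) (at y)" if "y \<in> U" for y
    using f1[OF that] by (intro derivative_eq_intros) auto
  have g2: "((\<lambda>y. f1 y v \<bullet> b) has_derivative (\<lambda>w. S w v \<bullet> b)) (at x)" for v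
    using f2[of v] by (intro derivative_eq_intros) auto
  have "((\<lambda>t. (?f (x + t *\<^sub>R v + t *\<^sub>R w) - ?f (x + t *\<^sub>R v) - ?f (x + t *\<^sub>R w) + ?f x) / t\<^sup>2)
      \<longlongrightarrow> S w v \<bullet> b) (at_right 0)"
    by (rule second_difference_quotient[OF U g1 g2])
  moreover have "((\<lambda>t. (?f (x + t *\<^sub>R w + t *\<^sub>R v) - ?f (x + t *\<^sub>R w) - ?f (x + t *\<^sub>R v) + ?f x) / t\<^sup>2)
      \<longlongrightarrow> S v w \<bullet> b) (at_right 0)"
    by (rule second_difference_quotient[OF U g1 g2])
  then have "((\<lambda>t. (?f (x + t *\<^sub>R v + t *\<^sub>R w) - ?f (x + t *\<^sub>R v) - ?f (x + t *\<^sub>R w) + ?f x) / t\<^sup>2)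
      \<longlongrightarrow> S v w \<bullet> b) (at_right 0)"
    by (simp add: algebra_simps)
  ultimately show "S v w \<bullet> b = S w v \<bullet> b"
    using tendsto_unique[OF trivial_limit_at_right_real] by blast
qed

section \<open>Model structures in normal form\<close>

definition model_J :: "(complex ^ 'm \<Rightarrow> complex ^ 'm \<Rightarrow> complex) \<Rightarrow> 'm::finite cspace \<Rightarrow> 'm cspace \<Rightarrow> 'm cspace" where
  "model_J \<beta> z v = (\<i> *s fst v, \<i> * snd v + \<beta> (fst z) (fst v))"

lemma bounded_bilinear_vector_scalar_mult:
  "bounded_bilinear ((*s) :: complex \<Rightarrow> complex ^ 'm::finite \<Rightarrow> complex ^ 'm)"
  unfolding bilinear_conv_bounded_bilinear[symmetric] bilinear_def
  by (auto intro!: linearI simp: vec_eq_iff algebra_simps)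

lemmas has_derivative_vector_scalar_mult [derivative_intros] =
  bounded_bilinear.FDERIV[OF bounded_bilinear_vector_scalar_mult]

lemmas continuous_on_vector_scalar_mult [continuous_intros] =
  bounded_bilinear.continuous_on[OF bounded_bilinear_vector_scalar_mult]

lemma linear_complex_multiple:
  assumes "linear D" "\<And>x. D (\<i> * x) = \<i> * D x"
  shows "D x = D 1 * (x::complex)"
proof -
  have "D x = D (Re x *\<^sub>R 1 + Im x *\<^sub>R (\<i> * 1))"
    by (rule arg_cong[of _ _ D]) (simp add: complex_eq_iff)
  also have "\<dots> = D 1 * x"
    by (simp only: linear_add[OF assms(1)] linear_scale[OF assms(1)] assms(2)) (simp add: complex_eq_iff)
  finally show ?thesis .
qed

lemma has_derivative_imp_field_differentiable:
  assumes "(f has_derivative D) (at z)" "\<And>\<xi>. D (\<i> * \<xi>) = \<i> * D \<xi>"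
  shows "f field_differentiable (at z)"
proof -
  have "(*) (D 1) = D"
    by (intro ext linear_complex_multiple[symmetric] has_derivative_linear[OF assms(1)] assms(2))
  then have "(f has_field_derivative D 1) (at z)"
    unfolding has_field_derivative_def using assms(1) by simp
  then show ?thesis unfolding field_differentiable_def by blast
qed

definition cscale :: "complex \<Rightarrow> 'm::finite cspace \<Rightarrow> 'm cspace" where
  "cscale c z = (c *s fst z, c * snd z)"

lemma bounded_bilinear_cscale: "bounded_bilinear (cscale :: _ \<Rightarrow> 'm::finite cspace \<Rightarrow> _)"
  unfolding bilinear_conv_bounded_bilinear[symmetric] bilinear_def
  by (auto intro!: linearI simp: cscale_def vec_eq_iff algebra_simps)

lemma cscale_cscale [simp]: "cscale a (cscale b z) = cscale (a * b) z"
  by (simp add: cscale_def vector_smult_assoc mult.assoc)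

lemma cscale_one [simp]: "cscale 1 z = z"
  by (simp add: cscale_def)

lemma norm_vector_scalar_mult_complex: "norm (c *s (x :: complex ^ 'm::finite)) = norm c * norm x"
  by (simp add: norm_vec_def norm_mult L2_set_right_distrib)

text \<open>Turns an identity known only on a hypersurface or on a Segre variety into a linear
  relation for the derivative, by restriction to a curve in that set.\<close>

lemma derivative_along_curve_eq_0:
  fixes g :: "'a::real_normed_vector \<Rightarrow> 'b::real_normed_vector"
  assumes g: "(g has_derivative g') (at (\<gamma> 0))"
    and \<gamma>: "(\<gamma> has_vector_derivative v) (at 0)"
    and ev: "\<forall>\<^sub>F t in nhds (0::real). g (\<gamma> t) = c"
  shows "g' v = 0"
proof -
  have lin: "linear g'" using g has_derivative_linear by blast
  have "((\<lambda>t. g (\<gamma> t)) has_derivative (\<lambda>h. g' (h *\<^sub>R v))) (at 0)"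
    using has_derivative_compose[OF \<gamma>[unfolded has_vector_derivative_def] g] .
  moreover have "((\<lambda>t. g (\<gamma> t)) has_derivative (\<lambda>h. 0)) (at 0)"
  proof (rule has_derivative_transform_eventually[OF has_derivative_const[of c]])
    show "\<forall>\<^sub>F t in at 0. c = g (\<gamma> t)"
      unfolding eventually_at_filter by (rule eventually_mono[OF ev]) simp
    show "c = g (\<gamma> 0)" using eventually_nhds_x_imp_x[OF ev] by (rule sym)
  qed simp
  ultimately have "(\<lambda>h. g' (h *\<^sub>R v)) = (\<lambda>h. 0)" by (rule has_derivative_unique)
  then have "g' (1 *\<^sub>R v) = 0" by meson
  then show ?thesis by simp
qed

lemma eventually_curve_in:
  fixes \<gamma> :: "real \<Rightarrow> 'a::topological_space"
  assumes "continuous (at 0) \<gamma>" "\<gamma> 0 \<in> G" "open G"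
  shows "\<forall>\<^sub>F t in nhds 0. \<gamma> t \<in> G"
proof -
  have "\<forall>\<^sub>F t in at 0. \<gamma> t \<in> G"
    using topological_tendstoD[OF assms(1)[unfolded continuous_at] assms(3)] assms(2) by blast
  then show ?thesis using assms(2) by (auto simp: eventually_at_filter elim: eventually_mono)
qed

text \<open>Pseudo-holomorphic functions with values in the complex plane. A derivative at each
  point suffices here, because composition with a disc leads to one variable, where complex
  differentiability gives holomorphy.\<close>

definition J_function_on :: "'a::euclidean_space set \<Rightarrow> ('a \<Rightarrow> 'a \<Rightarrow> 'a) \<Rightarrow> ('a \<Rightarrow> complex) \<Rightarrow> bool" where
  "J_function_on S J h \<longleftrightarrow> (\<forall>z\<in>S. \<exists>h'. (h has_derivative h') (at z) \<and> (\<forall>v. h' (J z v) = \<i> * h' v))"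

lemma J_function_on_subset: "J_function_on S J h \<Longrightarrow> T \<subseteq> S \<Longrightarrow> J_function_on T J h"
  by (auto simp: J_function_on_def)

text \<open>Antilinearity carries over to the second argument by alternation
  (\<open>\<beta>_scale_right\<close>); there it expresses that \<open>model_J\<close> squares to
  -1. Alternation is also what allows the discs to be real affine.\<close>

locale alternating_form =
  fixes \<beta> :: "complex ^ 'm::finite \<Rightarrow> complex ^ 'm \<Rightarrow> complex"
  assumes bilinear_\<beta>: "bounded_bilinear \<beta>"
    and \<beta>_scale_left: "\<beta> (c *s x) y = cnj c * \<beta> x y"
    and \<beta>_swap: "\<beta> x y = - \<beta> y x"
begin

sublocale \<beta>: bounded_bilinear \<beta> by (rule bilinear_\<beta>)

lemma \<beta>_scale_right: "\<beta> x (c *s y) = cnj c * \<beta> x y"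
  using \<beta>_scale_left[of c y x] \<beta>_swap[of x y] \<beta>_swap[of x "c *s y"] by simp

lemma \<beta>_self: "\<beta> x x = 0"
  using \<beta>_swap[of x x] by simp

abbreviation "J \<equiv> model_J \<beta>"

text \<open>The J-holomorphic discs used here are real affine, so that any two points of a ball lie on
  a disc whose part in the ball is connected.\<close>

lemma J_function_zero_on_ball:
  fixes h :: "'m cspace \<Rightarrow> complex"
  assumes h: "J_function_on (ball q r) J h" and W: "open W" "z0 \<in> W" "z0 \<in> ball q r"
    and zero: "\<And>z. z \<in> W \<Longrightarrow> z \<in> ball q r \<Longrightarrow> h z = 0" and z1: "z1 \<in> ball q r"
  shows "h z1 = 0"
proof -
  define v where "v = fst z1 - fst z0"
  \<comment> \<open>J-holomorphy of \<open>u\<close> amounts to -2 i k =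
    \<open>\<beta> (fst z0) v\<close>, since \<beta> vanishes on two multiples of v. Then
    \<open>a\<close> is chosen to place \<open>z1\<close> at the parameter 1.\<close>
  define k where "k = \<i> / 2 * \<beta> (fst z0) v"
  define a where "a = snd z1 - snd z0 - k"
  define L where "L \<zeta> = (\<zeta> *s v, \<zeta> * a + cnj \<zeta> * k)" for \<zeta>
  define u where "u \<zeta> = z0 + L \<zeta>" for \<zeta>
  have linL: "linear L"
    by (rule linearI) (auto simp: L_def algebra_simps vec_eq_iff)
  have u01: "u 0 = z0" "u 1 = z1"
    by (auto simp: u_def L_def v_def a_def prod_eq_iff)
  have contu: "continuous_on UNIV u"
    unfolding u_def using linL by (intro continuous_intros) (simp add: linear_continuous_on linear_linear)
  define S where "S = u -` ball q r"
  have "open S" unfolding S_def by (intro open_vimage contu open_ball)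
  have "convex S"
  proof (rule convexI)
    fix x y s t assume *: "x \<in> S" "y \<in> S" "0 \<le> s" "0 \<le> t" "s + t = (1::real)"
    have "u (s *\<^sub>R x + t *\<^sub>R y) = s *\<^sub>R u x + t *\<^sub>R u y"
      using *(5) by (simp add: u_def linear_add[OF linL] linear_scale[OF linL] algebra_simps flip: scaleR_add_left)
    then show "s *\<^sub>R x + t *\<^sub>R y \<in> S"
      using * convexD[OF convex_ball, of "u x" q r "u y" s t] by (simp add: S_def)
  qed
  have hol: "(\<lambda>\<zeta>. h (u \<zeta>)) holomorphic_on S"
    unfolding holomorphic_on_def
  proof
    fix \<zeta> assume "\<zeta> \<in> S"
    then have "u \<zeta> \<in> ball q r" by (simp add: S_def)
    then obtain h' where h': "(h has_derivative h') (at (u \<zeta>))" "\<And>v. h' (J (u \<zeta>) v) = \<i> * h' v"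
      using h unfolding J_function_on_def by blast
    have "(u has_derivative L) (at \<zeta>)"
      unfolding u_def[abs_def] using linear_imp_has_derivative[OF linL]
      by (auto intro!: derivative_eq_intros)
    then have "((\<lambda>\<zeta>. h (u \<zeta>)) has_derivative (\<lambda>\<xi>. h' (L \<xi>))) (at \<zeta>)"
      using has_derivative_compose h'(1) by blast
    moreover have "L (\<i> * \<xi>) = J (u \<zeta>) (L \<xi>)" for \<xi>
      by (simp add: L_def model_J_def u_def \<beta>.add_left \<beta>_scale_left \<beta>_scale_right \<beta>_self k_def
          vector_smult_assoc) (simp add: algebra_simps)
    ultimately have "(\<lambda>\<zeta>. h (u \<zeta>)) field_differentiable at \<zeta>"
      by (intro has_derivative_imp_field_differentiable[where D = "\<lambda>\<xi>. h' (L \<xi>)"]) (simp_all add: h'(2))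
    then show "(\<lambda>\<zeta>. h (u \<zeta>)) field_differentiable at \<zeta> within S"
      using field_differentiable_at_within by blast
  qed
  have "open (u -` W \<inter> S)" using W \<open>open S\<close> contu by (intro open_Int open_vimage)
  moreover have "0 \<in> u -` W \<inter> S" "1 \<in> S" using W u01 z1 by (auto simp: S_def)
  moreover have "h (u \<zeta>) = 0" if "\<zeta> \<in> u -` W \<inter> S" for \<zeta>
    using that by (intro zero) (simp_all add: S_def)
  ultimately have "h (u 1) = 0"
    by (intro analytic_continuation_open[of "u -` W \<inter> S" S "\<lambda>\<zeta>. h (u \<zeta>)" "\<lambda>_. 0" 1]
        \<open>open S\<close> convex_connected[OF \<open>convex S\<close>] hol holomorphic_on_const) auto
  then show ?thesis using u01 by simp
qed

text \<open>The interior of the zero set is relatively closed: a ball about a limit point meets it,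
  and \<open>J_function_zero_on_ball\<close> spreads the zeros over the whole ball.\<close>

lemma J_function_unique_continuation:
  fixes h :: "'m cspace \<Rightarrow> complex"
  assumes U: "open U" "connected U" and h: "J_function_on U J h"
    and W: "open W" "p \<in> W" "p \<in> U" and zero: "\<And>z. z \<in> W \<Longrightarrow> z \<in> U \<Longrightarrow> h z = 0" and z: "z \<in> U"
  shows "h z = 0"
proof -
  define Z where "Z = interior {z \<in> U. h z = 0}"
  have "Z \<subseteq> U" "open Z" unfolding Z_def using interior_subset by auto
  have "p \<in> Z" unfolding Z_def by (rule interiorI[of "W \<inter> U"]) (use U W zero in auto)
  have "q \<in> Z" if q: "q \<in> U" "q \<in> closure Z" for q
  proof -
    obtain r where r: "r > 0" "ball q r \<subseteq> U" using U q open_contains_ball by blast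
    obtain z0 where z0: "z0 \<in> Z" "z0 \<in> ball q r"
      using q(2) r(1) by (auto simp: closure_approachable dist_commute)
    have "h y = 0" if "y \<in> Z" for y
      using that interior_subset unfolding Z_def by blast
    then have "h y = 0" if "y \<in> ball q r" for y
      using J_function_zero_on_ball[OF J_function_on_subset[OF h r(2)] \<open>open Z\<close> z0 _ that] by auto
    then show "q \<in> Z"
      unfolding Z_def using r by (intro interiorI[of "ball q r"]) auto
  qed
  then have "closedin (top_of_set U) Z"
    using \<open>Z \<subseteq> U\<close> by (auto simp: closedin_closed intro!: exI[of _ "closure Z"] dest: closure_subset[THEN subsetD])
  then have "Z = U"
    using U(2) \<open>p \<in> Z\<close> \<open>Z \<subseteq> U\<close> \<open>open Z\<close> connected_clopen[of U] openin_open_eq[OF U(1)] by blast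
  then show ?thesis using z interior_subset unfolding Z_def by blast
qed

end

text \<open>The Hermitian form H takes the place of the standard one, so that no orthonormal basis
  has to be chosen.\<close>

locale normal_form = alternating_form \<beta> for \<beta> :: "complex ^ 'm::finite \<Rightarrow> complex ^ 'm \<Rightarrow> complex" +
  fixes H :: "complex ^ 'm \<Rightarrow> complex ^ 'm \<Rightarrow> complex"
  assumes bilinear_H: "bounded_bilinear H"
    and H_scale_left: "H (c *s x) y = c * H x y"
    and H_swap: "H y x = cnj (H x y)"
    and H_pos: "x \<noteq> 0 \<Longrightarrow> Re (H x x) > 0"
begin

sublocale H: bounded_bilinear H by (rule bilinear_H)

lemma H_scale_right: "H x (c *s y) = cnj c * H x y"
  by (metis H_scale_left H_swap complex_cnj_mult complex_cnj_cnj)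

lemma Im_H_self [simp]: "Im (H x x) = 0"
  using H_swap[of x x] by (simp add: complex_eq_iff)

lemma H_self: "H x x = of_real (Re (H x x))"
  by (simp add: complex_eq_iff)

lemma H_nonneg: "Re (H x x) \<ge> 0"
  using H_pos[of x] by (cases "x = 0") (auto simp: H.zero_left)

lemma H_eq_0_iff: "H x x = 0 \<longleftrightarrow> x = 0"
  using H_pos[of x] H.zero_left by (metis less_irrefl zero_complex.sel(1))

definition def_fun :: "'m cspace \<Rightarrow> real" where
  "def_fun z = Re (snd z) + Re (H (fst z) (fst z))"

definition Dom :: "'m cspace set" where
  "Dom = {z. def_fun z < 0}"

lemma continuous_def_fun: "continuous_on S def_fun"
  unfolding def_fun_def by (intro continuous_intros H.continuous_on)

lemma open_Dom: "open Dom"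
proof -
  have "Dom = def_fun -` {..<0}" by (auto simp: Dom_def)
  then show ?thesis using continuous_def_fun open_vimage[of "{..<0}" def_fun] by simp
qed

end

section \<open>The integrable case\<close>

locale flat_normal_form = normal_form \<beta> H
  for \<beta> H :: "complex ^ 'm::finite \<Rightarrow> complex ^ 'm \<Rightarrow> complex" +
  assumes flat: "\<beta> x y = 0"
begin

lemma J_flat: "J z v = cscale \<i> v"
  by (simp add: model_J_def cscale_def flat)

text \<open>Homogeneous coordinates: the point z of affine space is represented by (z, 1).\<close>

definition herm :: "'m cspace \<times> complex \<Rightarrow> 'm cspace \<times> complex \<Rightarrow> complex" where
  "herm x y = 2 * H (fst (fst x)) (fst (fst y)) + snd (fst x) * cnj (snd y) + snd x * cnj (snd (fst y))"

definition hscale :: "complex \<Rightarrow> 'm cspace \<times> complex \<Rightarrow> 'm cspace \<times> complex" where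
  "hscale c x = (cscale c (fst x), c * snd x)"

text \<open>Compatibility with \<open>hscale\<close> adds complex homogeneity to real linearity.
  Positivity of \<mu> sends negative vectors to negative vectors, so that the projective map keeps
  \<open>Dom\<close> on its side of the boundary.\<close>

definition similitude :: "('m cspace \<times> complex \<Rightarrow> 'm cspace \<times> complex) \<Rightarrow> real \<Rightarrow> bool" where
  "similitude M \<mu> \<longleftrightarrow> linear M \<and> (\<forall>c x. M (hscale c x) = hscale c (M x)) \<and> inj M \<and> \<mu> > 0 \<and>
     (\<forall>x. herm (M x) (M x) = of_real \<mu> * herm x x)"

definition proj_map :: "('m cspace \<times> complex \<Rightarrow> 'm cspace \<times> complex) \<Rightarrow> 'm cspace \<Rightarrow> 'm cspace" where
  "proj_map M z = cscale (inverse (snd (M (z, 1)))) (fst (M (z, 1)))"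

lemma herm_affine: "herm (z, 1) (z, 1) = of_real (2 * def_fun z)"
  by (simp add: herm_def def_fun_def complex_eq_iff)

lemma herm_hscale: "herm (hscale c x) (hscale c x) = of_real ((cmod c)\<^sup>2) * herm x x"
  unfolding complex_norm_square herm_def hscale_def cscale_def
  by (simp add: H_scale_left H_scale_right algebra_simps)

lemma hscale_hscale: "hscale a (hscale b x) = hscale (a * b) x"
  by (simp add: hscale_def mult.assoc)

lemma hscale_one [simp]: "hscale 1 x = x"
  by (simp add: hscale_def)

text \<open>On vectors with last coordinate 0 the form reduces to 2H and is nonnegative. As points
  of \<open>Dom\<close> are represented by negative vectors, denominators cannot vanish
  there.\<close>

lemma snd_nonzero_of_herm_neg: "Re (herm x x) < 0 \<Longrightarrow> snd x \<noteq> 0"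
  using H_nonneg[of "fst (fst x)"] by (auto simp: herm_def)

lemma hscale_affine: "snd x \<noteq> 0 \<Longrightarrow> x = hscale (snd x) (cscale (inverse (snd x)) (fst x), 1)"
  by (simp add: hscale_def prod_eq_iff)

lemma similitude_denominator:
  assumes "similitude M \<mu>" "z \<in> Dom"
  shows "snd (M (z, 1)) \<noteq> 0" "M (z, 1) = hscale (snd (M (z, 1))) (proj_map M z, 1)" "proj_map M z \<in> Dom"
proof -
  have "herm (M (z, 1)) (M (z, 1)) = of_real (\<mu> * (2 * def_fun z))"
    using assms(1) herm_affine[of z] unfolding similitude_def by (metis of_real_mult)
  then have "Re (herm (M (z, 1)) (M (z, 1))) = \<mu> * (2 * def_fun z)" by simp
  then have neg: "Re (herm (M (z, 1)) (M (z, 1))) < 0"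
    using assms by (simp add: similitude_def Dom_def mult_pos_neg)
  then show nz: "snd (M (z, 1)) \<noteq> 0" by (rule snd_nonzero_of_herm_neg)
  then show eq: "M (z, 1) = hscale (snd (M (z, 1))) (proj_map M z, 1)"
    unfolding proj_map_def by (rule hscale_affine)
  have "herm (M (z, 1)) (M (z, 1)) = of_real ((cmod (snd (M (z, 1))))\<^sup>2) * of_real (2 * def_fun (proj_map M z))"
    by (subst (1 2) eq) (simp add: herm_hscale herm_affine)
  then have "Re (herm (M (z, 1)) (M (z, 1))) = (cmod (snd (M (z, 1))))\<^sup>2 * (2 * def_fun (proj_map M z))"
    by (metis Re_complex_of_real of_real_mult)
  then show "proj_map M z \<in> Dom"
    using neg nz by (simp add: Dom_def mult_less_0_iff)
qed

text \<open>Linear algebra in homogeneous coordinates: if two points have the same image,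
  multiplying each by the denominator of the other gives vectors with the same image under M; and
  the preimage of (y, 1) under M is a negative vector, hence represents an affine point.\<close>

lemma bij_betw_proj_map:
  assumes M: "similitude M \<mu>"
  shows "bij_betw (proj_map M) Dom Dom"
  unfolding bij_betw_def
proof
  have lin: "linear M" and inj: "inj M" and sc: "\<And>c x. M (hscale c x) = hscale c (M x)"
    and \<mu>: "\<mu> > 0" and form: "\<And>x. herm (M x) (M x) = of_real \<mu> * herm x x"
    using M by (auto simp: similitude_def)
  note den = similitude_denominator[OF M]
  show "inj_on (proj_map M) Dom"
  proof (rule inj_onI)
    fix z w assume *: "z \<in> Dom" "w \<in> Dom" "proj_map M z = proj_map M w"
    let ?a = "snd (M (z, 1))" and ?b = "snd (M (w, 1))"
    have "M (hscale ?b (z, 1)) = hscale (?b * ?a) (proj_map M z, 1)"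
      by (simp only: sc) (subst den(2)[OF *(1)], simp add: hscale_hscale)
    also have "\<dots> = M (hscale ?a (w, 1))"
      by (simp only: sc *(3)) (subst (2) den(2)[OF *(2)], simp add: hscale_hscale mult.commute)
    finally have "hscale ?b (z, 1) = hscale ?a (w, 1)" by (rule injD[OF inj])
    then have ab: "?b = ?a" and eq: "cscale ?b z = cscale ?a w" by (auto simp only: hscale_def prod.inject fst_conv snd_conv mult_1_right)
    have "cscale ?a z = cscale ?a w" using eq unfolding ab .
    from arg_cong[OF this, of "cscale (inverse ?a)"] show "z = w" using den(1)[OF *(1)] by simp
  qed
  show "proj_map M ` Dom = Dom"
  proof
    show "proj_map M ` Dom \<subseteq> Dom" using den(3) by blast
    show "Dom \<subseteq> proj_map M ` Dom"
    proof
      fix y assume y: "y \<in> Dom"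
      obtain x where x: "M x = (y, 1)"
        using linear_injective_imp_surjective[OF lin inj] by (metis surjD)
      have "\<mu> * Re (herm x x) = 2 * def_fun y"
        using arg_cong[OF form[of x], of Re] unfolding x herm_affine by simp
      then have "Re (herm x x) < 0" using y \<mu> by (simp add: Dom_def) (smt (verit) mult_nonneg_nonneg)
      then have nz: "snd x \<noteq> 0" by (rule snd_nonzero_of_herm_neg)
      define z where "z = cscale (inverse (snd x)) (fst x)"
      have x_eq: "x = hscale (snd x) (z, 1)" unfolding z_def by (rule hscale_affine[OF nz])
      then have "(y, 1) = hscale (snd x) (M (z, 1))" using x sc by metis
      then have Mz: "M (z, 1) = hscale (inverse (snd x)) (y, 1)" using nz by (simp add: hscale_hscale)
      have "of_real (2 * \<mu> * def_fun z) = complex_of_real ((cmod (inverse (snd x)))\<^sup>2 * (2 * def_fun y))"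
        using form[of "(z, 1)"] unfolding Mz herm_hscale herm_affine by simp
      then have "\<mu> * def_fun z = (cmod (inverse (snd x)))\<^sup>2 * def_fun y"
        unfolding of_real_eq_iff by simp
      then have "z \<in> Dom" using y \<mu> nz unfolding Dom_def mem_Collect_eq
        by (metis mult_pos_neg mult_less_0_iff norm_eq_zero not_less_iff_gr_or_eq nonzero_imp_inverse_nonzero zero_less_power2)
      moreover have "proj_map M z = y"
        using nz by (simp add: proj_map_def Mz hscale_def)
      ultimately show "y \<in> proj_map M ` Dom" by blast
    qed
  qed
qed

lemma J_automorphism_proj_map:
  assumes M: "similitude M \<mu>"
  shows "J_automorphism Dom J (proj_map M)"
  unfolding J_automorphism_def
proof
  show bij: "bij_betw (proj_map M) Dom Dom" by (rule bij_betw_proj_map[OF M])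
  have lin: "linear M" and sc: "\<And>c x. M (hscale c x) = hscale c (M x)"
    using M by (auto simp: similitude_def)
  have bl: "bounded_linear M" using lin by (simp add: linear_linear)
  let ?N = "\<lambda>z. fst (M (z, 1))" and ?s = "\<lambda>z. snd (M (z, 1))"
  let ?N' = "\<lambda>v. fst (M (v, 0))" and ?s' = "\<lambda>v. snd (M (v, 0))"
  let ?d = "\<lambda>z v. cscale (inverse (?s z)) (?N' v) + cscale (- (inverse (?s z) * ?s' v * inverse (?s z))) (?N z)"
  have dM: "((\<lambda>z. M (z, 1)) has_derivative (\<lambda>v. M (v, 0))) (at z)" for z
    by (rule bounded_linear.has_derivative[OF bl]) (auto intro!: derivative_eq_intros)
  have cM: "continuous_on S (\<lambda>z. M (z, 1))" for S
    using bl by (intro bounded_linear.continuous_on[OF bl] continuous_intros)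
  have nz: "\<And>z. z \<in> Dom \<Longrightarrow> ?s z \<noteq> 0" using similitude_denominator[OF M] by blast
  show "pseudo_holomorphic Dom J Dom J (proj_map M)"
  proof (rule pseudo_holomorphicI[OF open_Dom, of _ _ ?d])
    show "proj_map M ` Dom \<subseteq> Dom" using bij by (simp add: bij_betw_def)
    show "(proj_map M has_derivative ?d z) (at z)" if "z \<in> Dom" for z
    proof -
      have N: "(?N has_derivative ?N') (at z)" and s: "(?s has_derivative ?s') (at z)"
        by (rule has_derivative_fst[OF dM] has_derivative_snd[OF dM])+
      show ?thesis
        using bounded_bilinear.FDERIV[OF bounded_bilinear_cscale Deriv.has_derivative_inverse[OF nz[OF that] s] N]
        unfolding proj_map_def[abs_def] .
    qed
    show "continuous_on Dom (\<lambda>z. ?d z v)" for v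
    proof -
      have N: "continuous_on Dom ?N" and s: "continuous_on Dom ?s"
        by (intro continuous_on_fst continuous_on_snd cM)+
      have i: "continuous_on Dom (\<lambda>z. inverse (?s z))"
        by (intro continuous_on_inverse s ballI nz)
      show ?thesis
        by (intro continuous_on_add continuous_on_minus continuous_on_mult continuous_on_const i N
            bounded_bilinear.continuous_on[OF bounded_bilinear_cscale])
    qed
    have "M (cscale \<i> v, 0) = hscale \<i> (M (v, 0))" for v
      using sc[of \<i> "(v, 0)"] by (simp add: hscale_def)
    then show "?d z (J z v) = J (proj_map M z) (?d z v)" if "z \<in> Dom" for z v
      unfolding J_flat
      by (simp add: hscale_def bounded_bilinear.add_right[OF bounded_bilinear_cscale] algebra_simps)
  qed
qed

end

section \<open>Polarization of the boundary condition\<close>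

context flat_normal_form
begin

text \<open>The polarized defining function; \<open>polar z w = 0\<close> says that z lies on the Segre variety of w.\<close>

definition polar :: "'m cspace \<Rightarrow> 'm cspace \<Rightarrow> complex" where
  "polar z w = 2 * H (fst z) (fst w) + snd z + cnj (snd w)"

lemma polar_self: "polar z z = of_real (2 * def_fun z)"
  by (simp add: polar_def def_fun_def complex_eq_iff)

text \<open>The point of the complexified hypersurface is joined to its real points by the holomorphic
  curve s \<mapsto> (z(s), cnj (z(cnj s))), where z(s) is on the hypersurface for real s.\<close>

lemma polarization:
  assumes e: "ball 0 e \<subseteq> U" "e > 0"
    and Df: "\<And>z. z \<in> U \<Longrightarrow> (f has_derivative Df z) (at z)"
    and hol: "\<And>z v. z \<in> U \<Longrightarrow> Df z (cscale \<i> v) = cscale \<i> (Df z v)"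
    and bd: "\<And>z. z \<in> U \<Longrightarrow> def_fun z = 0 \<Longrightarrow> def_fun (f z) = 0"
  shows "\<exists>\<delta>>0. ball 0 \<delta> \<subseteq> U \<and> (\<forall>z\<in>ball 0 \<delta>. \<forall>w\<in>ball 0 \<delta>. polar z w = 0 \<longrightarrow> polar (f z) (f w) = 0)"
proof -
  obtain K where K: "K > 0" "\<And>x y. norm (H x y) \<le> norm x * norm y * K"
    using H.pos_bounded by blast
  \<comment> \<open>The curve \<open>c\<close> will have norm at most 6 \<delta> + 12 K \<delta> for
    |s| < 2, which is less than 12 (1 + K) \<delta>. The radius 2 leaves room for s = i and s =
    -i.\<close>
  define \<delta> where "\<delta> = min 1 (e / (12 * (1 + K)))"
  have \<delta>1: "\<delta> > 0" "\<delta> \<le> 1" "\<delta> \<le> e / (12 * (1 + K))"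
    using e K(1) by (simp_all add: \<delta>_def)
  then have \<delta>: "\<delta> > 0" "\<delta> \<le> 1" "12 * (1 + K) * \<delta> \<le> e"
    using K(1) by (simp_all add: pos_le_divide_eq mult.commute)
  have "\<delta> \<le> e" using \<delta> K(1) by (smt (verit) mult_right_mono mult_cancel_right1)
  have "polar (f z) (f w) = 0" if z: "z \<in> ball 0 \<delta>" and w: "w \<in> ball 0 \<delta>" and zw: "polar z w = 0" for z w
  proof -
    \<comment> \<open>Chosen to give \<open>c \<i>\<close> = z and \<open>c (- \<i>)\<close> = w: a
      + i b and a - i b are the first components of z and w, and t0 + i t1 = q. As \<open>t0\<close>
      and \<open>t1\<close> are real, \<open>c s\<close> lies on the hypersurface for real
      s.\<close>
    define a where "a = (1/2) *s (fst z + fst w)"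
    define b where "b = (1 / (2 * \<i>)) *s (fst z - fst w)"
    define q where "q = (snd z + H (fst z) (fst w)) / \<i>"
    define t0 where "t0 = complex_of_real (Re q)"
    define t1 where "t1 = complex_of_real (Im q)"
    define h1 where "h1 = H b a + H a b"
    define c where "c s = (a + s *s b, - (H a a + s * h1 + s * s * H b b) + \<i> * (t0 + s * t1))" for s
    define c' where "c' s \<xi> = (\<xi> *s b, - (\<xi> * h1 + (s * \<xi> + \<xi> * s) * H b b) + \<i> * (\<xi> * t1))" for s \<xi>
    have nz: "norm (fst z) < \<delta>" "norm (snd z) < \<delta>" "norm (fst w) < \<delta>"
      using z w norm_fst_le[of "fst z" "snd z"] norm_snd_le[of "snd z" "fst z"] norm_fst_le[of "fst w" "snd w"] by auto
    have na: "norm a \<le> \<delta>"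
      using norm_triangle_ineq[of "fst z" "fst w"] nz unfolding a_def norm_vector_scalar_mult_complex by (simp add: norm_divide)
    have nb: "norm b \<le> \<delta>"
      using norm_triangle_ineq4[of "fst z" "fst w"] nz unfolding b_def norm_vector_scalar_mult_complex by (simp add: norm_divide norm_mult)
    have HK: "norm (H x y) \<le> K * \<delta>" if "norm x \<le> \<delta>" "norm y \<le> \<delta>" for x y
    proof -
      have "norm x * norm y \<le> \<delta> * 1" using that \<delta> by (intro mult_mono) auto
      then have "norm x * norm y * K \<le> \<delta> * 1 * K" using K(1) by (intro mult_right_mono) auto
      then show ?thesis using K(2)[of x y] by (simp add: mult.commute)
    qed
    have nh1: "norm h1 \<le> 2 * (K * \<delta>)"
      using norm_triangle_ineq[of "H b a" "H a b"] HK na nb unfolding h1_def by (smt (verit))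
    have nq: "norm q \<le> \<delta> + K * \<delta>"
      using norm_triangle_ineq[of "snd z" "H (fst z) (fst w)"] HK[of "fst z" "fst w"] nz
      by (simp add: q_def norm_divide norm_mult)
    have nt: "norm t0 \<le> \<delta> + K * \<delta>" "norm t1 \<le> \<delta> + K * \<delta>"
      using nq abs_Re_le_cmod[of q] abs_Im_le_cmod[of q] by (simp_all add: t0_def t1_def)
    have c_in: "c s \<in> ball 0 e" if s: "s \<in> ball 0 2" for s
    proof -
      have s2: "norm s \<le> 2" using s by simp
      have le: "norm (s * x) \<le> 2 * B" if "norm x \<le> B" for x :: complex and B
        using mult_mono[OF s2 that] by (simp add: norm_mult)
      have "norm (a + s *s b) \<le> \<delta> + 2 * \<delta>"
        using norm_triangle_ineq[of a "s *s b"] na mult_mono[OF s2 nb]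
        by (simp add: norm_vector_scalar_mult_complex)
      moreover have "norm (- (H a a + s * h1 + s * s * H b b) + \<i> * (t0 + s * t1))
          \<le> (K * \<delta> + 2 * (2 * (K * \<delta>)) + 2 * (2 * (K * \<delta>))) + (\<delta> + K * \<delta> + 2 * (\<delta> + K * \<delta>))"
      proof -
        have "norm (H a a + s * h1 + s * s * H b b) \<le> K * \<delta> + 2 * (2 * (K * \<delta>)) + 2 * (2 * (K * \<delta>))"
          using HK[OF na na] le[OF nh1] le[OF le[OF HK[OF nb nb]]]
          by (intro norm_triangle_mono) (auto simp: mult.assoc)
        moreover have "norm (\<i> * (t0 + s * t1)) \<le> \<delta> + K * \<delta> + 2 * (\<delta> + K * \<delta>)"
          unfolding norm_mult using nt(1) le[OF nt(2)] norm_triangle_mono by fastforce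
        ultimately show ?thesis by (intro norm_triangle_mono) (simp_all only: norm_minus_cancel)
      qed
      moreover have "norm (c s) \<le> norm (a + s *s b) + norm (- (H a a + s * h1 + s * s * H b b) + \<i> * (t0 + s * t1))"
        unfolding c_def by (rule norm_Pair_le)
      ultimately have "norm (c s) \<le> (\<delta> + 2 * \<delta>)
          + ((K * \<delta> + 2 * (2 * (K * \<delta>)) + 2 * (2 * (K * \<delta>))) + (\<delta> + K * \<delta> + 2 * (\<delta> + K * \<delta>)))"
        by (meson add_mono order_trans)
      also have "\<dots> = 6 * \<delta> + 12 * (K * \<delta>)" by (simp add: algebra_simps)
      also have "\<dots> < 12 * (1 + K) * \<delta>" using \<delta>(1) by (simp add: algebra_simps)
      finally show ?thesis using \<delta>(3) by simp
    qed
    have sw: "snd w = - 2 * H (fst w) (fst z) - cnj (snd z)"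
      using arg_cong[OF zw, of cnj] H_swap[of "fst z" "fst w"] by (simp add: polar_def algebra_simps eq_neg_iff_add_eq_0)
    have ab: "a + \<i> *s b = fst z" "a + (- \<i>) *s b = fst w"
      unfolding a_def b_def by (simp_all add: vec_eq_iff field_simps)
    have Hc: "H (a + s *s b) (a + cnj s *s b) = H a a + s * h1 + s * s * H b b" for s
      by (simp add: H.add_left H.add_right H_scale_left H_scale_right h1_def algebra_simps)
    have qq: "t0 + \<i> * t1 = q" "t0 + (- \<i>) * t1 = cnj q"
      by (simp_all add: t0_def t1_def complex_eq_iff)
    have Hzw: "H a a + \<i> * h1 + \<i> * \<i> * H b b = H (fst z) (fst w)"
      using Hc[of \<i>] unfolding complex_cnj_i ab by (rule sym)
    have Hwz: "H a a + (- \<i>) * h1 + (- \<i>) * (- \<i>) * H b b = H (fst w) (fst z)"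
      using Hc[of "- \<i>"] unfolding complex_cnj_minus complex_cnj_i minus_minus ab by (rule sym)
    have ci: "c \<i> = z"
      unfolding c_def ab Hzw qq prod_eq_iff by (simp add: q_def)
    have cmi: "c (- \<i>) = w"
      unfolding c_def ab Hwz qq prod_eq_iff using H_swap[of "fst z" "fst w"]
      by (simp add: q_def sw field_simps)
    have c_der: "(c has_derivative c' s) (at s)" for s
      unfolding c_def[abs_def] c'_def[abs_def] by (auto intro!: derivative_eq_intros simp: algebra_simps)
    have c'_i: "c' s (\<i> * \<xi>) = cscale \<i> (c' s \<xi>)" for s \<xi>
      by (simp add: c'_def cscale_def vector_smult_assoc algebra_simps)
    \<comment> \<open>Holomorphic in s, because the antilinear argument of \<open>polar\<close>
      depends on the conjugate of s.\<close>
    define G where "G s = polar (f (c s)) (f (c (cnj s)))" for s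
    have G0: "G (of_real r) = 0" if "of_real r \<in> ball (0::complex) 2" for r
    proof -
      have "def_fun (c (of_real r)) = 0"
        using Hc[of "of_real r"] by (simp add: c_def def_fun_def t0_def t1_def)
      then show ?thesis
        using bd[of "c (of_real r)"] c_in[OF that] e by (auto simp: G_def polar_self)
    qed
    have hol_G: "G holomorphic_on ball 0 2"
      unfolding holomorphic_on_def
    proof
      fix s :: complex assume s: "s \<in> ball 0 2"
      then have s': "cnj s \<in> ball 0 2" by simp
      have cU: "c s \<in> U" "c (cnj s) \<in> U" using c_in[OF s] c_in[OF s'] e by auto
      let ?D1 = "\<lambda>\<xi>. Df (c s) (c' s \<xi>)" and ?D2 = "\<lambda>\<xi>. Df (c (cnj s)) (c' (cnj s) (cnj \<xi>))"
      have d1: "((\<lambda>s. f (c s)) has_derivative ?D1) (at s)"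
        by (rule has_derivative_compose[OF c_der Df[OF cU(1)]])
      have "((\<lambda>s. c (cnj s)) has_derivative (\<lambda>\<xi>. c' (cnj s) (cnj \<xi>))) (at s)"
        by (rule has_derivative_compose[OF has_derivative_cnj[OF has_derivative_ident] c_der])
      then have d2: "((\<lambda>s. f (c (cnj s))) has_derivative ?D2) (at s)"
        by (rule has_derivative_compose[where f = "\<lambda>s. c (cnj s)" and g = f]) (rule Df[OF cU(2)])
      have "(G has_derivative (\<lambda>\<xi>. 2 * (H (fst (f (c s))) (fst (?D2 \<xi>)) + H (fst (?D1 \<xi>)) (fst (f (c (cnj s)))))
            + snd (?D1 \<xi>) + cnj (snd (?D2 \<xi>)))) (at s)"
        unfolding G_def[abs_def] polar_def
        by (intro has_derivative_add has_derivative_mult_right H.FDERIV has_derivative_fst has_derivative_snd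
            has_derivative_cnj d1 d2)
      moreover have "?D1 (\<i> * \<xi>) = cscale \<i> (?D1 \<xi>)" "?D2 (\<i> * \<xi>) = cscale (- \<i>) (?D2 \<xi>)" for \<xi>
      proof -
        show "?D1 (\<i> * \<xi>) = cscale \<i> (?D1 \<xi>)" using hol[OF cU(1)] by (simp add: c'_i)
        have "cscale \<i> (?D2 (\<i> * \<xi>)) = Df (c (cnj s)) (c' (cnj s) (\<i> * cnj (\<i> * \<xi>)))"
          using hol[OF cU(2)] by (simp only: c'_i)
        also have "\<dots> = ?D2 \<xi>" by simp
        finally have "cscale (- \<i>) (cscale \<i> (?D2 (\<i> * \<xi>))) = cscale (- \<i>) (?D2 \<xi>)" by simp
        then show "?D2 (\<i> * \<xi>) = cscale (- \<i>) (?D2 \<xi>)" by simp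
      qed
      ultimately have "G field_differentiable at s"
        by (elim has_derivative_imp_field_differentiable)
          (simp add: cscale_def H_scale_left H_scale_right H.minus_right algebra_simps)
      then show "G field_differentiable at s within ball 0 2"
        using field_differentiable_at_within by blast
    qed
    have "G \<i> = 0"
    proof (rule analytic_continuation[OF hol_G open_ball connected_ball, of "of_real ` {-1..1}" 0])
      show "(0::complex) islimpt of_real ` {-1..1}"
        unfolding islimpt_approachable
      proof (intro allI impI)
        fix e :: real assume "e > 0"
        then show "\<exists>x'\<in>of_real ` {-1..1}. x' \<noteq> (0::complex) \<and> dist x' 0 < e"
          by (intro bexI[of _ "of_real (min 1 (e / 2))"]) (auto simp: min_def)
      qed
    qed (use G0 in auto)
    then show ?thesis using ci cmi by (simp add: G_def)
  qed
  then show ?thesis using \<delta>(1) \<open>\<delta> \<le> e\<close> e(1) by (intro exI[of _ \<delta>]) auto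
qed

end


section \<open>Maps fixing 0 that preserve Segre varieties\<close>

locale segre_map = flat_normal_form \<beta> H
  for \<beta> H :: "complex ^ 'm::finite \<Rightarrow> complex ^ 'm \<Rightarrow> complex" +
  fixes f Df :: "'m cspace \<Rightarrow> 'm cspace" and \<delta> :: real
  assumes \<delta>: "\<delta> > 0"
    and polar_f: "z \<in> ball 0 \<delta> \<Longrightarrow> w \<in> ball 0 \<delta> \<Longrightarrow> polar z w = 0 \<Longrightarrow> polar (f z) (f w) = 0"
    and Df: "(f has_derivative Df) (at 0)"
    and Df_i: "Df (cscale \<i> v) = cscale \<i> (Df v)"
    and f_0: "f 0 = 0"
    and inj_Df: "inj Df"
    and f_nonzero: "z \<in> ball 0 \<delta> \<Longrightarrow> z \<noteq> 0 \<Longrightarrow> f z \<noteq> 0"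
begin

lemma linear_Df: "linear Df"
  using Df has_derivative_linear by blast

lemma Df_scale: "Df (cscale c v) = cscale c (Df v)"
proof -
  have eq: "cscale c v = Re c *\<^sub>R v + Im c *\<^sub>R cscale \<i> v" for v :: "'m cspace"
    by (simp add: cscale_def prod_eq_iff vec_eq_iff complex_eq_iff)
  show ?thesis
    unfolding eq linear_add[OF linear_Df] linear_scale[OF linear_Df] Df_i ..
qed

definition A :: "complex ^ 'm \<Rightarrow> complex ^ 'm" where "A x = fst (Df (x, 0))"
definition b :: "complex ^ 'm" where "b = fst (Df (0, 1))"
definition lam :: complex where "lam = snd (Df (0, 1))"

lemmas eventually_ball = eventually_curve_in[OF _ _ open_ball]

lemma snd_f_horizontal:
  assumes "(x, 0 :: complex) \<in> ball 0 \<delta>"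
  shows "snd (f (x, 0)) = 0"
proof -
  have "polar (f (x, 0)) (f 0) = 0"
    using polar_f[OF assms, of 0] \<delta> by (simp add: polar_def H.zero_right)
  then show ?thesis by (simp add: polar_def f_0 H.zero_right)
qed

lemma horizontal_curve: "((\<lambda>t. (t *\<^sub>R x, 0 :: complex)) has_vector_derivative (x, 0)) (at 0)"
  by (auto intro!: derivative_eq_intros)

lemma horizontal_eventually: "\<forall>\<^sub>F t in nhds 0. (t *\<^sub>R x, 0) \<in> ball (0 :: 'm cspace) \<delta>"
  using \<delta> by (intro eventually_ball has_vector_derivative_continuous[OF horizontal_curve]) simp

text \<open>One block of the derivative vanishes because \<open>f\<close> maps z_n = 0, the Segre
  variety of 0, into itself.\<close>

lemma Df_eq: "Df v = (A (fst v) + snd v *s b, lam * snd v)"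
proof -
  have "snd (Df (x, 0)) = 0" for x
  proof (rule derivative_along_curve_eq_0[where g = "\<lambda>z. snd (f z)" and g' = "\<lambda>v. snd (Df v)"
        and \<gamma> = "\<lambda>t. (t *\<^sub>R x, 0)"])
    show "((\<lambda>z. snd (f z)) has_derivative (\<lambda>v. snd (Df v))) (at (0 *\<^sub>R x, 0))"
      using has_derivative_snd[OF Df] by (simp add: zero_prod_def)
    show "\<forall>\<^sub>F t in nhds 0. snd (f (t *\<^sub>R x, 0)) = 0"
      using horizontal_eventually by eventually_elim (rule snd_f_horizontal)
  qed (rule horizontal_curve)
  moreover have "v = (fst v, 0) + cscale (snd v) (0, 1)"
    by (simp add: cscale_def)
  ultimately show ?thesis
    by (metis (no_types, lifting) A_def Df_scale b_def cscale_def fst_add fst_conv lam_def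
        linear_Df linear_add mult.commute prod.collapse snd_add snd_conv add_0)
qed

lemma linear_A: "linear A"
  by (rule linearI)
    (simp_all add: A_def linear_add[OF linear_Df, symmetric] linear_scale[OF linear_Df, symmetric]
      flip: fst_add fst_scaleR)

lemma A_scale: "A (c *s x) = c *s A x"
  using Df_scale[of c "(x, 0)"] by (simp add: A_def cscale_def)

text \<open>The real line spanned by \<open>\<omega>\<close> lies in the Segre variety of (x, 0).
  Differentiating the invariance along it at 0 leaves the value of \<open>f\<close> at (x, 0) and
  first derivatives at 0.\<close>

lemma Segre_derivative:
  assumes "(x, 0 :: complex) \<in> ball 0 \<delta>"
  shows "H (fst (f (x, 0))) (A u) = (cnj lam + 2 * H (fst (f (x, 0))) b) * H x u"
proof -
  let ?X = "fst (f (x, 0))"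
  define \<omega> where "\<omega> = (u, - 2 * cnj (H x u))"
  have curve: "((\<lambda>t. t *\<^sub>R \<omega>) has_vector_derivative \<omega>) (at 0)"
    by (auto intro!: derivative_eq_intros)
  have "2 * H ?X (fst (Df \<omega>)) + 0 + cnj (snd (Df \<omega>)) = 0"
  proof (rule derivative_along_curve_eq_0[where \<gamma> = "\<lambda>t. t *\<^sub>R \<omega>" and g = "\<lambda>w. polar (f (x, 0)) (f w)"
        and g' = "\<lambda>v. 2 * H ?X (fst (Df v)) + 0 + cnj (snd (Df v))"])
    have "(f has_derivative Df) (at (0 *\<^sub>R \<omega>))" using Df by simp
    then show "((\<lambda>w. polar (f (x, 0)) (f w)) has_derivative
        (\<lambda>v. 2 * H ?X (fst (Df v)) + 0 + cnj (snd (Df v)))) (at (0 *\<^sub>R \<omega>))"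
      unfolding polar_def
      by (intro has_derivative_add has_derivative_mult_right has_derivative_const has_derivative_cnj
          bounded_linear.has_derivative[OF H.bounded_linear_right] has_derivative_fst has_derivative_snd)
    have "\<forall>\<^sub>F t in nhds 0. t *\<^sub>R \<omega> \<in> ball 0 \<delta>"
      using \<delta> by (intro eventually_ball has_vector_derivative_continuous[OF curve]) simp
    then show "\<forall>\<^sub>F t in nhds 0. polar (f (x, 0)) (f (t *\<^sub>R \<omega>)) = 0"
    proof eventually_elim
      case (elim t)
      have "polar (x, 0) (t *\<^sub>R \<omega>) = 0"
        by (simp add: polar_def \<omega>_def H.scaleR_right)
      then show ?case using polar_f[OF assms elim] by simp
    qed
  qed (rule curve)
  then have "2 * H ?X (A u) = 2 * ((cnj lam + 2 * H ?X b) * H x u)"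
    by (simp add: Df_eq \<omega>_def H.add_right H.diff_right H_scale_right algebra_simps)
  then show ?thesis by simp
qed

text \<open>The derivative of \<open>Segre_derivative\<close> in x at 0; the products simplify
  because \<open>f\<close> fixes 0.\<close>

lemma H_A: "H (A x) (A u) = cnj lam * H x u"
proof -
  let ?g = "\<lambda>z. H (fst (f z)) (A u) - (cnj lam + 2 * H (fst (f z)) b) * H (fst z) u"
  let ?g' = "\<lambda>v. H (fst (Df v)) (A u) - ((cnj lam + 2 * H (fst (f (0 *\<^sub>R x, 0))) b) * H (fst v) u
        + (0 + 2 * H (fst (Df v)) b) * H (fst (0 *\<^sub>R x, 0::complex)) u)"
  have "H (fst (Df (x, 0))) (A u) - ((cnj lam + 2 * H (fst (f (0 *\<^sub>R x, 0))) b) * H (fst (x, 0::complex)) u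
      + (0 + 2 * H (fst (Df (x, 0))) b) * H (fst (0 *\<^sub>R x, 0::complex)) u) = 0"
  proof (rule derivative_along_curve_eq_0[where g = ?g and g' = ?g' and \<gamma> = "\<lambda>t. (t *\<^sub>R x, 0)", OF _ horizontal_curve])
    have D: "(f has_derivative Df) (at (0 *\<^sub>R x, 0))" using Df by (simp add: zero_prod_def)
    show "(?g has_derivative ?g') (at (0 *\<^sub>R x, 0))"
      by (intro has_derivative_diff has_derivative_mult has_derivative_add has_derivative_mult_right has_derivative_const
          bounded_linear.has_derivative[OF H.bounded_linear_left] has_derivative_fst has_derivative_ident D)
    show "\<forall>\<^sub>F t in nhds 0. ?g (t *\<^sub>R x, 0) = 0"
      using horizontal_eventually[of x] by eventually_elim (simp add: Segre_derivative)
  qed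
  then show ?thesis
    by (simp add: A_def[symmetric] H.zero_left f_0 flip: zero_prod_def)
qed

lemma inj_A: "inj A"
proof -
  have "x = 0" if "A x = 0" for x
  proof -
    have "Df (x, 0) = (0, 0)" by (simp add: Df_eq that)
    then have "Df (x, 0) = Df 0" unfolding linear_0[OF linear_Df] by (simp add: zero_prod_def)
    then have "(x, 0) = (0 :: 'm cspace)" by (rule injD[OF inj_Df])
    then show "x = 0" by (simp add: zero_prod_def)
  qed
  then show ?thesis using linear_injective_0[OF linear_A] by blast
qed

definition \<mu> :: real where "\<mu> = Re lam"

text \<open>Taking u = x in \<open>H_A\<close> exhibits \<open>cnj lam\<close> as a quotient of two
  positive numbers.\<close>

lemma \<mu>: "lam = of_real \<mu>" "\<mu> > 0"
proof -
  define x :: "complex ^ 'm" where "x = 1"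
  have "x \<noteq> 0" by (simp add: x_def)
  then have "A x \<noteq> 0" using inj_A linear_0[OF linear_A] by (metis injD)
  then have pos: "Re (H (A x) (A x)) > 0" "Re (H x x) > 0" using H_pos \<open>x \<noteq> 0\<close> by auto
  have "of_real (Re (H (A x) (A x))) = cnj lam * of_real (Re (H x x))"
    using H_A[of x x] by (metis H_self)
  then have "cnj lam = of_real (Re (H (A x) (A x)) / Re (H x x))"
    using pos(2) by (simp add: field_simps)
  then have "lam = of_real (Re (H (A x) (A x)) / Re (H x x))" by (metis complex_cnj_cnj complex_cnj_complex_of_real)
  then show "lam = of_real \<mu>" "\<mu> > 0" using pos by (auto simp: \<mu>_def)
qed

lemma H_A': "H (A x) (A u) = of_real \<mu> * H x u"
  using H_A \<mu>(1) by simp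

lemma surj_A: "\<exists>y. x = A y"
  using linear_injective_imp_surjective[OF linear_A inj_A] by (metis surjD)

lemma H_nondegenerate: "(\<And>u. H p u = 0) \<Longrightarrow> p = 0"
  using H_eq_0_iff by blast

text \<open>\<open>Segre_derivative\<close>, tested against all u, makes the first component of f(x,
  0) a multiple of A x, with a factor that involves f(x, 0) itself. Solving for this factor gives a
  fraction; the product of the factor before and the denominator after is \<mu>^2, so neither can
  vanish.\<close>

lemma f_horizontal:
  assumes "(x, 0 :: complex) \<in> ball 0 \<delta>"
  shows "(of_real \<mu> - 2 * H (A x) b) *s fst (f (x, 0)) = of_real \<mu> *s A x" "of_real \<mu> - 2 * H (A x) b \<noteq> 0"
proof -
  obtain y where y: "fst (f (x, 0)) = A y" using surj_A by blast
  let ?h = "H (A y) b" and ?k = "H (A x) b" and ?m = "complex_of_real \<mu>"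
  have "H (?m *s y - (?m + 2 * ?h) *s x) u = 0" for u
    using Segre_derivative[OF assms, of u] H_A'[of y u] \<mu>(1)
    by (simp add: y H.diff_left H.add_left H_scale_left algebra_simps)
  then have "?m *s y - (?m + 2 * ?h) *s x = 0" by (rule H_nondegenerate)
  then have yx: "?m *s y = (?m + 2 * ?h) *s x" by simp
  then have mA: "?m *s A y = (?m + 2 * ?h) *s A x" using A_scale by metis
  have "?m * ?h = (?m + 2 * ?h) * ?k" using arg_cong[OF mA, of "\<lambda>v. H v b"] by (simp add: H.add_left H_scale_left algebra_simps)
  then have mm: "(?m + 2 * ?h) * (?m - 2 * ?k) = ?m * ?m" by (simp add: algebra_simps)
  then show "?m - 2 * ?k \<noteq> 0" using \<mu>(2) by auto
  have "?m *s ((?m - 2 * ?k) *s A y) = (?m - 2 * ?k) *s ((?m + 2 * ?h) *s A x)"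
    by (simp only: vector_smult_assoc mult.commute flip: mA)
  also have "\<dots> = ?m *s (?m *s A x)" unfolding vector_smult_assoc mm[symmetric] by (simp only: mult.commute)
  finally show "(?m - 2 * ?k) *s fst (f (x, 0)) = ?m *s A x"
    using \<mu>(2) unfolding vector_mul_lcancel y by simp
qed

text \<open>The derivative of \<open>f\<close> at 0 with \<open>lam\<close> = \<mu>. It serves as
  the numerator of the projective map sought.\<close>

definition N :: "'m cspace \<Rightarrow> 'm cspace" where
  "N z = (A (fst z) + snd z *s b, of_real \<mu> * snd z)"

text \<open>The horizontal point (\<open>foot z\<close>, 0) lies on the Segre variety of z.\<close>

definition foot :: "'m cspace \<Rightarrow> complex ^ 'm" where
  "foot z = (- cnj (snd z) / (2 * H (fst z) (fst z))) *s fst z"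

definition good :: "'m cspace set" where
  "good = {z \<in> ball 0 \<delta>. fst z \<noteq> 0 \<and> (foot z, 0) \<in> ball (0 :: 'm cspace) \<delta>}"

text \<open>The Segre variety of z meets the horizontal hyperplane near the foot in a piece of an
  affine hyperplane, where \<open>f\<close> is known by \<open>f_horizontal\<close>. Moving along it
  shows that y is H-orthogonal to everything orthogonal to the first component of z, hence a
  multiple of it; the value at the foot itself gives the last coordinate.\<close>

lemma f_proportional:
  assumes z: "z \<in> good"
  shows "\<exists>\<tau>. \<tau> \<noteq> 0 \<and> cscale (of_real \<mu>) (f z) = cscale \<tau> (N z)"
proof -
  let ?m = "complex_of_real \<mu>" and ?F = "fst (f z)" and ?Fn = "snd (f z)"
  \<comment> \<open>Subtracting the multiple of b makes the incidence condition, after clearing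
    denominators by \<open>f_horizontal\<close>, a condition on H y u alone.\<close>
  obtain y where y: "A y = ?m *s ?F - ?Fn *s b" using surj_A by metis
  have foot: "H (fst z) (foot z) = - snd z / 2"
    using z H_eq_0_iff[of "fst z"] H_swap[of "fst z" "fst z", symmetric]
    by (simp add: foot_def good_def H.minus_right H_scale_right)
  have key: "H y u = - ?Fn / 2" if u: "(u, 0 :: complex) \<in> ball 0 \<delta>" and zu: "H (fst z) u = - snd z / 2" for u
  proof -
    let ?k = "H (A u) b"
    have "polar z (u, 0) = 0" using zu by (simp add: polar_def)
    then have "2 * H ?F (fst (f (u, 0))) + ?Fn = 0"
      using polar_f[OF _ u, of z] z snd_f_horizontal[OF u] by (simp add: polar_def good_def)
    then have "2 * (cnj (?m - 2 * ?k) * H ?F (fst (f (u, 0)))) + cnj (?m - 2 * ?k) * ?Fn = 0"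
      by (metis distrib_left mult.left_commute mult_zero_right)
    then have "2 * H ?F (?m *s A u) + cnj (?m - 2 * ?k) * ?Fn = 0"
      unfolding H_scale_right[symmetric] f_horizontal(1)[OF u] .
    then have "2 * H (A y) (A u) = - ?m * ?Fn"
      by (simp add: y H.diff_left H_scale_left H_scale_right H_swap[of b "A u", symmetric] algebra_simps)
    then have "?m * (2 * H y u + ?Fn) = 0" by (simp add: H_A' algebra_simps)
    then have "2 * H y u = - ?Fn" using \<mu>(2) by (simp add: eq_neg_iff_add_eq_0)
    then show ?thesis by (metis nonzero_mult_div_cancel_left zero_neq_numeral)
  qed
  have orth: "H y u = 0" if "H (fst z) u = 0" for u
  proof -
    have "((\<lambda>t. (foot z + t *\<^sub>R u, 0::complex)) has_vector_derivative (u, 0)) (at 0)"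
      by (auto intro!: derivative_eq_intros)
    then have "\<forall>\<^sub>F t in nhds 0. (foot z + t *\<^sub>R u, 0) \<in> ball (0 :: 'm cspace) \<delta>"
      using z by (intro eventually_ball has_vector_derivative_continuous) (auto simp: good_def)
    then have "\<forall>\<^sub>F t in at_right 0. (foot z + t *\<^sub>R u, 0) \<in> ball (0 :: 'm cspace) \<delta> \<and> 0 < t"
      by (auto simp: eventually_at_filter elim: eventually_mono)
    then obtain t :: real where t: "(foot z + t *\<^sub>R u, 0) \<in> ball (0 :: 'm cspace) \<delta>" "t > 0"
      using eventually_happens'[OF trivial_limit_at_right_real] by (metis (mono_tags, lifting))
    have "H y (foot z + t *\<^sub>R u) = H y (foot z)"
      using key[OF t(1)] key[of "foot z"] z foot that by (simp add: good_def H.add_right H.scaleR_right)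
    then show ?thesis using t(2) by (simp add: H.add_right H.scaleR_right)
  qed
  define t where "t = H y (fst z) / H (fst z) (fst z)"
  have nz: "H (fst z) (fst z) \<noteq> 0" using z H_eq_0_iff by (auto simp: good_def)
  define u where "u = y - t *s fst z"
  have "H u (fst z) = 0" using nz by (simp add: u_def t_def H.diff_left H_scale_left)
  then have zu: "H (fst z) u = 0" using H_swap[of u "fst z"] by simp
  have "H u u = H y u - t * H (fst z) u"
    by (subst (1) u_def) (simp only: H.diff_left H_scale_left)
  then have "H u u = 0" using zu orth[OF zu] by simp
  then have yt: "y = t *s fst z" using H_eq_0_iff by (simp add: u_def)
  have "H y (foot z) = - ?Fn / 2" using key z foot by (simp add: good_def)
  then have Fn: "?Fn = t * snd z" by (simp add: yt H_scale_left foot)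
  have "?m *s ?F = t *s A (fst z) + ?Fn *s b" using y by (simp add: yt A_scale)
  then have eq: "cscale ?m (f z) = cscale t (N z)"
    by (simp add: cscale_def N_def Fn vector_add_ldistrib vector_smult_assoc)
  have "t \<noteq> 0"
  proof
    assume "t = 0"
    then have "cscale ?m (f z) = 0" using eq by (simp add: cscale_def zero_prod_def)
    then have "cscale (inverse ?m) (cscale ?m (f z)) = 0" by (simp add: cscale_def zero_prod_def)
    then have "f z = 0" using \<mu>(2) by simp
    moreover have "z \<noteq> 0" "z \<in> ball 0 \<delta>" using z by (auto simp: good_def)
    ultimately show False using f_nonzero by blast
  qed
  then show ?thesis using eq by blast
qed


definition sg :: "'m cspace \<Rightarrow> complex" where
  "sg z = (SOME \<sigma>. \<sigma> \<noteq> 0 \<and> cscale \<sigma> (f z) = N z)"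

lemma sg:
  assumes "z \<in> good"
  shows "sg z \<noteq> 0" "cscale (sg z) (f z) = N z"
proof -
  obtain t where t: "t \<noteq> 0" "cscale (of_real \<mu>) (f z) = cscale t (N z)"
    using f_proportional[OF assms] by blast
  then have "cscale (inverse t) (cscale (of_real \<mu>) (f z)) = N z" by simp
  then have "of_real \<mu> / t \<noteq> 0 \<and> cscale (of_real \<mu> / t) (f z) = N z"
    using t(1) \<mu>(2) by (simp add: divide_inverse mult.commute)
  then have "sg z \<noteq> 0 \<and> cscale (sg z) (f z) = N z" unfolding sg_def by (rule someI)
  then show "sg z \<noteq> 0" "cscale (sg z) (f z) = N z" by auto
qed

text \<open>A denominator for which the pair of \<open>N\<close> and \<open>s0\<close> respects the
  polarized form, see \<open>polar_N\<close>. Adding C z_n with C purely imaginary gives further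
  ones.\<close>

definition s0 :: "'m cspace \<Rightarrow> complex" where
  "s0 z = 1 - 2 / of_real \<mu> * H (A (fst z)) b - H b b / of_real \<mu> * snd z"

definition eps :: "'m cspace \<Rightarrow> complex" where
  "eps z = sg z - s0 z"

lemma polar_N:
  "2 * H (fst (N z)) (fst (N w)) + of_real \<mu> * snd z * cnj (s0 w) + of_real \<mu> * cnj (snd w) * s0 z
    = of_real \<mu> * polar z w"
proof -
  have c: "cnj (H b b) = H b b" "cnj (H (A (fst w)) b) = H b (A (fst w))" using H_swap by metis+
  have d: "of_real \<mu> * s0 z = of_real \<mu> - 2 * H (A (fst z)) b - H b b * snd z"
    "of_real \<mu> * cnj (s0 w) = of_real \<mu> - 2 * H b (A (fst w)) - H b b * cnj (snd w)"
    using \<mu>(2) by (simp_all add: s0_def c field_simps)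
  have "2 * H (fst (N z)) (fst (N w)) + of_real \<mu> * snd z * cnj (s0 w) + of_real \<mu> * cnj (snd w) * s0 z
    = 2 * H (fst (N z)) (fst (N w)) + snd z * (of_real \<mu> * cnj (s0 w)) + cnj (snd w) * (of_real \<mu> * s0 z)"
    by (simp add: algebra_simps)
  also have "\<dots> = of_real \<mu> * polar z w"
    unfolding d by (simp add: N_def polar_def H.add_left H.add_right H_scale_left H_scale_right H_A' algebra_simps)
  finally show ?thesis .
qed

text \<open>On pairs with \<open>polar z w = 0\<close>, both \<open>sg\<close> and \<open>s0\<close>
  satisfy the same real affine relation, one through the invariance of Segre varieties and the other
  by \<open>polar_N\<close>. The difference satisfies its linear part.\<close>

lemma eps_polar:
  assumes "z \<in> good" "w \<in> good" "polar z w = 0"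
  shows "snd z * cnj (eps w) + cnj (snd w) * eps z = 0"
proof -
  have "polar (f z) (f w) = 0" using assms polar_f by (simp add: good_def)
  then have "2 * (sg z * cnj (sg w) * H (fst (f z)) (fst (f w))) + cnj (sg w) * (sg z * snd (f z))
      + sg z * cnj (sg w * snd (f w)) = 0"
    unfolding polar_def by (simp add: algebra_simps) algebra
  moreover have Nf: "sg x *s fst (f x) = fst (N x)" "sg x * snd (f x) = of_real \<mu> * snd x" if "x \<in> good" for x
    using sg(2)[OF that] by (auto simp: cscale_def N_def)
  moreover have "sg z * cnj (sg w) * H (fst (f z)) (fst (f w)) = H (fst (N z)) (fst (N w))"
    by (simp add: Nf(1)[symmetric] assms H_scale_left H_scale_right)
  ultimately have "2 * H (fst (N z)) (fst (N w)) + cnj (sg w) * (of_real \<mu> * snd z)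
      + sg z * cnj (of_real \<mu> * snd w) = 0"
    using assms by simp
  moreover have "of_real \<mu> * (snd z * cnj (eps w) + cnj (snd w) * eps z) =
      (2 * H (fst (N z)) (fst (N w)) + cnj (sg w) * (of_real \<mu> * snd z) + sg z * cnj (of_real \<mu> * snd w)) -
      (2 * H (fst (N z)) (fst (N w)) + of_real \<mu> * snd z * cnj (s0 w) + of_real \<mu> * cnj (snd w) * s0 z)"
    by (simp add: eps_def algebra_simps)
  moreover have "2 * H (fst (N z)) (fst (N w)) + of_real \<mu> * snd z * cnj (s0 w) + of_real \<mu> * cnj (snd w) * s0 z = 0"
    using polar_N[of z w] assms(3) by simp
  ultimately have "of_real \<mu> * (snd z * cnj (eps w) + cnj (snd w) * eps z) = 0"
    by (simp only: diff_self)
  then show ?thesis using \<mu>(2) by simp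
qed

definition good' :: "'m cspace set" where
  "good' = good \<inter> {z. snd z \<noteq> 0}"

lemma open_good': "open good'"
proof -
  let ?S = "ball (0 :: 'm cspace) \<delta> \<inter> {z. fst z \<noteq> 0} \<inter> {z. snd z \<noteq> 0}"
  have "open ?S"
    by (intro open_Int open_ball open_Collect_neq continuous_intros)
  moreover have "continuous_on ?S (\<lambda>z. (foot z, 0 :: complex))"
    unfolding foot_def by (intro continuous_intros H.continuous_on) (auto simp: H_eq_0_iff)
  ultimately have "open (?S \<inter> (\<lambda>z. (foot z, 0 :: complex)) -` ball 0 \<delta>)"
    by (intro continuous_open_preimage open_ball)
  moreover have "good' = ?S \<inter> (\<lambda>z. (foot z, 0 :: complex)) -` ball 0 \<delta>"
    by (auto simp: good'_def good_def)
  ultimately show ?thesis by simp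
qed

text \<open>Over a real line in the horizontal space, the foot of a boundary point is half of its
  horizontal part. So every small enough point of this parabola except 0 is suitable.\<close>

lemma boundary_point: "\<exists>z\<in>good'. def_fun z = 0"
proof -
  define x :: "complex ^ 'm" where "x = 1"
  have "x \<noteq> 0" by (simp add: x_def)
  let ?g = "\<lambda>t::real. (t *\<^sub>R x, - (t\<^sup>2 *\<^sub>R H x x))"
  have "continuous (at 0) ?g" by (intro continuous_intros)
  then have "\<forall>\<^sub>F t in nhds 0. ?g t \<in> ball (0 :: 'm cspace) \<delta>"
    using \<delta> by (intro eventually_ball) (auto simp: zero_prod_def[symmetric])
  then have "\<forall>\<^sub>F t in at_right 0. ?g t \<in> ball (0 :: 'm cspace) \<delta> \<and> 0 < t"
    by (auto simp: eventually_at_filter elim: eventually_mono)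
  then obtain t :: real where t: "?g t \<in> ball (0 :: 'm cspace) \<delta>" "t > 0"
    using eventually_happens'[OF trivial_limit_at_right_real] by (metis (mono_tags, lifting))
  have H: "H (t *\<^sub>R x) (t *\<^sub>R x) = t\<^sup>2 *\<^sub>R H x x"
    by (simp add: H.scaleR_left H.scaleR_right power2_eq_square)
  have nz: "t\<^sup>2 *\<^sub>R H x x \<noteq> 0" using t(2) \<open>x \<noteq> 0\<close> H_eq_0_iff by simp
  have cH: "cnj (H x x) = H x x" using H_swap[of x x] by simp
  have "foot (?g t) = (1 / 2) *s (t *\<^sub>R x)"
    unfolding foot_def fst_conv snd_conv H using t(2) nz cH by (simp add: scaleR_conv_of_real)
  then have "norm (foot (?g t)) \<le> norm (t *\<^sub>R x)"
    by (simp only: norm_vector_scalar_mult_complex) (simp add: norm_divide)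
  also have "\<dots> \<le> norm (?g t)" using norm_fst_le[of "t *\<^sub>R x" "- (t\<^sup>2 *\<^sub>R H x x)"] by simp
  also have "\<dots> < \<delta>" using t(1) by (simp only: mem_ball_0)
  finally have "?g t \<in> good'"
    unfolding good'_def good_def using t nz \<open>x \<noteq> 0\<close> by simp
  moreover have "def_fun (?g t) = 0" by (simp add: def_fun_def H)
  ultimately show ?thesis by blast
qed

text \<open>Points z near a suitable point lie on the Segre variety of some w near a fixed boundary
  point \<open>zs\<close>, where w is also on the Segre variety of \<open>zs\<close>. So \<open>eps_polar\<close> compares the values of
  \<open>eps z / snd z\<close> at z and \<open>zs\<close>.\<close>

lemma eps_proportional:
  "\<exists>C T. C + cnj C = 0 \<and> open T \<and> T \<noteq> {} \<and> T \<subseteq> good \<and> (\<forall>z\<in>T. eps z = C * snd z)"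
proof -
  obtain zs where zs: "zs \<in> good'" "def_fun zs = 0" using boundary_point by blast
  have zs': "zs \<in> good" "snd zs \<noteq> 0" "fst zs \<noteq> 0" using zs by (auto simp: good'_def good_def)
  \<comment> \<open>Purely imaginary, because a boundary point lies on its own Segre
    variety.\<close>
  define C where "C = eps zs / snd zs"
  have "snd zs * cnj (eps zs) + cnj (snd zs) * eps zs = 0"
    using zs' zs(2) by (intro eps_polar) (simp_all add: polar_self)
  then have "C + cnj C = 0" using zs'(2) by (simp add: C_def field_simps)
  \<comment> \<open>Solves the condition that w be on the Segre variety of z, while the last
    coordinate of w puts it on that of \<open>zs\<close>.\<close>
  define c where "c z = cnj (- (snd (z - zs) + 2 * H (fst (z - zs)) (fst zs)) / (2 * H (fst (z - zs)) (fst (z - zs))))" for z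
  define w1 where "w1 z = fst zs + c z *s fst (z - zs)" for z
  define w where "w z = (w1 z, - cnj (2 * H (fst zs) (w1 z) + snd zs))" for z
  define O1 where "O1 = good' \<inter> {z. fst (z - zs) \<noteq> 0}"
  define O2 where "O2 = O1 \<inter> w -` good'"
  have polar_zs: "polar zs (w z) = 0" for z by (simp add: polar_def w_def)
  have polar_z: "polar z (w z) = 0" if "fst (z - zs) \<noteq> 0" for z
  proof -
    let ?v = "z - zs"
    have "H (fst ?v) (fst ?v) \<noteq> 0" using that H_eq_0_iff by blast
    then have "2 * (cnj (c z) * H (fst ?v) (fst ?v)) = - (snd ?v + 2 * H (fst ?v) (fst zs))"
      by (simp add: c_def)
    then have "2 * H (fst ?v) (w1 z) + snd ?v = 0"
      by (simp only: w1_def H.add_right H_scale_right distrib_left) simp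
    moreover have "polar z (w z) = polar zs (w z) + (2 * H (fst ?v) (w1 z) + snd ?v)"
      by (simp add: polar_def w_def H.diff_left algebra_simps)
    ultimately show ?thesis using polar_zs by simp
  qed
  have eps_eq: "eps z = C * snd z" if z: "z \<in> O2" for z
  proof -
    have good: "z \<in> good" "w z \<in> good" "snd (w z) \<noteq> 0" "fst (z - zs) \<noteq> 0"
      using z by (auto simp: O2_def O1_def good'_def)
    have "snd z * cnj (eps (w z)) + cnj (snd (w z)) * eps z = 0"
      "snd zs * cnj (eps (w z)) + cnj (snd (w z)) * eps zs = 0"
      using good zs' polar_z[of z] polar_zs[of z] by (auto intro!: eps_polar)
    then have "cnj (snd (w z)) * (snd zs * eps z - snd z * eps zs) = 0" by algebra
    then show ?thesis using good(3) zs'(2) by (simp add: C_def field_simps)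
  qed
  have "open O1" unfolding O1_def
    by (intro open_Int open_good' open_Collect_neq continuous_intros)
  moreover have "continuous_on O1 w"
  proof -
    have "continuous_on O1 c" unfolding c_def
      by (intro continuous_intros H.continuous_on) (auto simp: H_eq_0_iff O1_def)
    then show ?thesis unfolding w_def w1_def by (intro continuous_intros H.continuous_on)
  qed
  ultimately have "open O2" unfolding O2_def by (intro continuous_open_preimage open_good')
  have "O2 \<noteq> {}"
  proof -
    \<comment> \<open>A direction inside the Segre variety of \<open>zs\<close>: along it c is 0,
      and w is \<open>zs\<close> itself.\<close>
    let ?v = "(fst zs, - 2 * H (fst zs) (fst zs))"
    have "continuous (at 0) (\<lambda>t::real. zs + t *\<^sub>R ?v)" by (intro continuous_intros)
    then have "\<forall>\<^sub>F t in nhds (0::real). zs + t *\<^sub>R ?v \<in> good'"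
      using zs(1) open_good' by (intro eventually_curve_in) (simp_all flip: zero_prod_def)
    then have "\<forall>\<^sub>F t in at (0::real). zs + t *\<^sub>R ?v \<in> good' \<and> t \<noteq> 0"
      unfolding eventually_at_filter by (rule eventually_mono) blast
    then obtain t :: real where t: "zs + t *\<^sub>R ?v \<in> good'" "t \<noteq> 0"
      using eventually_happens'[OF at_neq_bot] by (metis (mono_tags, lifting))
    let ?z = "zs + t *\<^sub>R ?v"
    have "c ?z = 0" by (simp add: c_def H.scaleR_left)
    then have "w ?z = (fst zs, - cnj (2 * H (fst zs) (fst zs) + snd zs))" by (simp add: w_def w1_def)
    also have "\<dots> = zs" using zs(2) by (simp add: prod_eq_iff def_fun_def complex_eq_iff)
    finally have "?z \<in> O2" using t zs zs' by (simp add: O2_def O1_def)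
    then show ?thesis by blast
  qed
  then show ?thesis
    using \<open>open O2\<close> \<open>C + cnj C = 0\<close> eps_eq
    by (intro exI[of _ C] exI[of _ O2]) (auto simp: O2_def O1_def good'_def)
qed

lemma ex_similitude:
  "\<exists>M m T. similitude M m \<and> open T \<and> T \<noteq> {} \<and> T \<subseteq> ball 0 \<delta> \<and> (\<forall>z\<in>T. M (z, 1) = hscale (snd (M (z, 1))) (f z, 1))"
proof -
  obtain C T where C: "C + cnj C = 0" and T: "open T" "T \<noteq> {}" "T \<subseteq> good" "\<And>z. z \<in> T \<Longrightarrow> eps z = C * snd z"
    using eps_proportional by blast
  \<comment> \<open>The function \<open>s0 z\<close> + C z_n made homogeneous. The form is
    multiplied by \<mu> precisely because C + cnj C = 0.\<close>
  define S where "S x = snd x - 2 / of_real \<mu> * H (A (fst (fst x))) b + (C - H b b / of_real \<mu>) * snd (fst x)"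
    for x :: "'m cspace \<times> complex"
  define M where "M x = (N (fst x), S x)" for x
  have linM: "linear M"
    by (rule linearI)
      (simp_all add: M_def S_def N_def linear_add[OF linear_A] linear_scale[OF linear_A] H.add_left H.scaleR_left
        add_divide_distrib scaleR_conv_of_real[where 'a = complex] algebra_simps vec_eq_iff)
  have scM: "M (hscale c x) = hscale c (M x)" for c x
    by (simp add: M_def S_def N_def hscale_def cscale_def A_scale H_scale_left algebra_simps vec_eq_iff)
  have injM: "inj M"
    unfolding linear_injective_0[OF linM]
  proof (intro allI impI)
    fix x assume "M x = 0"
    then have N0: "N (fst x) = 0" and S0: "S x = 0" by (simp_all add: M_def zero_prod_def)
    then have xn: "snd (fst x) = 0" using \<mu>(2) by (simp add: N_def zero_prod_def)
    then have "A (fst (fst x)) = 0" using N0 by (simp add: N_def zero_prod_def)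
    then have x': "fst (fst x) = 0" using inj_A linear_0[OF linear_A] by (metis injD)
    then have "snd x = 0" using S0 xn by (simp add: S_def linear_0[OF linear_A] H.zero_left)
    then show "x = 0" using xn x' by (simp add: prod_eq_iff)
  qed
  have hermM: "herm (M x) (M x) = of_real \<mu> * herm x x" for x
  proof -
    let ?m = "complex_of_real \<mu>" and ?x = "fst (fst x)" and ?t = "snd (fst x)"
    have c: "cnj (H b b) = H b b" "cnj (H (A ?x) b) = H b (A ?x)" using H_swap by metis+
    have S: "?m * S x = ?m * snd x - 2 * H (A ?x) b + (?m * C - H b b) * ?t"
      "?m * cnj (S x) = ?m * cnj (snd x) - 2 * H b (A ?x) + (?m * cnj C - H b b) * cnj ?t"
      using \<mu>(2) by (simp_all add: S_def c field_simps)
    have "herm (M x) (M x) = 2 * H (A ?x + ?t *s b) (A ?x + ?t *s b) + ?t * (?m * cnj (S x)) + (?m * S x) * cnj ?t"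
      by (simp add: herm_def M_def N_def algebra_simps)
    also have "\<dots> = ?m * herm x x + ?m * (C + cnj C) * ?t * cnj ?t"
      unfolding S by (simp add: herm_def H.add_left H.add_right H_scale_left H_scale_right H_A' algebra_simps)
    finally show ?thesis using C by simp
  qed
  have "M (z, 1) = hscale (snd (M (z, 1))) (f z, 1)" if "z \<in> T" for z
  proof -
    have "S (z, 1) = s0 z + eps z" using T(4)[OF that] by (simp add: S_def s0_def algebra_simps)
    then have "S (z, 1) = sg z" by (simp add: eps_def)
    moreover have "cscale (sg z) (f z) = N z" using sg(2) T(3) that by blast
    ultimately show ?thesis by (simp add: M_def hscale_def)
  qed
  moreover have "T \<subseteq> ball 0 \<delta>" using T(3) by (auto simp: good_def)
  ultimately show ?thesis
    using linM scM injM hermM \<mu>(2) T unfolding similitude_def by blast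
qed

end

section \<open>Translations to the origin and global extension for vanishing \<beta>\<close>

context flat_normal_form
begin

lemma similitude_compose:
  assumes "similitude M m" "similitude M' m'"
  shows "similitude (\<lambda>x. M (M' x)) (m * m')"
  using assms linear_compose[of M' M] inj_compose[of M M']
  by (simp add: similitude_def o_def mult.assoc del: split_paired_All)

text \<open>The Heisenberg translation taking 0 to q when q is a boundary point; the term with H
  compensates the mixed terms of the Hermitian form.\<close>

definition trans :: "'m cspace \<Rightarrow> 'm cspace \<Rightarrow> 'm cspace" where
  "trans q z = (fst z + fst q, snd z + snd q - 2 * H (fst z) (fst q))"

definition trans_inv :: "'m cspace \<Rightarrow> 'm cspace" where
  "trans_inv q = (- fst q, - snd q - 2 * H (fst q) (fst q))"

definition htrans :: "'m cspace \<Rightarrow> 'm cspace \<times> complex \<Rightarrow> 'm cspace \<times> complex" where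
  "htrans q x = ((fst (fst x) + snd x *s fst q, snd (fst x) + snd x * snd q - 2 * H (fst (fst x)) (fst q)), snd x)"

lemma trans_trans_inv [simp]: "trans q (trans (trans_inv q) z) = z"
  by (simp add: trans_def trans_inv_def H.add_left H.minus_left H.minus_right H.diff_left)

lemma trans_inv_trans [simp]: "trans (trans_inv q) (trans q z) = z"
  by (simp add: trans_def trans_inv_def H.add_left H.minus_left H.minus_right H.diff_left)

lemma trans_0 [simp]: "trans q 0 = q"
  by (simp add: trans_def H.zero_left)

lemma trans_inv_self [simp]: "trans (trans_inv q) q = 0"
  using trans_inv_trans[of q 0] by simp

lemma def_fun_trans: "def_fun q = 0 \<Longrightarrow> def_fun (trans q z) = def_fun z"
  using arg_cong[OF H_swap[of "fst z" "fst q"], of Re]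
  by (simp add: def_fun_def trans_def H.add_left H.add_right)

lemma def_fun_trans_inv: "def_fun q = 0 \<Longrightarrow> def_fun (trans_inv q) = 0"
  by (simp add: def_fun_def trans_inv_def H.minus_left H.minus_right)

lemma htrans_affine: "htrans q (z, 1) = (trans q z, 1)"
  by (simp add: htrans_def trans_def)

lemma similitude_htrans:
  assumes "def_fun q = 0"
  shows "similitude (htrans q) 1"
  unfolding similitude_def
proof (intro conjI allI)
  show lin: "linear (htrans q)"
    by (rule linearI)
      (simp_all add: htrans_def H.add_left H.scaleR_left scaleR_conv_of_real[where 'a = complex] algebra_simps vec_eq_iff)
  show "htrans q (hscale c x) = hscale c (htrans q x)" for c x
    by (simp add: htrans_def hscale_def cscale_def H_scale_left algebra_simps vec_eq_iff)
  show "inj (htrans q)"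
    unfolding linear_injective_0[OF lin]
    by (auto simp: htrans_def zero_prod_def H.zero_left)
  show "herm (htrans q x) (htrans q x) = of_real 1 * herm x x" for x
  proof -
    have "snd q + cnj (snd q) = of_real (2 * Re (snd q))" by (simp add: complex_eq_iff)
    also have "\<dots> = - 2 * H (fst q) (fst q)"
      using assms H_self[of "fst q"] by (simp add: def_fun_def complex_eq_iff)
    finally have q: "cnj (snd q) = - 2 * H (fst q) (fst q) - snd q" by (simp add: algebra_simps)
    show ?thesis
      using H_swap[of "fst (fst x)" "fst q"]
      by (simp add: q herm_def htrans_def H.add_left H.add_right H_scale_left H_scale_right algebra_simps)
  qed
qed simp

definition trans_deriv :: "'m cspace \<Rightarrow> 'm cspace \<Rightarrow> 'm cspace" where
  "trans_deriv q v = (fst v, snd v - 2 * H (fst v) (fst q))"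

lemma has_derivative_trans: "(trans q has_derivative trans_deriv q) (at z)"
  unfolding trans_def[abs_def] trans_deriv_def[abs_def]
  by (auto intro!: derivative_eq_intros bounded_linear.has_derivative[OF H.bounded_linear_left])

lemma trans_deriv_scale: "trans_deriv q (cscale c v) = cscale c (trans_deriv q v)"
  by (simp add: trans_deriv_def cscale_def H_scale_left algebra_simps)

lemma inj_trans_deriv: "inj (trans_deriv q)"
  by (auto simp: inj_def trans_deriv_def prod_eq_iff)

lemma continuous_on_trans: "continuous_on S (trans q)"
  using has_derivative_continuous[OF has_derivative_trans] continuous_at_imp_continuous_on by blast

text \<open>Translating p and f(p) to 0 produces a \<open>segre_map\<close>. Local injectivity of f
  supplies \<open>f_nonzero\<close>, and the similitude found there is conjugated back.\<close>

lemma local_similitude: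
  assumes U: "open U" "p \<in> U" and p: "def_fun p = 0"
    and Df: "\<And>z. z \<in> U \<Longrightarrow> (f has_derivative Df z) (at z)"
    and hol: "\<And>z v. z \<in> U \<Longrightarrow> Df z (cscale \<i> v) = cscale \<i> (Df z v)"
    and bd: "\<And>z. z \<in> U \<Longrightarrow> def_fun z = 0 \<Longrightarrow> def_fun (f z) = 0"
    and injD: "inj (Df p)" and W: "open W" "p \<in> W" "inj_on f W"
  shows "\<exists>M m T. similitude M m \<and> open T \<and> T \<noteq> {} \<and> T \<subseteq> U \<and> (\<forall>z\<in>T. M (z, 1) = hscale (snd (M (z, 1))) (f z, 1))"
proof -
  define q where "q = f p"
  have q: "def_fun q = 0" unfolding q_def using bd U p by blast
  define g where "g z = trans (trans_inv q) (f (trans p z))" for z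
  define Dg where "Dg z v = trans_deriv (trans_inv q) (Df (trans p z) (trans_deriv p v))" for z v
  define V where "V = trans p -` (U \<inter> W)"
  have "open V" unfolding V_def
    by (intro open_vimage open_Int U W continuous_on_trans)
  moreover have "0 \<in> V" using U W by (simp add: V_def)
  ultimately obtain e where e: "e > 0" "ball 0 e \<subseteq> V" using open_contains_ball by blast
  have g_der: "(g has_derivative Dg z) (at z)" if "z \<in> V" for z
  proof -
    have "((\<lambda>z. f (trans p z)) has_derivative (\<lambda>v. Df (trans p z) (trans_deriv p v))) (at z)"
      by (rule has_derivative_compose[OF has_derivative_trans Df]) (use that in \<open>simp add: V_def\<close>)
    from has_derivative_compose[OF this has_derivative_trans] show ?thesis
      unfolding g_def[abs_def] Dg_def[abs_def] .
  qed
  have g_hol: "Dg z (cscale \<i> v) = cscale \<i> (Dg z v)" if "z \<in> V" for z v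
    using that by (simp add: Dg_def trans_deriv_scale hol V_def)
  have g_bd: "def_fun (g z) = 0" if "z \<in> V" "def_fun z = 0" for z
    using that bd[of "trans p z"] by (simp add: g_def V_def def_fun_trans def_fun_trans_inv p q)
  obtain \<delta> where polar_g: "\<delta> > 0" "ball 0 \<delta> \<subseteq> V"
      "\<And>z w. z \<in> ball 0 \<delta> \<Longrightarrow> w \<in> ball 0 \<delta> \<Longrightarrow> polar z w = 0 \<Longrightarrow> polar (g z) (g w) = 0"
    using polarization[OF e(2,1) g_der g_hol g_bd] by blast
  interpret segre_map \<beta> H g "Dg 0" \<delta>
  proof
    show "inj (Dg 0)"
      using injD inj_trans_deriv unfolding Dg_def trans_0 inj_def by blast
    show "g 0 = 0" by (simp add: g_def q_def)
    show "g z \<noteq> 0" if "z \<in> ball 0 \<delta>" "z \<noteq> 0" for z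
    proof
      assume "g z = 0"
      then have "trans q (g z) = q" by simp
      then have "f (trans p z) = f p" by (simp add: g_def q_def)
      moreover have "trans p z \<in> W" using that(1) polar_g(2) by (auto simp: V_def)
      ultimately have "trans p z = p" using W by (meson inj_onD)
      then have "trans (trans_inv p) (trans p z) = 0" by simp
      then show False using that(2) by simp
    qed
  qed (use polar_g \<open>0 \<in> V\<close> g_der g_hol in auto)
  obtain M m T where M: "similitude M m" and T: "open T" "T \<noteq> {}" "T \<subseteq> ball 0 \<delta>"
    and MT: "\<And>z. z \<in> T \<Longrightarrow> M (z, 1) = hscale (snd (M (z, 1))) (g z, 1)"
    using ex_similitude by blast
  define M' where "M' x = htrans q (M (htrans (trans_inv p) x))" for x
  define T' where "T' = trans (trans_inv p) -` T"
  have M': "similitude M' (1 * (m * 1))"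
    unfolding M'_def by (intro similitude_compose similitude_htrans M def_fun_trans_inv p q)
  have "open T'" unfolding T'_def by (intro open_vimage T continuous_on_trans)
  moreover have "T' \<noteq> {}"
  proof -
    obtain z where "z \<in> T" using T by blast
    then have "trans p z \<in> T'" by (simp add: T'_def)
    then show ?thesis by blast
  qed
  moreover have "T' \<subseteq> U"
  proof
    fix z assume "z \<in> T'"
    then have "trans (trans_inv p) z \<in> T" by (simp add: T'_def)
    then have "trans (trans_inv p) z \<in> V" using T(3) polar_g(2) by blast
    then show "z \<in> U" by (simp add: V_def)
  qed
  moreover have "M' (z, 1) = hscale (snd (M' (z, 1))) (f z, 1)" if "z \<in> T'" for z
  proof -
    let ?y = "trans (trans_inv p) z"
    let ?s = "snd (M (?y, 1))"
    have "?y \<in> T" using that by (simp add: T'_def)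
    have "M' (z, 1) = htrans q (hscale ?s (g ?y, 1))"
      unfolding M'_def htrans_affine by (subst MT[OF \<open>?y \<in> T\<close>]) simp
    also have "\<dots> = hscale ?s (trans q (g ?y), 1)"
      using similitude_htrans[OF q] unfolding similitude_def htrans_affine[symmetric] by blast
    also have "trans q (g ?y) = f z" by (simp add: g_def)
    finally show ?thesis by (simp add: hscale_def)
  qed
  ultimately show ?thesis using M' by blast
qed

theorem flat_extension:
  assumes U: "open U" "connected U" "p \<in> U" and p: "def_fun p = 0"
    and Df: "\<And>z. z \<in> U \<Longrightarrow> (f has_derivative Df z) (at z)"
    and hol: "\<And>z v. z \<in> U \<Longrightarrow> Df z (J z v) = J (f z) (Df z v)"
    and bd: "\<And>z. z \<in> U \<Longrightarrow> def_fun z = 0 \<Longrightarrow> def_fun (f z) = 0"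
    and injD: "inj (Df p)" and W: "open W" "p \<in> W" "inj_on f W"
  shows "\<exists>\<Phi>. J_automorphism Dom J \<Phi> \<and> (\<forall>z\<in>U \<inter> Dom. \<Phi> z = f z)"
proof -
  have hol': "Df z (cscale \<i> v) = cscale \<i> (Df z v)" if "z \<in> U" for z v
    using hol[OF that] by (simp add: J_flat)
  obtain M m T where M: "similitude M m" and T: "open T" "T \<noteq> {}" "T \<subseteq> U"
    and MT: "\<And>z. z \<in> T \<Longrightarrow> M (z, 1) = hscale (snd (M (z, 1))) (f z, 1)"
    using local_similitude[OF U(1,3) p Df hol' bd injD W] by blast
  have lin: "linear M" and sc: "\<And>c x. M (hscale c x) = hscale c (M x)"
    using M by (auto simp: similitude_def)
  have bl: "bounded_linear M" using lin by (simp add: linear_linear)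
  have scM: "M (cscale \<i> v, 0) = hscale \<i> (M (v, 0))" for v
    using sc[of \<i> "(v, 0)"] by (simp add: hscale_def)
  have dM: "((\<lambda>z. M (z, 1)) has_derivative (\<lambda>v. M (v, 0))) (at z)" for z
    by (rule bounded_linear.has_derivative[OF bl]) (auto intro!: derivative_eq_intros)
  obtain z0 where z0: "z0 \<in> T" using T by blast
  \<comment> \<open>Kept free of division, as the denominator may vanish at points of U outside
    \<open>Dom\<close>. Its complex components are J-functions on U that vanish on T.\<close>
  define \<Delta> where "\<Delta> z = fst (M (z, 1)) - cscale (snd (M (z, 1))) (f z)" for z
  define D\<Delta> where "D\<Delta> z v = fst (M (v, 0)) - (cscale (snd (M (z, 1))) (Df z v) + cscale (snd (M (v, 0))) (f z))" for z v
  have d\<Delta>: "(\<Delta> has_derivative D\<Delta> z) (at z)" if "z \<in> U" for z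
    unfolding \<Delta>_def[abs_def] D\<Delta>_def[abs_def]
    by (intro has_derivative_diff has_derivative_fst has_derivative_snd dM Df[OF that]
        bounded_bilinear.FDERIV[OF bounded_bilinear_cscale])
  have i\<Delta>: "D\<Delta> z (cscale \<i> v) = cscale \<i> (D\<Delta> z v)" if "z \<in> U" for z v
    unfolding D\<Delta>_def scM hol'[OF that]
    by (simp add: hscale_def bounded_bilinear.add_right[OF bounded_bilinear_cscale]
        bounded_bilinear.diff_right[OF bounded_bilinear_cscale] mult.commute)
  have comp0: "L (\<Delta> z) = 0"
    if L: "bounded_linear L" "\<And>v. L (cscale \<i> v) = \<i> * L v" and z: "z \<in> U" for L :: "'m cspace \<Rightarrow> complex" and z
  proof (rule J_function_unique_continuation[OF U(1,2) _ T(1) z0 _ _ z])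
    show "J_function_on U J (\<lambda>z. L (\<Delta> z))"
      unfolding J_function_on_def
    proof (intro ballI exI conjI allI)
      fix z v assume "z \<in> U"
      show "((\<lambda>z. L (\<Delta> z)) has_derivative (\<lambda>v. L (D\<Delta> z v))) (at z)"
        by (rule bounded_linear.has_derivative[OF L(1) d\<Delta>[OF \<open>z \<in> U\<close>]])
      show "L (D\<Delta> z (J z v)) = \<i> * L (D\<Delta> z v)"
        by (simp add: J_flat i\<Delta>[OF \<open>z \<in> U\<close>] L(2))
    qed
    show "L (\<Delta> y) = 0" if "y \<in> T" for y
    proof -
      have "fst (M (y, 1)) = cscale (snd (M (y, 1))) (f y)"
        using arg_cong[OF MT[OF that], of fst] by (simp add: hscale_def)
      then show ?thesis using bounded_linear.linear[OF L(1)] by (simp add: \<Delta>_def linear_0)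
    qed
    show "z0 \<in> U" using z0 T by blast
  qed
  have \<Delta>0: "\<Delta> z = 0" if "z \<in> U" for z
  proof (rule prod_eqI)
    show "snd (\<Delta> z) = snd 0"
      using comp0[OF bounded_linear_snd _ that] by (simp add: cscale_def)
    have "fst (\<Delta> z) $ i = 0" for i
      using comp0[OF bounded_linear_compose[OF bounded_linear_vec_nth bounded_linear_fst] _ that] by (simp add: cscale_def)
    then show "fst (\<Delta> z) = fst 0" by (simp add: vec_eq_iff)
  qed
  have "proj_map M z = f z" if "z \<in> U \<inter> Dom" for z
    using \<Delta>0[of z] similitude_denominator(1)[OF M, of z] that
    by (simp add: proj_map_def \<Delta>_def)
  then show ?thesis using J_automorphism_proj_map[OF M] by blast
qed

end

section \<open>The non-integrable case\<close>

text \<open>T is a component of the second derivative and c its failure to be complex linear in the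
  second argument. In \<open>T (j w) (j v)\<close> the two factors j can be taken out in either
  order, and comparing the results forces c to be symmetric.\<close>

lemma symmetric_defect:
  fixes T c :: "'a \<Rightarrow> 'a \<Rightarrow> complex"
  assumes T: "\<And>v w. T v w = T w v" and TJ: "\<And>v w. T w (j v) = \<i> * T w v + c w v"
    and c: "\<And>v w. c (j w) v = - \<i> * c w v"
  shows "c w v = c v w" "T (j w) (j v) = - T w v"
proof -
  have eq: "T (j w) (j v) = - T w v + \<i> * c v w - \<i> * c w v" for v w
    using TJ[of "j w" v] TJ[of v w] T[of "j w" v] T[of v w] c[of w v] by (simp add: algebra_simps)
  have "- T w v + \<i> * c v w - \<i> * c w v = - T v w + \<i> * c w v - \<i> * c v w"
    using eq[of v w] eq[of w v] T[of "j w" "j v"] by metis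
  then have "2 * \<i> * (c v w - c w v) = 0" using T[of v w] by (simp add: algebra_simps)
  then show "c w v = c v w" by simp
  with eq[of w v] show "T (j w) (j v) = - T w v" by simp
qed

section \<open>Derivatives of pseudo-holomorphic maps for nonzero \<beta>\<close>

locale curved_map = normal_form \<beta> H
  for \<beta> H :: "complex ^ 'm::finite \<Rightarrow> complex ^ 'm \<Rightarrow> complex" +
  fixes f :: "'m cspace \<Rightarrow> 'm cspace" and Df :: "'m cspace \<Rightarrow> 'm cspace \<Rightarrow> 'm cspace"
    and S :: "'m cspace \<Rightarrow> 'm cspace \<Rightarrow> 'm cspace \<Rightarrow> 'm cspace" and U p w0 v0
  assumes \<beta>_nonzero: "\<beta> w0 v0 \<noteq> 0"
    and U: "open U" "connected U" "p \<in> U" and p: "def_fun p = 0"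
    and Df: "z \<in> U \<Longrightarrow> (f has_derivative Df z) (at z)"
    and D2f: "z \<in> U \<Longrightarrow> ((\<lambda>y. Df y v) has_derivative (\<lambda>w. S z w v)) (at z)"
    and hol: "z \<in> U \<Longrightarrow> Df z (J z v) = J (f z) (Df z v)"
    and bd: "z \<in> U \<Longrightarrow> def_fun z = 0 \<Longrightarrow> def_fun (f z) = 0"
    and inj_Df: "inj (Df p)"
begin

lemma linear_Df: "z \<in> U \<Longrightarrow> linear (Df z)"
  using Df has_derivative_linear by blast

lemma S_sym: "z \<in> U \<Longrightarrow> S z v w = S z w v"
  by (rule symmetric_second_derivative[OF U(1) _ Df D2f])

lemma Df_i: "z \<in> U \<Longrightarrow> fst (Df z (J z v)) = \<i> *s fst (Df z v)"
  "z \<in> U \<Longrightarrow> snd (Df z (J z v)) = \<i> * snd (Df z v) + \<beta> (fst (f z)) (fst (Df z v))"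
  by (simp_all add: hol) (simp_all add: model_J_def)

lemma fst_Df_vertical_i: "z \<in> U \<Longrightarrow> fst (Df z (0, \<i> * x)) = \<i> *s fst (Df z (0, x))"
  using Df_i(1)[of z "(0, x)"] by (simp add: model_J_def \<beta>.zero_right)

text \<open>The derivative of J in the direction w contributes the second summand.\<close>

lemma has_derivative_Df_J:
  assumes z: "z \<in> U"
  shows "((\<lambda>y. Df y (J y v)) has_derivative (\<lambda>w. S z w (J z v) + Df z (0, \<beta> (fst w) (fst v)))) (at z)"
proof -
  let ?c = "(\<i> *s fst v, \<i> * snd v)"
  \<comment> \<open>\<open>J y v\<close> depends on y only through a vertical complex number. Its
    real and imaginary parts become scalar coefficients, and \<open>D2f\<close> can be applied in
    fixed directions.\<close>
  have split: "Df y (a + (0, x)) = Df y a + Re x *\<^sub>R Df y (0, 1) + Im x *\<^sub>R Df y (0, \<i>)" if "y \<in> U" for y a x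
  proof -
    have eq: "a + (0, x) = a + Re x *\<^sub>R (0, 1) + Im x *\<^sub>R (0, \<i>)" by (simp add: prod_eq_iff complex_eq_iff)
    show ?thesis unfolding eq by (simp only: linear_add[OF linear_Df[OF that]] linear_scale[OF linear_Df[OF that]])
  qed
  have J_eq: "J y v = ?c + (0, \<beta> (fst y) (fst v))" for y
    by (simp add: model_J_def)
  have d\<beta>: "((\<lambda>y. \<beta> (fst y) (fst v)) has_derivative (\<lambda>w. \<beta> (fst w) (fst v))) (at z)"
    by (rule bounded_linear.has_derivative[OF \<beta>.bounded_linear_left has_derivative_fst[OF has_derivative_ident]])
  have d: "((\<lambda>y. Df y ?c + Re (\<beta> (fst y) (fst v)) *\<^sub>R Df y (0, 1) + Im (\<beta> (fst y) (fst v)) *\<^sub>R Df y (0, \<i>)) has_derivative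
     (\<lambda>w. S z w ?c + (Re (\<beta> (fst z) (fst v)) *\<^sub>R S z w (0, 1) + Re (\<beta> (fst w) (fst v)) *\<^sub>R Df z (0, 1))
        + (Im (\<beta> (fst z) (fst v)) *\<^sub>R S z w (0, \<i>) + Im (\<beta> (fst w) (fst v)) *\<^sub>R Df z (0, \<i>)))) (at z)"
    by (intro has_derivative_add has_derivative_scaleR D2f[OF z] has_derivative_Re has_derivative_Im d\<beta>)
  have SJ: "S z w (J z v) = S z w ?c + Re (\<beta> (fst z) (fst v)) *\<^sub>R S z w (0, 1) + Im (\<beta> (fst z) (fst v)) *\<^sub>R S z w (0, \<i>)" for w
  proof -
    have "S z w = (\<lambda>v. S z v w)" using S_sym[OF z] by (intro ext)
    then have lin: "linear (S z w)"
      using has_derivative_linear[OF D2f[OF z, of w]] by (simp only:)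
    have eq: "J z v = ?c + Re (\<beta> (fst z) (fst v)) *\<^sub>R (0, 1) + Im (\<beta> (fst z) (fst v)) *\<^sub>R (0, \<i>)"
      by (simp add: model_J_def prod_eq_iff complex_eq_iff)
    show ?thesis unfolding eq by (simp only: linear_add[OF lin] linear_scale[OF lin])
  qed
  have D0: "Df z (0, x) = Re x *\<^sub>R Df z (0, 1) + Im x *\<^sub>R Df z (0, \<i>)" for x
    using split[OF z, of 0 x] linear_0[OF linear_Df[OF z]] by simp
  have "((\<lambda>y. Df y ?c + Re (\<beta> (fst y) (fst v)) *\<^sub>R Df y (0, 1) + Im (\<beta> (fst y) (fst v)) *\<^sub>R Df y (0, \<i>)) has_derivative
     (\<lambda>w. S z w (J z v) + Df z (0, \<beta> (fst w) (fst v)))) (at z)"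
    by (rule has_derivative_eq_rhs[OF d]) (rule ext, simp only: SJ D0[of "\<beta> _ _"] ac_simps)
  then show ?thesis
    by (rule has_derivative_transform_within_open[OF _ U(1) z]) (simp only: J_eq split)
qed

lemma fst_S_J:
  assumes z: "z \<in> U"
  shows "fst (S z w (J z v)) + fst (Df z (0, \<beta> (fst w) (fst v))) = \<i> *s fst (S z w v)"
proof -
  have "((\<lambda>y. fst (Df y (J y v))) has_derivative (\<lambda>w. fst (S z w (J z v) + Df z (0, \<beta> (fst w) (fst v))))) (at z)"
    by (rule has_derivative_fst[OF has_derivative_Df_J[OF z]])
  moreover have "((\<lambda>y. \<i> *s fst (Df y v)) has_derivative (\<lambda>w. \<i> *s fst (S z w v))) (at z)"
    by (rule bounded_linear.has_derivative[OF bounded_bilinear.bounded_linear_right[OF bounded_bilinear_vector_scalar_mult]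
          has_derivative_fst[OF D2f[OF z]]])
  then have "((\<lambda>y. fst (Df y (J y v))) has_derivative (\<lambda>w. \<i> *s fst (S z w v))) (at z)"
    by (rule has_derivative_transform_within_open[OF _ U(1) z]) (simp add: Df_i)
  ultimately have "(\<lambda>w. fst (S z w (J z v) + Df z (0, \<beta> (fst w) (fst v)))) = (\<lambda>w. \<i> *s fst (S z w v))"
    by (rule has_derivative_unique)
  from fun_cong[OF this, of w] show ?thesis by simp
qed

text \<open>By \<open>fst_S_J\<close>, the failure of \<open>fst S\<close> to be complex linear is
  minus the image of the vertical vector \<beta>(w, v). It is alternating in w and v, yet symmetric
  by \<open>symmetric_defect\<close>, and so it is 0.\<close>

lemma fst_Df_vertical:
  assumes z: "z \<in> U"
  shows "fst (Df z (0, x)) = 0"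
proof -
  have "fst (Df z (0, \<beta> w v)) $ i = 0" for w v i
  proof -
    let ?c = "\<lambda>(w :: 'm cspace) (v :: 'm cspace). - fst (Df z (0, \<beta> (fst w) (fst v))) $ i"
    have "?c (w, 0) (v, 0) = ?c (v, 0) (w, 0)"
    proof (rule symmetric_defect(1)[where T = "\<lambda>w v. fst (S z w v) $ i" and j = "J z" and c = ?c])
      show "fst (S z w (J z v)) $ i = \<i> * fst (S z w v) $ i + - fst (Df z (0, \<beta> (fst w) (fst v))) $ i" for w v
        using arg_cong[OF fst_S_J[OF z, of w v], of "\<lambda>x. x $ i"] by (simp add: algebra_simps)
      show "- fst (Df z (0, \<beta> (fst (J z w)) (fst v))) $ i = - \<i> * - fst (Df z (0, \<beta> (fst w) (fst v))) $ i" for w v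
      proof -
        have "fst (Df z (0, \<beta> (fst w) (fst v))) = \<i> *s fst (Df z (0, \<beta> (fst (J z w)) (fst v)))"
          using fst_Df_vertical_i[OF z, of "\<beta> (fst (J z w)) (fst v)"]
          by (simp add: model_J_def \<beta>_scale_left)
        then show ?thesis by simp
      qed
    qed (simp add: S_sym[OF z])
    moreover have "fst (Df z (0, - \<beta> w v)) = - fst (Df z (0, \<beta> w v))"
      using linear_neg[OF linear_Df[OF z], of "(0, \<beta> w v)"] by simp
    ultimately show ?thesis using \<beta>_swap[of v w] by simp
  qed
  \<comment> \<open>By antilinearity every complex x is a value of \<beta>( _ , v0).\<close>
  then have "fst (Df z (0, \<beta> (cnj (x / \<beta> w0 v0) *s w0) v0)) = 0" by (simp add: vec_eq_iff)
  then show ?thesis using \<beta>_nonzero by (simp add: \<beta>_scale_left)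
qed

definition A :: "'m cspace \<Rightarrow> complex ^ 'm \<Rightarrow> complex ^ 'm" where
  "A z x = fst (Df z (x, 0))"

definition lam :: "'m cspace \<Rightarrow> complex" where
  "lam z = snd (Df z (0, 1))"

lemma fst_Df: "z \<in> U \<Longrightarrow> fst (Df z v) = A z (fst v)"
  using linear_add[OF linear_Df, of z "(fst v, 0)" "(0, snd v)"] fst_Df_vertical[of z "snd v"]
  by (simp add: A_def)

lemma linear_A: "z \<in> U \<Longrightarrow> linear (A z)"
  by (rule linearI)
    (simp_all add: A_def linear_add[OF linear_Df, symmetric] linear_scale[OF linear_Df, symmetric]
      flip: fst_add fst_scaleR)

lemma A_i: "z \<in> U \<Longrightarrow> A z (\<i> *s x) = \<i> *s A z x"
  using Df_i(1)[of z "(x, 0)"] by (simp add: fst_Df model_J_def)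

lemma snd_Df_vertical:
  assumes z: "z \<in> U"
  shows "snd (Df z (0, x)) = lam z * x"
  unfolding lam_def
proof (rule linear_complex_multiple[of "\<lambda>x. snd (Df z (0, x))"])
  show "linear (\<lambda>x. snd (Df z (0, x)))"
    by (rule linearI)
      (simp_all add: linear_add[OF linear_Df[OF z], symmetric] linear_scale[OF linear_Df[OF z], symmetric]
        flip: snd_add snd_scaleR)
  show "snd (Df z (0, \<i> * x)) = \<i> * snd (Df z (0, x))" for x
    using Df_i(2)[OF z, of "(0, x)"] fst_Df_vertical[OF z, of x] by (simp add: model_J_def \<beta>.zero_right)
qed

lemma has_derivative_fst_Df:
  "z \<in> U \<Longrightarrow> ((\<lambda>y. A y x) has_derivative (\<lambda>w. fst (S z w (x, 0)))) (at z)"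
  unfolding A_def by (rule has_derivative_fst[OF D2f])

lemma fst_S_vertical:
  assumes z: "z \<in> U"
  shows "fst (S z w (0, x)) = 0"
proof -
  have "((\<lambda>y. fst (Df y (0, x))) has_derivative (\<lambda>w. fst (S z w (0, x)))) (at z)"
    by (rule has_derivative_fst[OF D2f[OF z]])
  moreover have "((\<lambda>y. fst (Df y (0, x))) has_derivative (\<lambda>w. 0)) (at z)"
    by (rule has_derivative_transform_within_open[OF has_derivative_const U(1) z]) (simp add: fst_Df_vertical)
  ultimately have "(\<lambda>w. fst (S z w (0, x))) = (\<lambda>w. 0)" by (rule has_derivative_unique)
  then show ?thesis by meson
qed

lemma fst_S_i: "z \<in> U \<Longrightarrow> fst (S z w (J z v)) = \<i> *s fst (S z w v)"
  "z \<in> U \<Longrightarrow> fst (S z (J z w) v) = \<i> *s fst (S z w v)"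
  using fst_S_J[of z w v] fst_S_J[of z v w] by (simp_all add: fst_Df_vertical S_sym[of z v])

text \<open>The failure of \<open>snd S\<close> to be complex linear. The first two summands are
  alternating in w and v and the third is symmetric, so that \<open>symmetric_defect\<close> forces
  the first two to cancel; this is \<open>\<beta>_A\<close>.\<close>

definition defect :: "'m cspace \<Rightarrow> 'm cspace \<Rightarrow> 'm cspace \<Rightarrow> complex" where
  "defect z w v = \<beta> (A z (fst w)) (A z (fst v)) - lam z * \<beta> (fst w) (fst v) + \<beta> (fst (f z)) (fst (S z w v))"

lemma snd_S_J:
  assumes z: "z \<in> U"
  shows "snd (S z w (J z v)) = \<i> * snd (S z w v) + defect z w v"
proof -
  have "((\<lambda>y. snd (Df y (J y v))) has_derivative (\<lambda>w. snd (S z w (J z v) + Df z (0, \<beta> (fst w) (fst v))))) (at z)"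
    by (rule has_derivative_snd[OF has_derivative_Df_J[OF z]])
  moreover have "((\<lambda>y. \<i> * snd (Df y v) + \<beta> (fst (f y)) (fst (Df y v))) has_derivative
      (\<lambda>w. \<i> * snd (S z w v) + (\<beta> (fst (f z)) (fst (S z w v)) + \<beta> (fst (Df z w)) (fst (Df z v))))) (at z)"
    by (intro has_derivative_add has_derivative_mult_right has_derivative_snd has_derivative_fst \<beta>.FDERIV D2f Df z)
  then have "((\<lambda>y. snd (Df y (J y v))) has_derivative
      (\<lambda>w. \<i> * snd (S z w v) + (\<beta> (fst (f z)) (fst (S z w v)) + \<beta> (fst (Df z w)) (fst (Df z v))))) (at z)"
    by (rule has_derivative_transform_within_open[OF _ U(1) z]) (simp add: Df_i)
  ultimately have "(\<lambda>w. snd (S z w (J z v) + Df z (0, \<beta> (fst w) (fst v)))) =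
      (\<lambda>w. \<i> * snd (S z w v) + (\<beta> (fst (f z)) (fst (S z w v)) + \<beta> (fst (Df z w)) (fst (Df z v))))"
    by (rule has_derivative_unique)
  from fun_cong[OF this, of w] show ?thesis
    by (simp add: snd_Df_vertical[OF z] fst_Df[OF z] defect_def algebra_simps)
qed

lemma defect_J: "z \<in> U \<Longrightarrow> defect z (J z w) v = - \<i> * defect z w v"
  by (simp add: defect_def fst_S_i(2) \<beta>_scale_right)
    (simp add: model_J_def \<beta>_scale_left A_i algebra_simps)

lemma \<beta>_A:
  assumes z: "z \<in> U"
  shows "\<beta> (A z w) (A z v) = lam z * \<beta> w v"
proof -
  have "defect z (w, 0) (v, 0) = defect z (v, 0) (w, 0)"
    by (rule symmetric_defect(1)[where T = "\<lambda>w v. snd (S z w v)" and j = "J z"])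
      (rule arg_cong[OF S_sym[OF z]] snd_S_J[OF z] defect_J[OF z])+
  then have "2 * (\<beta> (A z w) (A z v) - lam z * \<beta> w v) = 0"
    using \<beta>_swap[of w v] \<beta>_swap[of "A z w" "A z v"] by (simp add: defect_def S_sym[OF z, of "(v, 0)"])
  then show ?thesis by simp
qed

text \<open>Used to eliminate second derivatives: applying J to both arguments reverses the sign of
  S, but leaves Hermitian terms alone.\<close>

lemma S_JJ:
  assumes z: "z \<in> U"
  shows "snd (S z (J z w) (J z v)) = - snd (S z w v)" "fst (S z (J z w) (J z v)) = - fst (S z w v)"
proof -
  show "snd (S z (J z w) (J z v)) = - snd (S z w v)"
    by (rule symmetric_defect(2)[where T = "\<lambda>w v. snd (S z w v)" and j = "J z"])
      (rule arg_cong[OF S_sym[OF z]] snd_S_J[OF z] defect_J[OF z])+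
  show "fst (S z (J z w) (J z v)) = - fst (S z w v)"
    by (simp add: fst_S_i z vector_smult_assoc)
qed

text \<open>The differential of \<open>lam\<close> is J-linear because \<open>snd S\<close> is, and J-antilinear by \<open>\<beta>_A\<close>.\<close>

lemma has_derivative_lam:
  assumes z: "z \<in> U"
  shows "(lam has_derivative (\<lambda>x. 0)) (at z)"
proof -
  let ?D = "\<lambda>x. snd (S z x (0, 1))"
  have d: "(lam has_derivative ?D) (at z)"
    unfolding lam_def[abs_def] by (rule has_derivative_snd[OF D2f[OF z]])
  have plus: "?D (J z x) = \<i> * ?D x" for x
    using snd_S_J[OF z, of "(0, 1)" x] linear_0[OF linear_A[OF z]] fst_S_vertical[OF z, of x 1]
    by (simp add: defect_def S_sym[OF z, of "(0, 1)"] \<beta>.zero_left \<beta>.zero_right)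
  have "((\<lambda>y. \<beta> (A y w0) (A y v0)) has_derivative
      (\<lambda>x. \<beta> (A z w0) (fst (S z x (v0, 0))) + \<beta> (fst (S z x (w0, 0))) (A z v0))) (at z)"
    by (intro \<beta>.FDERIV has_derivative_fst_Df z)
  then have "((\<lambda>y. lam y * \<beta> w0 v0) has_derivative
      (\<lambda>x. \<beta> (A z w0) (fst (S z x (v0, 0))) + \<beta> (fst (S z x (w0, 0))) (A z v0))) (at z)"
    by (rule has_derivative_transform_within_open[OF _ U(1) z]) (simp add: \<beta>_A)
  moreover have "((\<lambda>y. lam y * \<beta> w0 v0) has_derivative (\<lambda>x. ?D x * \<beta> w0 v0)) (at z)"
    by (rule has_derivative_mult_left[OF d])
  ultimately have "(\<lambda>x. ?D x * \<beta> w0 v0) =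
      (\<lambda>x. \<beta> (A z w0) (fst (S z x (v0, 0))) + \<beta> (fst (S z x (w0, 0))) (A z v0))"
    by (rule has_derivative_unique[rotated])
  then have eq: "?D x * \<beta> w0 v0 = \<beta> (A z w0) (fst (S z x (v0, 0))) + \<beta> (fst (S z x (w0, 0))) (A z v0)" for x
    by (rule fun_cong)
  have "?D (J z x) * \<beta> w0 v0 = - \<i> * (?D x * \<beta> w0 v0)" for x
    unfolding eq fst_S_i(2)[OF z] \<beta>_scale_left \<beta>_scale_right by (simp add: algebra_simps)
  then have "\<i> * ?D x * \<beta> w0 v0 + \<i> * ?D x * \<beta> w0 v0 = 0" for x
    unfolding plus by (simp only: eq_neg_iff_add_eq_0[symmetric] mult.assoc mult_minus_left)
  then have "?D = (\<lambda>x. 0)" using \<beta>_nonzero by (intro ext) (simp flip: mult_2)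
  then show ?thesis using d by (simp only:)
qed

end

section \<open>The boundary condition for nonzero \<beta>\<close>

context normal_form
begin

lemma has_derivative_def_fun:
  "(def_fun has_derivative (\<lambda>v. Re (snd v) + 2 * Re (H (fst v) (fst z)))) (at z)"
proof -
  have d: "(def_fun has_derivative (\<lambda>v. Re (snd v) + Re (H (fst z) (fst v) + H (fst v) (fst z)))) (at z)"
    unfolding def_fun_def[abs_def]
    by (intro has_derivative_add has_derivative_Re has_derivative_snd has_derivative_fst has_derivative_ident H.FDERIV)
  have e: "Re (H (fst z) (fst v) + H (fst v) (fst z)) = 2 * Re (H (fst v) (fst z))" for v
    using H_swap[of "fst z" "fst v"] by simp
  show ?thesis by (rule has_derivative_eq_rhs[OF d]) (simp only: e)
qed

end

context curved_map
begin

definition l :: real where "l = Re (lam p)"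

text \<open>Constancy follows from \<open>has_derivative_lam\<close> and connectedness of U. For
  reality, the curve p + t (0, i) stays on the boundary, so the real part of i lam is 0 at
  p.\<close>

lemma lam_eq:
  assumes z: "z \<in> U"
  shows "lam z = of_real l"
proof -
  have "Re (snd (Df p (0, \<i>))) + 2 * Re (H (fst (Df p (0, \<i>))) (fst (f p))) = 0"
  proof (rule derivative_along_curve_eq_0[where \<gamma> = "\<lambda>t. p + t *\<^sub>R (0, \<i>)" and g = "\<lambda>z. def_fun (f z)"
        and g' = "\<lambda>v. Re (snd (Df p v)) + 2 * Re (H (fst (Df p v)) (fst (f p)))"])
    have "(f has_derivative Df p) (at (p + 0 *\<^sub>R (0, \<i>)))" using Df[OF U(3)] by (simp flip: zero_prod_def)
    from has_derivative_compose[OF this has_derivative_def_fun]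
    show "((\<lambda>z. def_fun (f z)) has_derivative (\<lambda>v. Re (snd (Df p v)) + 2 * Re (H (fst (Df p v)) (fst (f p)))))
        (at (p + 0 *\<^sub>R (0, \<i>)))"
      by (simp flip: zero_prod_def)
    show curve: "((\<lambda>t. p + t *\<^sub>R (0, \<i>)) has_vector_derivative (0, \<i>)) (at 0)"
      by (auto intro!: derivative_eq_intros)
    have "\<forall>\<^sub>F t in nhds (0::real). p + t *\<^sub>R (0, \<i>) \<in> U"
      using U by (intro eventually_curve_in has_vector_derivative_continuous[OF curve]) (simp_all flip: zero_prod_def)
    then show "\<forall>\<^sub>F t in nhds 0. def_fun (f (p + t *\<^sub>R (0, \<i>))) = 0"
    proof eventually_elim
      case (elim t)
      then show ?case using p by (intro bd) (simp_all add: def_fun_def)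
    qed
  qed
  then have "Im (lam p) = 0"
    by (simp add: fst_Df_vertical[OF U(3)] snd_Df_vertical[OF U(3)] H.zero_left)
  moreover have "lam z = lam p"
    by (rule has_derivative_zero_unique_connected[OF U(1,2) has_derivative_lam z U(3)])
  ultimately show ?thesis by (simp add: l_def complex_eq_iff)
qed

definition Dr :: "'m cspace \<Rightarrow> 'm cspace \<Rightarrow> real" where
  "Dr z v = Re (snd (Df z v)) + 2 * Re (H (fst (Df z v)) (fst (f z))) - l * (Re (snd v) + 2 * Re (H (fst v) (fst z)))"

lemma has_derivative_r:
  assumes z: "z \<in> U"
  shows "((\<lambda>z. def_fun (f z) - l * def_fun z) has_derivative Dr z) (at z)"
  unfolding Dr_def[abs_def]
  by (intro has_derivative_diff has_derivative_mult_right has_derivative_def_fun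
      has_derivative_compose[OF Df[OF z] has_derivative_def_fun])

text \<open>The derivative of \<open>f\<close> multiplies vertical vectors by l, so the difference
  of the two sides is constant on vertical segments. Near p such a segment starts at a boundary
  point, where both sides are 0.\<close>

lemma def_fun_f_near: "\<exists>e>0. ball p e \<subseteq> U \<and> (\<forall>z\<in>ball p e. def_fun (f z) = l * def_fun z)"
proof -
  obtain r where r: "r > 0" "ball p r \<subseteq> U" using U open_contains_ball by blast
  \<comment> \<open>The boundary point reached from z by changing Re z_n. If z and
    \<open>base z\<close> are in the ball of radius r, then so is the segment joining them.\<close>
  define base where "base z = (fst z, snd z - of_real (def_fun z))" for z
  have "continuous_on UNIV base"
    unfolding base_def by (intro continuous_intros continuous_def_fun)
  then have "open (base -` ball p r \<inter> ball p r)" by (intro open_Int open_vimage open_ball)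
  moreover have "base p = p" using p by (simp add: base_def)
  then have "p \<in> base -` ball p r \<inter> ball p r" using r by simp
  ultimately obtain e where e: "e > 0" "ball p e \<subseteq> base -` ball p r \<inter> ball p r"
    using open_contains_ball by blast
  have "def_fun (f z) = l * def_fun z" if z: "z \<in> ball p e" for z
  proof -
    let ?s = "def_fun z" and ?g = "\<lambda>z. def_fun (f z) - l * def_fun z"
    define c where "c t = base z + t *\<^sub>R (0, of_real ?s)" for t :: real
    have c_in: "c t \<in> U" if t: "t \<in> {0..1}" for t
    proof -
      have "(1 - t) *\<^sub>R base z + t *\<^sub>R z \<in> ball p r"
        using z e t by (intro convexD[OF convex_ball]) auto
      moreover have "(1 - t) *\<^sub>R base z + t *\<^sub>R z = c t"
        by (simp add: c_def base_def prod_eq_iff scaleR_conv_of_real[where 'a = complex] algebra_simps)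
      ultimately show ?thesis using r by auto
    qed
    have "?g (c 0) = ?g (c 1)"
    proof (rule has_derivative_zero_unique[where s = "{0..1::real}" and f = "\<lambda>t. ?g (c t)" and x = 0 and y = 1])
      fix t :: real assume t: "t \<in> {0..1}"
      have "(c has_derivative (\<lambda>h. h *\<^sub>R (0, of_real ?s))) (at t)"
        unfolding c_def[abs_def] by (auto intro!: derivative_eq_intros)
      from has_derivative_compose[OF this has_derivative_r[OF c_in[OF t]]]
      have "((\<lambda>t. ?g (c t)) has_derivative (\<lambda>h. Dr (c t) (h *\<^sub>R (0, of_real ?s)))) (at t)" .
      moreover have "Dr (c t) (h *\<^sub>R (0, of_real ?s)) = 0" for h
        using fst_Df_vertical[OF c_in[OF t], of "h *\<^sub>R of_real ?s"] snd_Df_vertical[OF c_in[OF t], of "h *\<^sub>R of_real ?s"]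
        by (simp add: Dr_def lam_eq[OF c_in[OF t]] H.zero_left)
      ultimately have "((\<lambda>t. ?g (c t)) has_derivative (\<lambda>h. 0)) (at t)" by simp
      then show "((\<lambda>t. ?g (c t)) has_derivative (\<lambda>h. 0)) (at t within {0..1})"
        by (rule has_derivative_at_withinI)
    qed auto
    moreover have "c 1 = z" by (simp add: c_def base_def prod_eq_iff)
    moreover have "c 0 = base z" by (simp add: c_def flip: zero_prod_def)
    moreover have "def_fun (base z) = 0" by (simp add: base_def def_fun_def)
    moreover have "base z \<in> ball p r" using z e(2) by blast
    then have "base z \<in> U" using r by blast
    ultimately show ?thesis using bd[of "base z"] by simp
  qed
  then show ?thesis using e r by (intro exI[of _ e]) auto
qed

text \<open>Fixing one ball gives a convex set on which functions with zero derivative are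
  constant.\<close>

definition V :: "'m cspace set" where
  "V = ball p (SOME e. e > 0 \<and> ball p e \<subseteq> U \<and> (\<forall>z\<in>ball p e. def_fun (f z) = l * def_fun z))"

lemma V: "open V" "convex V" "p \<in> V" "V \<subseteq> U" "z \<in> V \<Longrightarrow> def_fun (f z) = l * def_fun z"
  using someI_ex[OF def_fun_f_near] by (auto simp: V_def)

lemma V_U: "z \<in> V \<Longrightarrow> z \<in> U"
  using V by blast

lemma Dr_0:
  assumes z: "z \<in> V"
  shows "Dr z v = 0"
proof -
  have "((\<lambda>z. def_fun (f z) - l * def_fun z) has_derivative (\<lambda>v. 0)) (at z)"
    by (rule has_derivative_transform_within_open[OF has_derivative_const V(1) z]) (simp add: V(5))
  with has_derivative_r[OF V_U[OF z]] have "Dr z = (\<lambda>v. 0)" by (rule has_derivative_unique)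
  then show ?thesis by simp
qed

lemma D2r_0:
  assumes z: "z \<in> V"
  shows "Re (snd (S z w v)) + 2 * Re (H (fst (Df z v)) (fst (Df z w)) + H (fst (S z w v)) (fst (f z)))
    = l * (2 * Re (H (fst v) (fst w)))"
proof -
  have zU: "z \<in> U" by (rule V_U[OF z])
  have "((\<lambda>y. Re (snd (Df y v)) + 2 * Re (H (fst (Df y v)) (fst (f y))) - l * (Re (snd v) + 2 * Re (H (fst v) (fst y)))) has_derivative
     (\<lambda>w. Re (snd (S z w v)) + 2 * Re (H (fst (Df z v)) (fst (Df z w)) + H (fst (S z w v)) (fst (f z)))
        - l * (0 + 2 * Re (H (fst v) (fst w))))) (at z)"
    by (intro has_derivative_add has_derivative_diff has_derivative_mult_right has_derivative_Re has_derivative_fst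
        has_derivative_snd has_derivative_const has_derivative_ident H.FDERIV D2f[OF zU] Df[OF zU]
        bounded_linear.has_derivative[OF H.bounded_linear_right])
  then have "((\<lambda>y. Dr y v) has_derivative (\<lambda>w. Re (snd (S z w v)) + 2 * Re (H (fst (Df z v)) (fst (Df z w)) + H (fst (S z w v)) (fst (f z)))
        - l * (0 + 2 * Re (H (fst v) (fst w))))) (at z)"
    unfolding Dr_def[symmetric] .
  moreover have "((\<lambda>y. Dr y v) has_derivative (\<lambda>w. 0)) (at z)"
    by (rule has_derivative_transform_within_open[OF has_derivative_const V(1) z]) (simp add: Dr_0)
  ultimately have "(\<lambda>w. Re (snd (S z w v)) + 2 * Re (H (fst (Df z v)) (fst (Df z w)) + H (fst (S z w v)) (fst (f z)))
        - l * (0 + 2 * Re (H (fst v) (fst w)))) = (\<lambda>w. 0)"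
    by (rule has_derivative_unique)
  from fun_cong[OF this, of w] show ?thesis by simp
qed

text \<open>Add \<open>D2r_0\<close> for a pair of vectors and for their images under J: by
  \<open>S_JJ\<close> the second derivatives cancel, leaving the real part of the identity.
  Replacing y by i y gives the imaginary part.\<close>

lemma H_A:
  assumes z: "z \<in> V"
  shows "H (A z x) (A z y) = of_real l * H x y"
proof -
  have zU: "z \<in> U" by (rule V_U[OF z])
  have Re: "Re (H (A z x) (A z y)) = l * Re (H x y)" for x y
  proof -
    have "Re (snd (S z (y, 0) (x, 0))) + 2 * Re (H (A z x) (A z y) + H (fst (S z (y, 0) (x, 0))) (fst (f z)))
        = l * (2 * Re (H x y))"
      using D2r_0[OF z, of "(y, 0)" "(x, 0)"] by (simp add: fst_Df[OF zU])
    moreover have "- Re (snd (S z (y, 0) (x, 0))) + 2 * Re (H (A z x) (A z y) - H (fst (S z (y, 0) (x, 0))) (fst (f z)))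
        = l * (2 * Re (H x y))"
      using D2r_0[OF z, of "J z (y, 0)" "J z (x, 0)"]
      by (simp add: S_JJ[OF zU] Df_i[OF zU] fst_Df[OF zU] H.minus_left H_scale_left H_scale_right)
        (simp add: model_J_def A_i[OF zU] H_scale_left H_scale_right)
    ultimately show ?thesis by simp
  qed
  have "Im (H (A z x) (A z y)) = l * Im (H x y)"
    using Re[of x "\<i> *s y"] by (simp add: A_i[OF zU] H_scale_right)
  then show ?thesis using Re[of x y] by (simp add: complex_eq_iff)
qed

text \<open>If l were 0, then (0, 1) would be in the kernel of \<open>Df p\<close>. The sign is then
  decided by \<open>H_A\<close>, since H is positive definite.\<close>

lemma l_pos: "l > 0" and inj_A: "inj (A p)"
proof -
  have lz: "l \<noteq> 0"
  proof
    assume "l = 0"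
    then have "Df p (0, 1) = Df p 0"
      using fst_Df_vertical[OF U(3), of 1] snd_Df_vertical[OF U(3), of 1] lam_eq[OF U(3)] linear_0[OF linear_Df[OF U(3)]]
      by (simp add: prod_eq_iff)
    then have "(0 :: complex ^ 'm, 1 :: complex) = 0" by (rule injD[OF inj_Df])
    then show False by (simp add: zero_prod_def)
  qed
  have "x = 0" if "A p x = 0" for x
    using H_A[OF V(3), of x x] that lz H_eq_0_iff[of x] by (simp add: H.zero_left)
  then show "inj (A p)" using linear_injective_0[OF linear_A[OF U(3)]] by blast
  define x :: "complex ^ 'm" where "x = 1"
  have "Re (H x x) > 0" by (rule H_pos) (simp add: x_def)
  moreover have "l * Re (H x x) \<ge> 0"
    using H_nonneg[of "A p x"] unfolding H_A[OF V(3)] by simp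
  ultimately show "l > 0" using lz by (smt (verit) mult_neg_pos)
qed

lemma surj_A:
  assumes z: "z \<in> V"
  shows "\<exists>y. x = A z y"
proof -
  have "y = 0" if "A z y = 0" for y
    using H_A[OF z, of y y] that l_pos H_eq_0_iff[of y] by (simp add: H.zero_left)
  then have "inj (A z)" using linear_injective_0[OF linear_A[OF V_U[OF z]]] by blast
  then show ?thesis using linear_injective_imp_surjective[OF linear_A[OF V_U[OF z]]] by (metis surjD)
qed

text \<open>The derivative of \<open>H_A\<close> is a sum of two terms equal to 0. Replacing w by
  \<open>J z w\<close> multiplies one of them by i and the other by -i, so each of them is
  0.\<close>

lemma fst_S_0:
  assumes z: "z \<in> V"
  shows "fst (S z w (x, 0)) = 0"
proof -
  have zU: "z \<in> U" by (rule V_U[OF z])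
  have sum0: "H (A z x) (fst (S z w (u, 0))) + H (fst (S z w (x, 0))) (A z u) = 0" for w u
  proof -
    have "((\<lambda>y. H (A y x) (A y u)) has_derivative
        (\<lambda>w. H (A z x) (fst (S z w (u, 0))) + H (fst (S z w (x, 0))) (A z u))) (at z)"
      by (intro H.FDERIV has_derivative_fst_Df zU)
    moreover have "((\<lambda>y. H (A y x) (A y u)) has_derivative (\<lambda>w. 0)) (at z)"
      by (rule has_derivative_transform_within_open[OF has_derivative_const V(1) z]) (simp add: H_A)
    ultimately have "(\<lambda>w. H (A z x) (fst (S z w (u, 0))) + H (fst (S z w (x, 0))) (A z u)) = (\<lambda>w. 0)"
      by (rule has_derivative_unique)
    from fun_cong[OF this, of w] show ?thesis .
  qed
  have "H (fst (S z w (x, 0))) (A z u) = 0" for u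
  proof -
    have "\<i> * (H (fst (S z w (x, 0))) (A z u) - H (A z x) (fst (S z w (u, 0)))) = 0"
      using sum0[of "J z w" u] by (simp add: fst_S_i[OF zU] H_scale_left H_scale_right algebra_simps)
    then have "H (fst (S z w (x, 0))) (A z u) = H (A z x) (fst (S z w (u, 0)))" by simp
    then show ?thesis using sum0[of w u] by (simp flip: mult_2)
  qed
  moreover obtain u where "fst (S z w (x, 0)) = A z u" using surj_A[OF z] by blast
  ultimately show ?thesis using H_eq_0_iff by metis
qed

definition b :: "complex ^ 'm" where
  "b = fst (f p) - A p (fst p)"

lemma fst_f:
  assumes z: "z \<in> V"
  shows "fst (f z) = A p (fst z) + b" "A z = A p"
proof -
  have A_const: "A y = A p" if y: "y \<in> V" for y
  proof
    fix x
    show "A y x = A p x"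
    proof (rule has_derivative_zero_unique[where f = "\<lambda>y. A y x", OF V(2) _ y V(3)])
      fix z assume z: "z \<in> V"
      show "((\<lambda>y. A y x) has_derivative (\<lambda>h. 0)) (at z within V)"
        using has_derivative_fst_Df[OF V_U[OF z], of x] unfolding fst_S_0[OF z] by (rule has_derivative_at_withinI)
    qed
  qed
  then show "A z = A p" using z by blast
  have "fst (f z) - A p (fst z) = fst (f p) - A p (fst p)"
  proof (rule has_derivative_zero_unique[where f = "\<lambda>z. fst (f z) - A p (fst z)", OF V(2) _ z V(3)])
    fix y assume y: "y \<in> V"
    have bl: "bounded_linear (A p)" using linear_A[OF U(3)] by (simp add: linear_linear)
    have "((\<lambda>z. fst (f z) - A p (fst z)) has_derivative (\<lambda>v. fst (Df y v) - A p (fst v))) (at y)"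
      by (intro has_derivative_diff has_derivative_fst Df V_U[OF y] has_derivative_ident bounded_linear.has_derivative[OF bl])
    then have "((\<lambda>z. fst (f z) - A p (fst z)) has_derivative (\<lambda>v. 0)) (at y)"
      by (simp add: fst_Df[OF V_U[OF y]] A_const[OF y])
    then show "((\<lambda>z. fst (f z) - A p (fst z)) has_derivative (\<lambda>v. 0)) (at y within V)"
      by (rule has_derivative_at_withinI)
  qed
  then show "fst (f z) = A p (fst z) + b" by (simp add: b_def algebra_simps)
qed

text \<open>The term with H is dictated by the boundary condition. The purely imaginary term does
  not affect \<open>def_fun\<close>; it compensates in J-holomorphy for the translation by
  b.\<close>

definition lin :: "'m cspace \<Rightarrow> 'm cspace" where
  "lin v = (A p (fst v), l *\<^sub>R snd v - 2 * H (A p (fst v)) b + \<i> * of_real (Re (\<beta> b (A p (fst v)))))"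

text \<open>Again the real part of the last coordinate is dictated by \<open>def_fun\<close>; the
  imaginary part is fitted to the value of f at p.\<close>

definition aff :: "'m cspace" where
  "aff = (b, - H b b + \<i> * of_real (Im (snd (f p) - snd (lin p))))"

definition \<Phi> :: "'m cspace \<Rightarrow> 'm cspace" where
  "\<Phi> z = lin z + aff"

lemma linear_lin: "linear lin"
  by (rule linearI)
    (simp_all add: lin_def linear_add[OF linear_A[OF U(3)]] linear_scale[OF linear_A[OF U(3)]] H.add_left H.scaleR_left
      \<beta>.add_right \<beta>.scaleR_right scaleR_conv_of_real[where 'a = complex] algebra_simps)

lemma has_derivative_\<Phi>: "(\<Phi> has_derivative lin) (at z)"
  unfolding \<Phi>_def[abs_def] using linear_imp_has_derivative[OF linear_lin]
  by (auto intro!: derivative_eq_intros)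

lemma \<beta>_Ap: "\<beta> (A p x) (A p y) = of_real l * \<beta> x y"
  using \<beta>_A[OF U(3)] lam_eq[OF U(3)] by simp

lemma lin_J: "lin (J z v) = J (\<Phi> z) (lin v)"
proof -
  have "\<i> * of_real (Im c) = c - of_real (Re c)" for c by (simp add: complex_eq_iff)
  note * = this[of "\<beta> b (A p (fst v))"]
  show ?thesis
    by (simp add: lin_def model_J_def \<Phi>_def aff_def A_i[OF U(3)] H_scale_left \<beta>_scale_right \<beta>.add_left \<beta>_Ap
        scaleR_conv_of_real[where 'a = complex] * algebra_simps)
qed

lemma def_fun_\<Phi>: "def_fun (\<Phi> z) = l * def_fun z"
proof -
  have "Re (H b (A p (fst z))) = Re (H (A p (fst z)) b)"
    using H_swap[of b "A p (fst z)"] by simp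
  then show ?thesis
    by (simp add: def_fun_def \<Phi>_def lin_def aff_def H.add_left H.add_right H_A[OF V(3)] algebra_simps)
qed

lemma inj_lin: "inj lin"
  unfolding linear_injective_0[OF linear_lin]
proof (intro allI impI)
  fix v assume v: "lin v = 0"
  then have "A p (fst v) = A p 0" using linear_0[OF linear_A[OF U(3)]] by (simp add: lin_def zero_prod_def)
  then have v': "fst v = 0" by (rule injD[OF inj_A])
  then have "l *\<^sub>R snd v = 0"
    using v linear_0[OF linear_A[OF U(3)]] by (simp add: lin_def zero_prod_def H.zero_left \<beta>.zero_right)
  then show "v = 0" using v' l_pos by (simp add: prod_eq_iff)
qed

lemma J_automorphism_\<Phi>: "J_automorphism Dom J \<Phi>"
  unfolding J_automorphism_def
proof
  have iff: "\<Phi> z \<in> Dom \<longleftrightarrow> z \<in> Dom" for z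
    using l_pos by (simp add: Dom_def def_fun_\<Phi> mult_less_0_iff)
  show "bij_betw \<Phi> Dom Dom"
    unfolding bij_betw_def
  proof
    show "inj_on \<Phi> Dom" using inj_lin by (auto simp: \<Phi>_def inj_on_def)
    show "\<Phi> ` Dom = Dom"
    proof
      show "\<Phi> ` Dom \<subseteq> Dom" by (simp only: image_subset_iff iff) simp
      show "Dom \<subseteq> \<Phi> ` Dom"
      proof
        fix y assume y: "y \<in> Dom"
        obtain x where "y - aff = lin x"
          using linear_injective_imp_surjective[OF linear_lin inj_lin] by (metis surjD)
        then have "y = \<Phi> x" by (simp add: \<Phi>_def algebra_simps)
        moreover from this have "x \<in> Dom" using y by (simp only: iff)
        ultimately show "y \<in> \<Phi> ` Dom" by (rule image_eqI)
      qed
    qed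
  qed
  show "pseudo_holomorphic Dom J Dom J \<Phi>"
  proof (rule pseudo_holomorphicI[OF open_Dom, where f' = "\<lambda>_. lin"])
    show "\<Phi> ` Dom \<subseteq> Dom" by (simp only: image_subset_iff iff) simp
  qed (rule has_derivative_\<Phi> continuous_on_const lin_J)+
qed

text \<open>The difference of the last coordinates has real part 0, as the first components agree
  and both maps multiply \<open>def_fun\<close> by l. Its differential D satisfies D (J v) = i D v,
  so the imaginary part of D vanishes too, and the value at p settles the constant.\<close>

lemma snd_f_V:
  assumes z: "z \<in> V"
  shows "snd (f z) = snd (\<Phi> z)"
proof -
  let ?d = "\<lambda>z. snd (f z) - snd (\<Phi> z)"
  have fst_eq: "fst (f y) = fst (\<Phi> y)" if "y \<in> V" for y
    using fst_f(1)[OF that] by (simp add: \<Phi>_def lin_def aff_def)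
  have Re0: "Re (?d y) = 0" if y: "y \<in> V" for y
  proof -
    have "def_fun (f y) = def_fun (\<Phi> y)" by (simp add: V(5)[OF y] def_fun_\<Phi>)
    then show ?thesis using fst_eq[OF y] by (simp add: def_fun_def)
  qed
  have "?d z = ?d p"
  proof (rule has_derivative_zero_unique[where f = ?d, OF V(2) _ z V(3)])
    fix y assume y: "y \<in> V"
    let ?D = "\<lambda>v. snd (Df y v) - snd (lin v)"
    have d: "(?d has_derivative ?D) (at y)"
      by (intro has_derivative_diff has_derivative_snd Df has_derivative_\<Phi> V_U[OF y])
    have "((\<lambda>z. Re (?d z)) has_derivative (\<lambda>v. Re (?D v))) (at y)" by (rule has_derivative_Re[OF d])
    moreover have "((\<lambda>z. Re (?d z)) has_derivative (\<lambda>v. 0)) (at y)"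
      by (rule has_derivative_transform_within_open[OF has_derivative_const V(1) y]) (simp only: Re0)
    ultimately have "(\<lambda>v. Re (?D v)) = (\<lambda>v. 0)" by (rule has_derivative_unique)
    then have Re: "Re (?D v) = 0" for v by (rule fun_cong)
    have "fst (Df y v) = fst (lin v)" for v
      by (simp add: fst_Df[OF V_U[OF y]] fst_f(2)[OF y] lin_def)
    then have "?D (J y v) = \<i> * ?D v" for v
      using fst_eq[OF y] by (simp add: Df_i(2)[OF V_U[OF y]] lin_J) (simp add: model_J_def algebra_simps)
    then have "Im (?D v) = 0" for v using Re[of "J y v"] by simp
    then have "?D = (\<lambda>v. 0)" using Re by (intro ext complex_eqI) simp_all
    then have "(?d has_derivative (\<lambda>v. 0)) (at y)" using d by simp
    then show "(?d has_derivative (\<lambda>v. 0)) (at y within V)" by (rule has_derivative_at_withinI)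
  qed
  moreover have "?d p = 0"
    using Re0[OF V(3)] by (intro complex_eqI) (simp_all add: \<Phi>_def aff_def)
  ultimately show ?thesis by simp
qed

text \<open>The last coordinate of \<open>f\<close> is not a J-function because of the \<beta>-term
  in \<open>Df_i\<close>. This term cancels in the difference from \<Phi> once the first components
  agree on U, which is why they are treated first.\<close>

lemma f_eq_\<Phi>:
  assumes z: "z \<in> U"
  shows "f z = \<Phi> z"
proof -
  have fst_eq: "fst (f y) = fst (\<Phi> y)" if y: "y \<in> U" for y
  proof -
    have "(fst (f y) - fst (\<Phi> y)) $ i = 0" for i
    proof (rule J_function_unique_continuation[OF U(1,2) _ V(1,3) U(3) _ y])
      show "J_function_on U J (\<lambda>y. (fst (f y) - fst (\<Phi> y)) $ i)"
        unfolding J_function_on_def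
      proof (intro ballI exI conjI allI)
        fix z v assume z: "z \<in> U"
        show "((\<lambda>y. (fst (f y) - fst (\<Phi> y)) $ i) has_derivative (\<lambda>v. (fst (Df z v) - fst (lin v)) $ i)) (at z)"
          by (intro bounded_linear.has_derivative[OF bounded_linear_vec_nth] has_derivative_diff has_derivative_fst Df z has_derivative_\<Phi>)
        show "(fst (Df z (J z v)) - fst (lin (J z v))) $ i = \<i> * (fst (Df z v) - fst (lin v)) $ i"
          by (simp add: Df_i[OF z] lin_J) (simp add: model_J_def algebra_simps)
      qed
      show "(fst (f z) - fst (\<Phi> z)) $ i = 0" if "z \<in> V" for z
        using fst_f(1)[OF that] by (simp add: \<Phi>_def lin_def aff_def)
    qed
    then show ?thesis by (simp add: vec_eq_iff)
  qed
  have Dfst_eq: "fst (Df y v) = fst (lin v)" if y: "y \<in> U" for y v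
  proof -
    have "((\<lambda>y. fst (f y)) has_derivative (\<lambda>v. fst (Df y v))) (at y)" by (rule has_derivative_fst[OF Df[OF y]])
    moreover have "((\<lambda>y. fst (f y)) has_derivative (\<lambda>v. fst (lin v))) (at y)"
      by (rule has_derivative_transform_within_open[OF has_derivative_fst[OF has_derivative_\<Phi>] U(1) y]) (simp add: fst_eq)
    ultimately have "(\<lambda>v. fst (Df y v)) = (\<lambda>v. fst (lin v))" by (rule has_derivative_unique)
    then show ?thesis by (rule fun_cong)
  qed
  have "snd (f z) - snd (\<Phi> z) = 0"
  proof (rule J_function_unique_continuation[OF U(1,2) _ V(1,3) U(3) _ z])
    show "J_function_on U J (\<lambda>y. snd (f y) - snd (\<Phi> y))"
      unfolding J_function_on_def
    proof (intro ballI exI conjI allI)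
      fix y v assume y: "y \<in> U"
      show "((\<lambda>y. snd (f y) - snd (\<Phi> y)) has_derivative (\<lambda>v. snd (Df y v) - snd (lin v))) (at y)"
        by (intro has_derivative_diff has_derivative_snd Df y has_derivative_\<Phi>)
      show "snd (Df y (J y v)) - snd (lin (J y v)) = \<i> * (snd (Df y v) - snd (lin v))"
        by (simp add: Df_i[OF y] lin_J fst_eq[OF y] Dfst_eq[OF y]) (simp add: model_J_def algebra_simps)
    qed
  qed (simp add: snd_f_V)
  then show ?thesis using fst_eq[OF z] by (simp add: prod_eq_iff)
qed

end

theorem (in normal_form) normal_form_extension:
  fixes f Df :: "_ \<Rightarrow> _" and S :: "_ \<Rightarrow> _ \<Rightarrow> _ \<Rightarrow> _"
  assumes U: "open U" "connected U" "p \<in> U" and p: "def_fun p = 0"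
    and Df: "\<And>z. z \<in> U \<Longrightarrow> (f has_derivative Df z) (at z)"
    and D2f: "\<And>z v. z \<in> U \<Longrightarrow> ((\<lambda>y. Df y v) has_derivative (\<lambda>w. S z w v)) (at z)"
    and hol: "\<And>z v. z \<in> U \<Longrightarrow> Df z (J z v) = J (f z) (Df z v)"
    and bd: "\<And>z. z \<in> U \<Longrightarrow> def_fun z = 0 \<Longrightarrow> def_fun (f z) = 0"
    and injD: "inj (Df p)" and W: "open W" "p \<in> W" "inj_on f W"
  shows "\<exists>\<Phi>. J_automorphism Dom J \<Phi> \<and> (\<forall>z\<in>U \<inter> Dom. \<Phi> z = f z)"
proof (cases "\<forall>x y. \<beta> x y = 0")
  case True
  then interpret flat_normal_form \<beta> H by unfold_locales auto
  show ?thesis by (rule flat_extension[OF U p Df hol bd injD W])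
next
  case False
  then obtain w0 v0 where "\<beta> w0 v0 \<noteq> 0" by blast
  then interpret curved_map \<beta> H f Df S U p w0 v0
    by unfold_locales (use assms in auto)
  show ?thesis using J_automorphism_\<Phi> f_eq_\<Phi> by auto
qed

section \<open>Reduction to the normal form\<close>

text \<open>Here \<open>l\<close> describes the given structure, and \<open>h\<close> and
  \<open>q\<close> are the complex bilinear and the sesquilinear part of the polynomial. The forms
  being real bilinear, their behaviour under i determines that under complex scalars.\<close>

locale model_data =
  fixes l h q :: "complex ^ 'm::finite \<Rightarrow> complex ^ 'm \<Rightarrow> complex"
  assumes bilinear_l: "bounded_bilinear l" and bilinear_h: "bounded_bilinear h" and bilinear_q: "bounded_bilinear q"
    and l_i_right: "l x (\<i> *s y) = - \<i> * l x y"
    and h_i: "h (\<i> *s x) y = \<i> * h x y" "h x (\<i> *s y) = \<i> * h x y"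
    and q_i: "q (\<i> *s x) y = \<i> * q x y" "q x (\<i> *s y) = - \<i> * q x y"
begin

sublocale l: bounded_bilinear l by (rule bilinear_l)
sublocale h: bounded_bilinear h by (rule bilinear_h)
sublocale q: bounded_bilinear q by (rule bilinear_q)

definition J0 :: "'m cspace \<Rightarrow> 'm cspace \<Rightarrow> 'm cspace" where
  "J0 z v = (\<i> *s fst v, \<i> * snd v + l (fst z) (fst v))"

definition P0 :: "complex ^ 'm \<Rightarrow> real" where
  "P0 w = Re (h w w + q w w)"

definition r0 :: "'m cspace \<Rightarrow> real" where
  "r0 z = Re (snd z) + P0 (fst z)"

definition dP :: "complex ^ 'm \<Rightarrow> complex ^ 'm \<Rightarrow> real" where
  "dP x y = Re (h x y + h y x + q x y + q y x)"

text \<open>The part of \<open>l\<close> that is complex linear in the first argument;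
  \<open>l2\<close> is the antilinear part.\<close>

definition l1 :: "complex ^ 'm \<Rightarrow> complex ^ 'm \<Rightarrow> complex" where
  "l1 x y = (l x y - \<i> * l (\<i> *s x) y) / 2"

definition l2 :: "complex ^ 'm \<Rightarrow> complex ^ 'm \<Rightarrow> complex" where
  "l2 x y = (l x y + \<i> * l (\<i> *s x) y) / 2"

definition bt :: "complex ^ 'm \<Rightarrow> complex ^ 'm \<Rightarrow> complex" where
  "bt x y = (l2 x y - l2 y x) / 2"

text \<open>The change of coordinates removes \<open>l1\<close> from the structure, and the removed
  part reappears in the polynomial.\<close>

definition q1 :: "complex ^ 'm \<Rightarrow> complex ^ 'm \<Rightarrow> complex" where
  "q1 x y = q x y - l1 x y / (2 * \<i>)"

definition H :: "complex ^ 'm \<Rightarrow> complex ^ 'm \<Rightarrow> complex" where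
  "H x y = (q1 x y + cnj (q1 y x)) / 2"

text \<open>The change of coordinates z_n \<mapsto> z_n + k z' z' makes l alternating and P0 Hermitian.\<close>

definition k :: "complex ^ 'm \<Rightarrow> complex ^ 'm \<Rightarrow> complex" where
  "k x y = l1 x y / (2 * \<i>) + l2 x y / (4 * \<i>) - cnj (l2 x y / (4 * \<i>)) + h x y"

lemma l_split: "l x y = l1 x y + l2 x y"
  by (simp add: l1_def l2_def field_simps)

lemma ii_smult: "\<i> *s (\<i> *s x) = - (x :: complex ^ 'm)"
  by (simp add: vector_smult_assoc)

lemma l1_i: "l1 (\<i> *s x) y = \<i> * l1 x y" "l1 x (\<i> *s y) = - \<i> * l1 x y"
  by (simp_all add: l1_def ii_smult l.minus_left l_i_right field_simps)

lemma l2_i: "l2 (\<i> *s x) y = - \<i> * l2 x y" "l2 x (\<i> *s y) = - \<i> * l2 x y"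
  by (simp_all add: l2_def ii_smult l.minus_left l_i_right field_simps)

lemma bilinear_l_i: "bounded_bilinear (\<lambda>x y. l (\<i> *s x) y)"
  using bounded_bilinear.comp1[OF bilinear_l
      bounded_bilinear.bounded_linear_right[OF bounded_bilinear_vector_scalar_mult]] .

lemma bilinear_combination:
  fixes f g :: "complex ^ 'm \<Rightarrow> complex ^ 'm \<Rightarrow> complex"
  assumes "bounded_bilinear f" "bounded_bilinear g" "bounded_linear L" "bounded_linear K"
  shows "bounded_bilinear (\<lambda>x y. L (f x y) + K (g x y))"
proof -
  interpret f: bounded_bilinear f by fact
  interpret g: bounded_bilinear g by fact
  interpret L: bounded_linear L by fact
  interpret K: bounded_linear K by fact
  show ?thesis
    unfolding bilinear_conv_bounded_bilinear[symmetric] bilinear_def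
    by (auto intro!: linearI simp: f.add_left f.add_right f.scaleR_left f.scaleR_right g.add_left g.add_right
        g.scaleR_left g.scaleR_right L.add L.scaleR K.add K.scaleR scaleR_add_right)
qed

lemma bilinear_l1: "bounded_bilinear l1" and bilinear_l2: "bounded_bilinear l2"
proof -
  have "l1 = (\<lambda>x y. (1/2) * l x y + (- \<i> / 2) * l (\<i> *s x) y)"
    by (simp add: l1_def fun_eq_iff field_simps)
  then show "bounded_bilinear l1"
    by (simp only:) (rule bilinear_combination[OF bilinear_l bilinear_l_i bounded_linear_mult_right bounded_linear_mult_right])
  have "l2 = (\<lambda>x y. (1/2) * l x y + (\<i> / 2) * l (\<i> *s x) y)"
    by (simp add: l2_def fun_eq_iff field_simps)
  then show "bounded_bilinear l2"
    by (simp only:) (rule bilinear_combination[OF bilinear_l bilinear_l_i bounded_linear_mult_right bounded_linear_mult_right])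
qed

lemma bilinear_bt: "bounded_bilinear bt"
proof -
  have "bt = (\<lambda>x y. (1/2) * l2 x y + (- 1/2) * l2 y x)"
    by (simp add: bt_def fun_eq_iff field_simps)
  then show ?thesis
    by (simp only:) (rule bilinear_combination[OF bilinear_l2 bounded_bilinear.flip[OF bilinear_l2]
        bounded_linear_mult_right bounded_linear_mult_right])
qed

lemma bilinear_q1: "bounded_bilinear q1"
proof -
  have "q1 = (\<lambda>x y. 1 * q x y + (- 1 / (2 * \<i>)) * l1 x y)"
    by (simp add: q1_def fun_eq_iff)
  then show ?thesis
    by (simp only:) (rule bilinear_combination[OF bilinear_q bilinear_l1 bounded_linear_mult_right bounded_linear_mult_right])
qed

lemma bilinear_H: "bounded_bilinear H"
proof -
  have "H = (\<lambda>x y. (1/2) * q1 x y + (1/2) * cnj (q1 y x))"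
    by (simp add: H_def fun_eq_iff field_simps)
  then show ?thesis
    by (simp only:) (rule bilinear_combination[OF bilinear_q1 bounded_bilinear.flip[OF bilinear_q1]
        bounded_linear_mult_right bounded_linear_compose[OF bounded_linear_mult_right bounded_linear_cnj]])
qed

lemma bilinear_k: "bounded_bilinear k"
proof -
  have bl: "bounded_linear (\<lambda>x. x / (4 * \<i>) - cnj (x / (4 * \<i>)))"
    by (intro bounded_linear_sub bounded_linear_compose[OF bounded_linear_cnj] bounded_linear_divide)
  have "k = (\<lambda>x y. 1 * (l1 x y / (2 * \<i>) + (l2 x y / (4 * \<i>) - cnj (l2 x y / (4 * \<i>)))) + 1 * h x y)"
    by (simp add: k_def fun_eq_iff)
  then show ?thesis
    by (simp only:) (rule bilinear_combination[OF bilinear_combination[OF bilinear_l1 bilinear_l2 bounded_linear_divide bl] bilinear_h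
        bounded_linear_mult_right bounded_linear_mult_right])
qed

sublocale k: bounded_bilinear k by (rule bilinear_k)

lemma complex_scale_of_i:
  fixes F :: "complex ^ 'm \<Rightarrow> complex"
  assumes "linear F" "\<And>x. F (\<i> *s x) = \<i> * F x"
  shows "F (c *s x) = c * F x"
proof -
  have "c *s x = Re c *\<^sub>R x + Im c *\<^sub>R (\<i> *s x)"
    by (simp add: vec_eq_iff complex_eq_iff)
  then have "F (c *s x) = Re c *\<^sub>R F x + Im c *\<^sub>R (\<i> * F x)"
    by (simp only: linear_add[OF assms(1)] linear_scale[OF assms(1)] assms(2))
  then show ?thesis by (simp add: complex_eq_iff)
qed

text \<open>The condition for \<Psi> to carry \<open>J0\<close> to \<open>model_J bt\<close>.
  Complex bilinear terms of \<open>k\<close>, namely \<open>h\<close> and the conjugate of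
  \<open>l2\<close>, drop out of it. The coefficient 1 / (2 i) cancels \<open>l1\<close>, and 1 / (4
  i) cancels the symmetric part of \<open>l2\<close>.\<close>

lemma k_change: "bt x y = l x y + (k x (\<i> *s y) + k (\<i> *s y) x) - \<i> * (k x y + k y x)"
  unfolding k_def bt_def l_split[of x y]
  by (simp add: l1_i l2_i h_i field_simps)

text \<open>The \<open>l2\<close> terms of \<open>k\<close> are together purely imaginary, which is
  the purpose of subtracting the conjugate; \<open>h\<close> is absorbed, and the \<open>l1\<close>
  term is balanced by the one in \<open>q1\<close>.\<close>

lemma P0_eq: "P0 w = Re (k w w) + Re (H w w)"
  by (simp add: P0_def k_def H_def q1_def diff_divide_distrib)

lemma alternating_bt: "alternating_form bt"
proof (rule alternating_form.intro)
  show "bounded_bilinear bt" by (rule bilinear_bt)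
  show "bt x y = - bt y x" for x y by (simp add: bt_def field_simps)
  show "bt (c *s x) y = cnj c * bt x y" for c x y
  proof -
    have "cnj (bt (c *s x) y) = c * cnj (bt x y)"
    proof (rule complex_scale_of_i[where F = "\<lambda>x. cnj (bt x y)"])
      show "linear (\<lambda>x. cnj (bt x y))"
        using bounded_linear_compose[OF bounded_linear_cnj bounded_bilinear.bounded_linear_left[OF bilinear_bt]]
        by (rule bounded_linear.linear)
      show "cnj (bt (\<i> *s x) y) = \<i> * cnj (bt x y)" for x
        by (simp add: bt_def l2_i field_simps)
    qed
    then show ?thesis by (metis complex_cnj_cnj complex_cnj_mult)
  qed
qed

lemma normal_form_H:
  assumes pos: "\<And>x. x \<noteq> 0 \<Longrightarrow> Re (H x x) > 0"
  shows "normal_form bt H"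
proof (intro normal_form.intro alternating_bt normal_form_axioms.intro)
  show "bounded_bilinear H" by (rule bilinear_H)
  show "H y x = cnj (H x y)" for x y by (simp add: H_def)
  show "H (c *s x) y = c * H x y" for c x y
  proof (rule complex_scale_of_i[where F = "\<lambda>x. H x y"])
    show "linear (\<lambda>x. H x y)"
      using bounded_bilinear.bounded_linear_left[OF bilinear_H] by (rule bounded_linear.linear)
    show "H (\<i> *s x) y = \<i> * H x y" for x
      by (simp add: H_def q1_def q_i l1_i field_simps)
  qed
qed (rule pos)

subsection \<open>The Levi form at the origin\<close>

lemma has_derivative_r0: "(r0 has_derivative (\<lambda>v. Re (snd v) + dP (fst z) (fst v))) (at z)"
proof -
  have d: "(r0 has_derivative (\<lambda>v. Re (snd v) + Re ((h (fst z) (fst v) + h (fst v) (fst z)) + (q (fst z) (fst v) + q (fst v) (fst z))))) (at z)"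
    unfolding r0_def[abs_def] P0_def
    by (intro has_derivative_add has_derivative_Re has_derivative_snd has_derivative_fst has_derivative_ident h.FDERIV q.FDERIV)
  show ?thesis by (rule has_derivative_eq_rhs[OF d]) (simp add: dP_def algebra_simps)
qed

lemma frechet_r0: "frechet_derivative r0 (at z) v = Re (snd v) + dP (fst z) (fst v)"
  using frechet_derivative_at[OF has_derivative_r0[of z]] by metis

lemma bilinear_dP: "bounded_bilinear dP"
  unfolding bilinear_conv_bounded_bilinear[symmetric] bilinear_def dP_def
  by (auto intro!: linearI simp: h.add_left h.add_right q.add_left q.add_right
      h.scaleR_left h.scaleR_right q.scaleR_left q.scaleR_right algebra_simps)

sublocale dP: bounded_bilinear dP by (rule bilinear_dP)

lemma J0_J0: "J0 z (J0 z v) = - v"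
  by (simp add: J0_def ii_smult l_i_right algebra_simps prod_eq_iff flip: mult.assoc)

text \<open>As \<open>J0\<close> squares to -1, lying in the image of the tangent space means that
  JX is tangent. The two equations are dr(X) = 0 and dr(JX) = 0.\<close>

lemma J_tangent_iff:
  "X \<in> J_tangent_space J0 r0 z \<longleftrightarrow>
     Re (snd X) + dP (fst z) (fst X) = 0 \<and> - Im (snd X) + Re (l (fst z) (fst X)) + dP (fst z) (\<i> *s fst X) = 0"
proof -
  have rw: "Re (snd (J0 z X)) + dP (fst z) (fst (J0 z X)) = - Im (snd X) + Re (l (fst z) (fst X)) + dP (fst z) (\<i> *s fst X)" for X
    by (simp add: J0_def)
  have neg: "J0 z (- X) = - J0 z X" for X by (simp add: J0_def l.minus_right)
  have "X \<in> J_tangent_space J0 r0 z \<longleftrightarrow> X \<in> tangent_space r0 z \<and> J0 z X \<in> tangent_space r0 z"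
  proof
    assume X: "X \<in> J_tangent_space J0 r0 z"
    then obtain Y where Y: "X = J0 z Y" "Y \<in> tangent_space r0 z" by (auto simp: J_tangent_space_def)
    then have "J0 z X = - Y" by (simp add: J0_J0)
    then show "X \<in> tangent_space r0 z \<and> J0 z X \<in> tangent_space r0 z"
      using X Y by (auto simp: J_tangent_space_def tangent_space_def frechet_r0 dP.minus_right)
  next
    assume X: "X \<in> tangent_space r0 z \<and> J0 z X \<in> tangent_space r0 z"
    then have "- J0 z X \<in> tangent_space r0 z" by (simp add: tangent_space_def frechet_r0 dP.minus_right)
    moreover have "X = J0 z (- J0 z X)" by (simp only: neg J0_J0) simp
    ultimately show "X \<in> J_tangent_space J0 r0 z" using X unfolding J_tangent_space_def by blast
  qed
  then show ?thesis by (simp only: tangent_space_def mem_Collect_eq frechet_r0 rw)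
qed

text \<open>Lifts a horizontal line through 0 to the hypersurface; since \<open>P0\<close> is
  quadratic, the lift has the same velocity at 0.\<close>

lemma r0_curve: "((\<lambda>t. (t *\<^sub>R w, - complex_of_real (P0 (t *\<^sub>R w)))) has_vector_derivative (w, 0)) (at 0)"
  "r0 (t *\<^sub>R w, - of_real (P0 (t *\<^sub>R w))) = 0"
proof -
  have P: "P0 (t *\<^sub>R w) = t\<^sup>2 * P0 w" for t
    by (simp add: P0_def h.scaleR_left h.scaleR_right q.scaleR_left q.scaleR_right power2_eq_square algebra_simps)
  show "((\<lambda>t. (t *\<^sub>R w, - complex_of_real (P0 (t *\<^sub>R w)))) has_vector_derivative (w, 0)) (at 0)"
  proof -
    have "((\<lambda>t::real. t\<^sup>2 * P0 w) has_derivative (\<lambda>h. 0)) (at 0)"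
      by (auto intro!: derivative_eq_intros)
    from has_derivative_minus[OF has_derivative_of_real[OF this, where 'a = complex]]
    have "((\<lambda>t. (t *\<^sub>R w, - complex_of_real (t\<^sup>2 * P0 w))) has_derivative (\<lambda>h. (h *\<^sub>R w, - complex_of_real 0))) (at 0)"
      by (intro has_derivative_Pair) (auto intro!: derivative_eq_intros)
    then show ?thesis unfolding P has_vector_derivative_def by simp
  qed
  show "r0 (t *\<^sub>R w, - of_real (P0 (t *\<^sub>R w))) = 0" by (simp add: r0_def)
qed

text \<open>The derivative of an arbitrary admissible field is not known, but only Re snd DX(v, 0)
  and Im snd DX(i v, 0) enter. They are determined by differentiating dr(X) = 0 in the direction v
  and dr(JX) = 0 in the direction i v.\<close>

lemma levi_value:
  assumes X: "J_tangent_field_near J0 r0 0 X" and X0: "X 0 = (v, 0)"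
  shows "frechet_derivative r0 (at 0) (J0 0 (lie_bracket X (\<lambda>z. J0 z (X z)) 0)) = 4 * Re (H v v)"
proof -
  obtain V where V: "open V" "0 \<in> V" "smooth_on V X" "\<And>z. z \<in> V \<Longrightarrow> r0 z = 0 \<Longrightarrow> X z \<in> J_tangent_space J0 r0 z"
    using X unfolding J_tangent_field_near_def by blast
  define DX where "DX = frechet_derivative X (at 0)"
  have "Ck_on (Suc 0) V X" using V(3) unfolding smooth_on_def by blast
  then have dX: "(X has_derivative DX) (at 0)" unfolding DX_def by (rule Ck_on_SucD[OF _ V(2)])
  \<comment> \<open>Covers both equations: c = 1, a = 0 stands for dr(X) = 0, and c = i, a = 1 for
    dr(JX) = 0.\<close>
  have constraint: "Re (c * snd (DX (w, 0))) + Re (a * l w v) + dP w (c *s v) = 0"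
    if c: "\<And>z. z \<in> V \<Longrightarrow> r0 z = 0 \<Longrightarrow> Re (c * snd (X z)) + Re (a * l (fst z) (fst (X z))) + dP (fst z) (c *s fst (X z)) = 0" for c a w
  proof -
    let ?\<gamma> = "\<lambda>t. (t *\<^sub>R w, - of_real (P0 (t *\<^sub>R w)))"
    let ?g = "\<lambda>z. Re (c * snd (X z)) + Re (a * l (fst z) (fst (X z))) + dP (fst z) (c *s fst (X z))"
    let ?g' = "\<lambda>v. Re (c * snd (DX v)) + Re (a * (l (fst (0::'m cspace)) (fst (DX v)) + l (fst v) (fst (X 0))))
      + (dP (fst (0::'m cspace)) (c *s fst (DX v)) + dP (fst v) (c *s fst (X 0)))"
    have \<gamma>0: "?\<gamma> 0 = 0" by (simp add: P0_def h.zero_left q.zero_left zero_prod_def)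
    have "?g' (w, 0) = 0"
    proof (rule derivative_along_curve_eq_0[where \<gamma> = ?\<gamma> and g = ?g and g' = ?g'])
      show "(?g has_derivative ?g') (at (?\<gamma> 0))"
        unfolding \<gamma>0
        by (intro has_derivative_add has_derivative_Re has_derivative_mult_right has_derivative_snd has_derivative_fst
            has_derivative_ident l.FDERIV dP.FDERIV dX
            bounded_linear.has_derivative[OF bounded_bilinear.bounded_linear_right[OF bounded_bilinear_vector_scalar_mult]])
      have "\<forall>\<^sub>F t in nhds (0::real). ?\<gamma> t \<in> V"
        by (rule eventually_curve_in[OF has_vector_derivative_continuous[OF r0_curve(1)] _ V(1)]) (simp only: \<gamma>0 V(2))
      then show "\<forall>\<^sub>F t in nhds 0. ?g (?\<gamma> t) = 0"
        by eventually_elim (rule c[OF _ r0_curve(2)])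
    qed (rule r0_curve(1))
    then show ?thesis by (simp add: X0 l.zero_left dP.zero_left)
  qed
  have c1: "Re (snd (DX (v, 0))) + dP v v = 0"
    using constraint[of 1 0 v] V(4) by (simp add: J_tangent_iff)
  have c2: "- Im (snd (DX (\<i> *s v, 0))) + Re (l (\<i> *s v) v) + dP (\<i> *s v) (\<i> *s v) = 0"
    using constraint[of \<i> 1 "\<i> *s v"] V(4) by (simp add: J_tangent_iff)
  let ?Y = "\<lambda>z. J0 z (X z)"
  have "(?Y has_derivative (\<lambda>w. (\<i> *s fst (DX w), \<i> * snd (DX w) + (l (fst (0::'m cspace)) (fst (DX w)) + l (fst w) (fst (X 0)))))) (at 0)"
    unfolding J0_def[abs_def]
    by (intro has_derivative_Pair has_derivative_add has_derivative_mult_right has_derivative_snd has_derivative_fst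
        has_derivative_ident l.FDERIV dX
        bounded_linear.has_derivative[OF bounded_bilinear.bounded_linear_right[OF bounded_bilinear_vector_scalar_mult]])
  note DY = frechet_derivative_at[OF this, symmetric]
  have Y0: "J0 0 (X 0) = (\<i> *s v, 0)" by (simp add: J0_def X0 l.zero_left)
  have "frechet_derivative r0 (at 0) (J0 0 (lie_bracket X ?Y 0)) =
      - Im (\<i> * snd (DX (v, 0)) + l v v - snd (DX (\<i> *s v, 0)))"
    unfolding lie_bracket_def DX_def[symmetric] DY Y0 X0
    by (simp add: frechet_r0 J0_def X0 dP.zero_left l.zero_left)
  also have "\<dots> = dP v v + dP (\<i> *s v) (\<i> *s v) + Re (l (\<i> *s v) v) - Im (l v v)"
    using c1 c2 by simp
  \<comment> \<open>Between v and i v the terms with \<open>h\<close> cancel, and those with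
    \<open>l\<close> combine to the real part of 2 i \<open>l1 v v\<close>.\<close>
  also have "\<dots> = 4 * Re (H v v)"
    by (simp add: dP_def H_def q1_def l1_def h_i q_i field_simps)
  finally show ?thesis .
qed

lemma levi_form_0: "levi_form J0 r0 0 (v, 0) = 4 * Re (H v v)"
  unfolding levi_form_def
proof (rule the_equality)
  \<comment> \<open>An admissible field, whose existence the \<open>THE\<close> in
    \<open>levi_form\<close> requires: the horizontal part is constant, and the last coordinate
    solves the two real equations of \<open>J_tangent_iff\<close>.\<close>
  define X :: "'m cspace \<Rightarrow> 'm cspace" where
    "X z = (v, 0) + (0, - of_real (dP (fst z) v) + \<i> * of_real (Re (l (fst z) v) + dP (fst z) (\<i> *s v)))" for z
  have "linear (\<lambda>z :: 'm cspace. (0 :: complex ^ 'm, - of_real (dP (fst z) v) + \<i> * of_real (Re (l (fst z) v) + dP (fst z) (\<i> *s v))))"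
    by (rule linearI)
      (simp_all add: dP.add_left dP.scaleR_left l.add_left l.scaleR_left scaleR_conv_of_real[where 'a = complex] algebra_simps)
  then have "Ck_on k UNIV X" for k
    unfolding X_def[abs_def] by (intro Ck_on_add Ck_on_const Ck_on_linear) auto
  moreover have "X z \<in> J_tangent_space J0 r0 z" for z
    by (simp add: J_tangent_iff X_def)
  ultimately have X: "J_tangent_field_near J0 r0 0 X"
    unfolding J_tangent_field_near_def smooth_on_def by (intro exI[of _ UNIV]) auto
  have X0: "X 0 = (v, 0)" by (simp add: X_def dP.zero_left l.zero_left)
  show "\<exists>X. J_tangent_field_near J0 r0 0 X \<and> X 0 = (v, 0) \<and>
      4 * Re (H v v) = frechet_derivative r0 (at 0) (J0 0 (lie_bracket X (\<lambda>z. J0 z (X z)) 0))"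
    by (intro exI[of _ X] conjI X X0 levi_value[OF X X0, symmetric])
qed (use levi_value in auto)

lemma H_pos:
  assumes "strictly_pseudoconvex_near J0 r0 0" "x \<noteq> 0"
  shows "Re (H x x) > 0"
proof -
  have "r0 0 = 0" by (simp add: r0_def P0_def h.zero_left q.zero_left)
  then have "strictly_pseudoconvex_at J0 r0 0" using assms(1) unfolding strictly_pseudoconvex_near_def by blast
  moreover have "(x, 0) \<in> J_tangent_space J0 r0 0"
    by (simp add: J_tangent_iff dP.zero_left l.zero_left)
  moreover have "(x, 0) \<noteq> (0 :: 'm cspace)" using assms(2) by (simp add: zero_prod_def)
  ultimately have "levi_form J0 r0 0 (x, 0) > 0" unfolding strictly_pseudoconvex_at_def by blast
  then show ?thesis by (simp add: levi_form_0)
qed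

end

lemma inj_frechet_of_local_diffeomorphism:
  assumes "local_diffeomorphism_at f p"
  shows "inj (frechet_derivative f (at p))" "\<exists>W. open W \<and> p \<in> W \<and> inj_on f W"
proof -
  obtain V W g where V: "open V" "open W" "p \<in> V" "homeomorphism V W f g" "Ck_on 1 V f" "Ck_on 1 W g"
    using assms unfolding local_diffeomorphism_at_def by blast
  have fp: "f p \<in> W" using V(3,4) by (auto simp: homeomorphism_def)
  have gf: "g (f x) = x" if "x \<in> V" for x using V(4) that by (auto simp: homeomorphism_def)
  then show "\<exists>W. open W \<and> p \<in> W \<and> inj_on f W"
    using V(1,3) by (intro exI[of _ V]) (auto intro: inj_on_inverseI)
  have "(f has_derivative frechet_derivative f (at p)) (at p)"
    using Ck_on_SucD[of 0 V f p] V by simp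
  moreover have "(g has_derivative frechet_derivative g (at (f p))) (at (f p))"
    using Ck_on_SucD[of 0 W g "f p"] V fp by simp
  ultimately have "((\<lambda>x. g (f x)) has_derivative (\<lambda>v. frechet_derivative g (at (f p)) (frechet_derivative f (at p) v))) (at p)"
    by (rule has_derivative_compose)
  moreover have "((\<lambda>x. g (f x)) has_derivative (\<lambda>v. v)) (at p)"
    by (rule has_derivative_transform_within_open[OF has_derivative_ident V(1,3)]) (simp add: gf)
  ultimately have "(\<lambda>v. frechet_derivative g (at (f p)) (frechet_derivative f (at p) v)) = (\<lambda>v. v)"
    by (rule has_derivative_unique)
  then show "inj (frechet_derivative f (at p))" by (metis injI)
qed

section \<open>Transfer of the extension theorem along the change of coordinates\<close>

context model_data
begin

definition \<Psi> :: "'m cspace \<Rightarrow> 'm cspace" where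
  "\<Psi> z = z + (0, k (fst z) (fst z))"

definition \<Psi>_inv :: "'m cspace \<Rightarrow> 'm cspace" where
  "\<Psi>_inv z = z - (0, k (fst z) (fst z))"

definition D\<Psi> :: "'m cspace \<Rightarrow> 'm cspace \<Rightarrow> 'm cspace" where
  "D\<Psi> z v = v + (0, k (fst z) (fst v) + k (fst v) (fst z))"

definition D\<Psi>_inv :: "'m cspace \<Rightarrow> 'm cspace \<Rightarrow> 'm cspace" where
  "D\<Psi>_inv z v = v - (0, k (fst z) (fst v) + k (fst v) (fst z))"

lemma \<Psi>_inverse [simp]: "\<Psi> (\<Psi>_inv z) = z" "\<Psi>_inv (\<Psi> z) = z"
  by (simp_all add: \<Psi>_def \<Psi>_inv_def)

lemma has_derivative_\<Psi>: "(\<Psi> has_derivative D\<Psi> z) (at z)" "(\<Psi>_inv has_derivative D\<Psi>_inv z) (at z)"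
  unfolding \<Psi>_def[abs_def] D\<Psi>_def[abs_def] \<Psi>_inv_def[abs_def] D\<Psi>_inv_def[abs_def]
  by (intro has_derivative_add has_derivative_diff has_derivative_ident has_derivative_Pair has_derivative_const
      k.FDERIV has_derivative_fst)+

lemma Ck_on_\<Psi>: "Ck_on n UNIV \<Psi>" "Ck_on n UNIV \<Psi>_inv"
proof -
  have "linear (\<lambda>c :: complex. (0 :: complex ^ 'm, c))" "linear (\<lambda>c :: complex. (0 :: complex ^ 'm, - c))"
    by (rule linearI; simp)+
  then have bl: "bounded_linear (\<lambda>c :: complex. (0 :: complex ^ 'm, c))" "bounded_linear (\<lambda>c :: complex. (0 :: complex ^ 'm, - c))"
    by (simp_all add: linear_linear)
  have f: "Ck_on n UNIV (\<lambda>z :: 'm cspace. fst z)"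
    by (rule Ck_on_linear) (simp_all add: linear_fst)
  have "Ck_on n UNIV (\<lambda>z :: 'm cspace. z + (0, k (fst z) (fst z)))"
    "Ck_on n UNIV (\<lambda>z :: 'm cspace. z + (0, - k (fst z) (fst z)))"
    by (intro Ck_on_add open_UNIV Ck_on_ident bl[THEN Ck_on_bounded_linear] Ck_on_bounded_bilinear[OF bilinear_k] f)+
  then show "Ck_on n UNIV \<Psi>" "Ck_on n UNIV \<Psi>_inv"
    by (simp_all add: \<Psi>_def[abs_def] \<Psi>_inv_def[abs_def] diff_conv_add_uminus)
qed

lemma continuous_on_\<Psi>: "continuous_on S \<Psi>" "continuous_on S \<Psi>_inv"
  using Ck_on_\<Psi>[of 0] continuous_on_subset by auto

lemma pseudo_holomorphic_\<Psi>:
  "pseudo_holomorphic UNIV J0 UNIV (model_J bt) \<Psi>" "pseudo_holomorphic UNIV (model_J bt) UNIV J0 \<Psi>_inv"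
proof -
  have *: "model_J bt (\<Psi> z) (D\<Psi> z v) = D\<Psi> z (J0 z v)"
    "J0 (\<Psi>_inv z) (D\<Psi>_inv z v) = D\<Psi>_inv z (model_J bt z v)" for z v
    using k_change[of "fst z" "fst v"]
    by (simp_all add: model_J_def J0_def \<Psi>_def \<Psi>_inv_def D\<Psi>_def D\<Psi>_inv_def prod_eq_iff algebra_simps)
  have "Ck_on 1 UNIV \<Psi>" "Ck_on 1 UNIV \<Psi>_inv" by (rule Ck_on_\<Psi>)+
  moreover have "frechet_derivative \<Psi> (at z) = D\<Psi> z" "frechet_derivative \<Psi>_inv (at z) = D\<Psi>_inv z" for z
    using frechet_derivative_at[OF has_derivative_\<Psi>(1)] frechet_derivative_at[OF has_derivative_\<Psi>(2)] by metis+
  ultimately show "pseudo_holomorphic UNIV J0 UNIV (model_J bt) \<Psi>"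
    "pseudo_holomorphic UNIV (model_J bt) UNIV J0 \<Psi>_inv"
    by (simp_all add: pseudo_holomorphic_def fun_eq_iff * del: split_paired_All)
qed

theorem model_extension:
  assumes spc: "strictly_pseudoconvex_near J0 r0 0"
    and U: "open U" "connected U" "p \<in> U" and p: "r0 p = 0"
    and f: "Ck_on 2 U f" "pseudo_holomorphic U J0 UNIV J0 f"
    and bd: "\<And>z. z \<in> U \<Longrightarrow> r0 z = 0 \<Longrightarrow> r0 (f z) = 0"
    and ld: "local_diffeomorphism_at f p"
  shows "\<exists>\<Phi>. J_automorphism {z. r0 z < 0} J0 \<Phi> \<and> (\<forall>z\<in>U \<inter> {z. r0 z < 0}. \<Phi> z = f z)"
proof -
  interpret nf: normal_form bt H
    by (rule normal_form_H) (rule H_pos[OF spc])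
  have r0_eq: "r0 z = nf.def_fun (\<Psi> z)" for z
    by (simp add: r0_def nf.def_fun_def \<Psi>_def P0_eq)
  have Dom_eq: "{z. r0 z < 0} = \<Psi> -` nf.Dom" by (auto simp: r0_eq nf.Dom_def)
  define g where "g z = \<Psi> (f (\<Psi>_inv z))" for z
  \<comment> \<open>In general no ball, but still open and connected, as unique continuation
    requires.\<close>
  define V where "V = \<Psi>_inv -` U"
  have V_image: "V = \<Psi> ` U"
  proof
    show "V \<subseteq> \<Psi> ` U" by (rule subsetI, rule image_eqI[of _ _ "\<Psi>_inv _"]) (auto simp: V_def)
  qed (auto simp: V_def)
  have V: "open V" "connected V" "\<Psi> p \<in> V"
    using U continuous_on_\<Psi> by (auto simp: V_def open_vimage) (simp add: connected_continuous_image flip: V_def add: V_image)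
  have inv_pseudo: "pseudo_holomorphic V (model_J bt) U J0 \<Psi>_inv"
    by (rule pseudo_holomorphic_subset[OF pseudo_holomorphic_\<Psi>(2)]) (auto simp: V_def)
  have g_pseudo: "pseudo_holomorphic V (model_J bt) UNIV (model_J bt) g"
    unfolding g_def[abs_def]
    by (rule pseudo_holomorphic_compose[OF V(1) open_UNIV pseudo_holomorphic_compose[OF V(1) U(1) inv_pseudo f(2)]
          pseudo_holomorphic_\<Psi>(1)])
  have "Ck_on 2 V (\<lambda>z. f (\<Psi>_inv z))"
    by (rule Ck_on_compose[OF V(1) U(1) Ck_on_subset[OF Ck_on_\<Psi>(2)] f(1)]) (auto simp: V_def)
  then have g2: "Ck_on 2 V g"
    unfolding g_def[abs_def] by (rule Ck_on_compose[OF V(1) open_UNIV _ Ck_on_\<Psi>(1)]) auto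
  define Dg where "Dg z = frechet_derivative g (at z)" for z
  have "Ck_on (Suc 0) V (\<lambda>z. Dg z v)" for v
    using g2 unfolding numeral_2_eq_2 Ck_on.simps(2)[of "Suc 0"] Dg_def by blast
  note D2g = Ck_on_SucD[OF this]
  obtain W where W: "open W" "p \<in> W" "inj_on f W" using inj_frechet_of_local_diffeomorphism(2)[OF ld] by blast
  have "inj (Dg (\<Psi> p))"
  proof -
    have "(\<Psi>_inv has_derivative D\<Psi>_inv (\<Psi> p)) (at (\<Psi> p))" by (rule has_derivative_\<Psi>(2))
    moreover have "(f has_derivative frechet_derivative f (at p)) (at (\<Psi>_inv (\<Psi> p)))"
      using pseudo_holomorphicD(1)[OF f(2) U(3)] by simp
    ultimately have "((\<lambda>z. f (\<Psi>_inv z)) has_derivative (\<lambda>v. frechet_derivative f (at p) (D\<Psi>_inv (\<Psi> p) v))) (at (\<Psi> p))"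
      by (rule has_derivative_compose)
    from has_derivative_compose[OF this has_derivative_\<Psi>(1)]
    have "(g has_derivative (\<lambda>v. D\<Psi> (f p) (frechet_derivative f (at p) (D\<Psi>_inv (\<Psi> p) v)))) (at (\<Psi> p))"
      by (simp add: g_def[abs_def])
    from frechet_derivative_at[OF this]
    have Dg: "Dg (\<Psi> p) = (\<lambda>v. D\<Psi> (f p) (frechet_derivative f (at p) (D\<Psi>_inv (\<Psi> p) v)))"
      unfolding Dg_def by (rule sym)
    have inj: "inj (D\<Psi> z)" "inj (D\<Psi>_inv z)" for z
      by (auto simp: inj_def D\<Psi>_def D\<Psi>_inv_def prod_eq_iff)
    show ?thesis
      unfolding Dg by (intro injI) (simp only: inj_eq[OF inj(1)] inj_eq[OF inj(2)] inj_eq[OF inj_frechet_of_local_diffeomorphism(1)[OF ld]])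
  qed
  moreover have "nf.def_fun (g z) = 0" if "z \<in> V" "nf.def_fun z = 0" for z
    using that bd[of "\<Psi>_inv z"] by (simp add: V_def g_def r0_eq)
  moreover have "open (\<Psi>_inv -` W)" using W(1) continuous_on_\<Psi>(2) by (rule open_vimage)
  moreover have "inj_on g (\<Psi>_inv -` W)"
  proof (rule inj_onI)
    fix x y assume *: "x \<in> \<Psi>_inv -` W" "y \<in> \<Psi>_inv -` W" "g x = g y"
    then have "\<Psi>_inv (g x) = \<Psi>_inv (g y)" by simp
    then have "f (\<Psi>_inv x) = f (\<Psi>_inv y)" by (simp add: g_def)
    then have "\<Psi>_inv x = \<Psi>_inv y" using W(3) * by (auto dest: inj_onD)
    then have "\<Psi> (\<Psi>_inv x) = \<Psi> (\<Psi>_inv y)" by simp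
    then show "x = y" by simp
  qed
  ultimately have "\<exists>\<Phi>. J_automorphism nf.Dom (model_J bt) \<Phi> \<and> (\<forall>z\<in>V \<inter> nf.Dom. \<Phi> z = g z)"
    using V p W(2) g_pseudo D2g
    by (intro nf.normal_form_extension[where p = "\<Psi> p" and Df = Dg and W = "\<Psi>_inv -` W"
          and S = "\<lambda>z w v. frechet_derivative (\<lambda>y. Dg y v) (at z) w"])
      (auto simp: r0_eq Dg_def intro: pseudo_holomorphicD(1,2)[OF g_pseudo])
  then obtain \<Phi> where \<Phi>: "bij_betw \<Phi> nf.Dom nf.Dom" "pseudo_holomorphic nf.Dom (model_J bt) nf.Dom (model_J bt) \<Phi>"
    and \<Phi>_g: "\<And>z. z \<in> V \<Longrightarrow> z \<in> nf.Dom \<Longrightarrow> \<Phi> z = g z"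
    unfolding J_automorphism_def by blast
  let ?D = "{z. r0 z < 0}" and ?F = "\<lambda>z. \<Psi>_inv (\<Phi> (\<Psi> z))"
  have openD: "open ?D" unfolding Dom_eq by (intro open_vimage nf.open_Dom continuous_on_\<Psi>)
  have "bij_betw \<Psi> ?D nf.Dom"
    by (rule bij_betw_byWitness[where f' = \<Psi>_inv]) (auto simp: Dom_eq)
  moreover have "bij_betw \<Psi>_inv nf.Dom ?D"
    by (rule bij_betw_byWitness[where f' = \<Psi>]) (auto simp: Dom_eq)
  ultimately have "bij_betw (\<Psi>_inv \<circ> (\<Phi> \<circ> \<Psi>)) ?D ?D"
    using \<Phi>(1) by (blast intro: bij_betw_trans)
  moreover have "pseudo_holomorphic ?D J0 ?D J0 ?F"
    by (rule pseudo_holomorphic_compose[OF openD nf.open_Dom pseudo_holomorphic_compose[OF openD nf.open_Dom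
            pseudo_holomorphic_subset[OF pseudo_holomorphic_\<Psi>(1)] \<Phi>(2)]
          pseudo_holomorphic_subset[OF pseudo_holomorphic_\<Psi>(2)]])
      (auto simp: Dom_eq)
  ultimately have "J_automorphism ?D J0 ?F" by (simp add: J_automorphism_def o_def)
  moreover have "?F z = f z" if "z \<in> U \<inter> ?D" for z
    using \<Phi>_g[of "\<Psi> z"] that by (simp add: V_def Dom_eq g_def)
  ultimately show ?thesis by blast
qed

end

section \<open>Forms attached to model structures and quadratic polynomials\<close>

lemma bounded_bilinear_sum_coordinates:
  fixes c :: "'m::finite \<Rightarrow> 'm \<Rightarrow> complex"
  assumes "linear s" "linear t"
  shows "bounded_bilinear (\<lambda>(x :: complex ^ 'm) (y :: complex ^ 'm). \<Sum>i\<in>UNIV. \<Sum>j\<in>UNIV. c i j * s (x $ i) * t (y $ j))"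
  unfolding bilinear_conv_bounded_bilinear[symmetric] bilinear_def
  by (auto intro!: linearI simp: linear_add[OF assms(1)] linear_add[OF assms(2)] linear_scale[OF assms(1)]
      linear_scale[OF assms(2)] algebra_simps sum.distrib scaleR_sum_right)

text \<open>A real polynomial equals its real part, and there the term with C may be replaced by its
  conjugate, which is complex bilinear and joins the term with A in \<open>h\<close>.\<close>

lemma real_homogeneous_quadratic_decomposition:
  fixes P :: "complex ^ 'm::finite \<Rightarrow> real"
  assumes "real_homogeneous_quadratic P"
  obtains h q where "bounded_bilinear h" "bounded_bilinear q"
    "\<And>x y. h (\<i> *s x) y = \<i> * h x y" "\<And>x y. h x (\<i> *s y) = \<i> * h x y"
    "\<And>x y. q (\<i> *s x) y = \<i> * q x y" "\<And>x y. q x (\<i> *s y) = - \<i> * q x y"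
    "\<And>w. P w = Re (h w w + q w w)"
proof -
  obtain A B C where P: "\<And>w. complex_of_real (P w) = (\<Sum>i\<in>UNIV. \<Sum>j\<in>UNIV.
      A i j * (w $ i) * (w $ j) + B i j * (w $ i) * cnj (w $ j) + C i j * cnj (w $ i) * cnj (w $ j))"
    using assms unfolding real_homogeneous_quadratic_def by blast
  define h where "h x y = (\<Sum>i\<in>UNIV. \<Sum>j\<in>UNIV. (A i j + cnj (C i j)) * x $ i * y $ j)" for x y :: "complex ^ 'm"
  define q where "q x y = (\<Sum>i\<in>UNIV. \<Sum>j\<in>UNIV. B i j * x $ i * cnj (y $ j))" for x y :: "complex ^ 'm"
  have lin: "linear (\<lambda>x :: complex. x)" "linear cnj"
    by (auto intro: linearI)
  show ?thesis
  proof (rule that)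
    show "bounded_bilinear h" "bounded_bilinear q"
      unfolding h_def[abs_def] q_def[abs_def]
      by (rule bounded_bilinear_sum_coordinates[OF lin(1) lin(1)] bounded_bilinear_sum_coordinates[OF lin(1) lin(2)])+
    show "h (\<i> *s x) y = \<i> * h x y" "h x (\<i> *s y) = \<i> * h x y"
      "q (\<i> *s x) y = \<i> * q x y" "q x (\<i> *s y) = - \<i> * q x y" for x y
      by (simp_all add: h_def q_def sum_distrib_left sum_negf mult.assoc mult.left_commute)
    fix w
    have "Re (complex_of_real (P w)) = (\<Sum>i\<in>UNIV. \<Sum>j\<in>UNIV.
      Re (A i j * (w $ i) * (w $ j)) + Re (B i j * (w $ i) * cnj (w $ j)) + Re (cnj (C i j * cnj (w $ i) * cnj (w $ j))))"
      unfolding P by (simp only: Re_sum plus_complex.sel cnj.simps)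
    also have "\<dots> = Re (h w w + q w w)"
      by (simp only: h_def q_def Re_sum plus_complex.sel(1) sum.distrib[symmetric])
        (intro sum.cong refl, simp add: algebra_simps)
    finally show "P w = Re (h w w + q w w)" by simp
  qed
qed

text \<open>The matrix entries refer to basis vectors; linearity of \<open>J z\<close> extends to
  all vectors both the pattern of zeros and the real linear dependence on the first component of z.
  Antilinearity of l is the last coordinate of J^2 = -1.\<close>

lemma model_structure_form:
  fixes J :: "'m::finite cspace \<Rightarrow> 'm cspace \<Rightarrow> 'm cspace"
  assumes "model_structure J"
  obtains l where "bounded_bilinear l" "\<And>x y. l x (\<i> *s y) = - \<i> * l x y"
    "\<And>z v. J z v = (\<i> *s fst v, \<i> * snd v + l (fst z) (fst v))"
proof -
  obtain a :: "'m cspace \<Rightarrow> 'm cspace \<Rightarrow> 'm \<Rightarrow> complex" where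
    acs: "almost_complex_structure_on UNIV J" and
    a: "\<And>z e e'. e \<in> Basis \<Longrightarrow> e' \<in> Basis \<Longrightarrow> complex_of_real ((J z e' - J_st e') \<bullet> e) =
            (if fst e = 0 \<and> snd e' = 0
             then (\<Sum>l\<in>UNIV. a e e' l * fst z $ l + cnj (a e e' l) * cnj (fst z $ l)) else 0)"
    using assms unfolding model_structure_def by blast
  have lin: "linear (J z)" and JJ: "J z (J z v) = - v" for z v
    using acs unfolding almost_complex_structure_on_def by blast+
  have linst: "linear (J_st :: 'm cspace \<Rightarrow> _)"
    by (rule linearI) (simp_all add: J_st_def vec_eq_iff algebra_simps)
  define K where "K z v = J z v - J_st v" for z v
  have linK: "linear (K z)" for z
    unfolding K_def[abs_def] by (intro linear_compose_sub lin linst)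
  have K_inner: "complex_of_real (K z e' \<bullet> e) = (if fst e = 0 \<and> snd e' = 0
             then (\<Sum>l\<in>UNIV. a e e' l * fst z $ l + cnj (a e e' l) * cnj (fst z $ l)) else 0)"
    if "e \<in> Basis" "e' \<in> Basis" for z e e'
    using a[OF that] by (simp add: K_def)
  have zero_ext: "F v = 0" if "linear F" "\<And>e. e \<in> Basis \<Longrightarrow> F e = 0" for F :: "'m cspace \<Rightarrow> 'm cspace" and v
    by (rule fun_cong[OF linear_eq_stdbasis[OF that(1) linear_zero]]) (simp add: that(2))
  have K_shift: "K z v = K (fst z, 0) v" for z v
  proof -
    have "(\<lambda>v. K z v - K (fst z, 0) v) v = 0"
    proof (rule zero_ext[where F = "(\<lambda>v. K z v - K (fst z, 0) v)"])
      fix e' :: "'m cspace" assume e': "e' \<in> Basis"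
      show "K z e' - K (fst z, 0) e' = 0"
      proof (rule euclidean_eqI)
        fix e :: "'m cspace" assume "e \<in> Basis"
        then have "complex_of_real (K z e' \<bullet> e) = complex_of_real (K (fst z, 0) e' \<bullet> e)"
          using K_inner e' by simp
        then show "(K z e' - K (fst z, 0) e') \<bullet> e = 0 \<bullet> e" by (simp add: inner_diff_left)
      qed
    qed (intro linear_compose_sub linK)
    then show ?thesis by simp
  qed
  have K_add: "K (x + y, 0) v = K (x, 0) v + K (y, 0) v" for x y v
  proof -
    have "(\<lambda>v. K (x + y, 0) v - (K (x, 0) v + K (y, 0) v)) v = 0"
    proof (rule zero_ext[where F = "(\<lambda>v. K (x + y, 0) v - (K (x, 0) v + K (y, 0) v))"])
      fix e' :: "'m cspace" assume e': "e' \<in> Basis"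
      show "K (x + y, 0) e' - (K (x, 0) e' + K (y, 0) e') = 0"
      proof (rule euclidean_eqI)
        fix e :: "'m cspace" assume "e \<in> Basis"
        then have "complex_of_real (K (x + y, 0) e' \<bullet> e) = complex_of_real (K (x, 0) e' \<bullet> e) + complex_of_real (K (y, 0) e' \<bullet> e)"
          using K_inner e' by (simp add: sum.distrib[symmetric] algebra_simps)
        then show "(K (x + y, 0) e' - (K (x, 0) e' + K (y, 0) e')) \<bullet> e = 0 \<bullet> e"
          by (simp add: inner_diff_left inner_add_left flip: of_real_add)
      qed
    qed (intro linear_compose_sub linear_compose_add linK)
    then show ?thesis by simp
  qed
  have K_scale: "K (r *\<^sub>R x, 0) v = r *\<^sub>R K (x, 0) v" for r x v
  proof -
    have "(\<lambda>v. K (r *\<^sub>R x, 0) v - r *\<^sub>R K (x, 0) v) v = 0"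
    proof (rule zero_ext[where F = "(\<lambda>v. K (r *\<^sub>R x, 0) v - r *\<^sub>R K (x, 0) v)"])
      fix e' :: "'m cspace" assume e': "e' \<in> Basis"
      show "K (r *\<^sub>R x, 0) e' - r *\<^sub>R K (x, 0) e' = 0"
      proof (rule euclidean_eqI)
        fix e :: "'m cspace" assume "e \<in> Basis"
        then have "complex_of_real (K (r *\<^sub>R x, 0) e' \<bullet> e) = complex_of_real r * complex_of_real (K (x, 0) e' \<bullet> e)"
          using K_inner e' by (simp add: sum_distrib_left scaleR_conv_of_real[where 'a = complex] algebra_simps)
        then show "(K (r *\<^sub>R x, 0) e' - r *\<^sub>R K (x, 0) e') \<bullet> e = 0 \<bullet> e"
          by (simp add: inner_diff_left flip: of_real_mult)
      qed
    qed (intro linear_compose_sub linear_compose_scale_right linK)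
    then show ?thesis by simp
  qed
  have fst_K: "fst (K z v) = 0" for z v
  proof -
    have "(\<lambda>v. (fst (K z v), 0 :: complex)) v = 0"
    proof (rule zero_ext[where F = "(\<lambda>v. (fst (K z v), 0 :: complex))"])
      show "linear (\<lambda>v. (fst (K z v), 0 :: complex))"
        by (rule linearI) (simp_all add: linear_add[OF linK] linear_scale[OF linK])
      fix e' :: "'m cspace" assume e': "e' \<in> Basis"
      have "fst (K z e') = 0"
      proof (rule euclidean_eqI)
        fix u :: "complex ^ 'm" assume u: "u \<in> Basis"
        then have "(u, 0) \<in> (Basis :: 'm cspace set)" by (simp add: Basis_prod_def)
        from K_inner[OF this e', of z] nonzero_Basis[OF u] show "fst (K z e') \<bullet> u = 0 \<bullet> u"
          by (simp add: inner_prod_def)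
      qed
      then show "(fst (K z e'), 0 :: complex) = 0" by (simp add: zero_prod_def)
    qed
    then show ?thesis by (simp add: zero_prod_def)
  qed
  have K_vertical: "K z (0, c) = 0" for z c
  proof -
    have "(\<lambda>v. K z (0, snd v)) (0 :: complex ^ 'm, c) = 0"
    proof (rule zero_ext[where F = "(\<lambda>v. K z (0, snd v))"])
      show "linear (\<lambda>v. K z (0, snd v))"
        by (rule linearI) (simp_all add: linear_add[OF linK, symmetric] linear_scale[OF linK, symmetric])
      fix e' :: "'m cspace" assume e': "e' \<in> Basis"
      show "K z (0, snd e') = 0"
      proof (cases "snd e' = 0")
        case True
        then show ?thesis using linear_0[OF linK[of z]] by (simp add: zero_prod_def)
      next
        case False
        then have "fst e' = 0" using e' by (auto simp: Basis_prod_def)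
        then have e'_eq: "(0, snd e') = e'" by (simp add: prod_eq_iff)
        show ?thesis
          unfolding e'_eq
        proof (rule euclidean_eqI)
          fix e :: "'m cspace" assume "e \<in> Basis"
          from K_inner[OF this e', of z] False show "K z e' \<bullet> e = 0 \<bullet> e" by simp
        qed
      qed
    qed
    then show ?thesis by simp
  qed
  define l where "l x y = snd (K (x, 0) (y, 0))" for x y
  have K_eq: "K z v = (0, l (fst z) (fst v))" for z v
  proof -
    have "K z v = K z (fst v, 0) + K z (0, snd v)" by (simp flip: linear_add[OF linK])
    then have "K z v = K (fst z, 0) (fst v, 0)" using K_vertical K_shift[of z "(fst v, 0)"] by simp
    then show ?thesis using fst_K by (simp add: l_def prod_eq_iff)
  qed
  have J_eq: "J z v = (\<i> *s fst v, \<i> * snd v + l (fst z) (fst v))" for z v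
    using K_eq[of z v] by (simp add: K_def J_st_def algebra_simps prod_eq_iff)
  show ?thesis
  proof (rule that)
    show "bounded_bilinear l"
      unfolding bilinear_conv_bounded_bilinear[symmetric] bilinear_def
    proof (intro conjI allI)
      show "linear (l x)" for x
      proof (rule linearI)
        show "l x (y + y') = l x y + l x y'" for y y'
          using linear_add[OF linK, of "(x, 0)" "(y, 0)" "(y', 0)"] by (simp add: l_def)
        show "l x (r *\<^sub>R y) = r *\<^sub>R l x y" for r y
          using linear_scale[OF linK, of "(x, 0)" r "(y, 0)"] by (simp add: l_def)
      qed
      show "linear (\<lambda>x. l x y)" for y
        by (rule linearI) (simp_all add: l_def K_add K_scale)
    qed
    show "l x (\<i> *s y) = - \<i> * l x y" for x y
    proof -
      have "\<i> * l x y + l x (\<i> *s y) = 0"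
        using arg_cong[OF JJ[of "(x, 0)" "(y, 0)"], of snd] by (simp add: J_eq)
      then show ?thesis by (simp add: eq_neg_iff_add_eq_0 add.commute)
    qed
  qed (rule J_eq)
qed

text \<open>Lowering Re z_n lowers the defining function, so every point where it is 0 is a limit of
  points of the domain.\<close>

lemma frontier_sublevel_graph:
  fixes P :: "complex ^ 'm::finite \<Rightarrow> real"
  assumes "continuous_on UNIV P"
  shows "frontier {z :: 'm cspace. Re (snd z) + P (fst z) < 0} = {z. Re (snd z) + P (fst z) = 0}"
proof -
  let ?r = "\<lambda>z :: 'm cspace. Re (snd z) + P (fst z)"
  have cont: "continuous_on UNIV ?r"
    by (intro continuous_intros continuous_on_compose2[OF assms]) auto
  have op: "open {z. ?r z < 0}" by (intro open_Collect_less cont continuous_on_const)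
  have cl: "closed {z. ?r z \<le> 0}" by (intro closed_Collect_le cont continuous_on_const)
  have "closure {z. ?r z < 0} = {z. ?r z \<le> 0}"
  proof
    show "closure {z. ?r z < 0} \<subseteq> {z. ?r z \<le> 0}" by (rule closure_minimal[OF _ cl]) auto
    show "{z. ?r z \<le> 0} \<subseteq> closure {z. ?r z < 0}"
    proof
      fix z assume z: "z \<in> {z. ?r z \<le> 0}"
      show "z \<in> closure {z. ?r z < 0}"
        unfolding closure_approachable
      proof (intro allI impI)
        fix e :: real assume e: "e > 0"
        let ?y = "z - (0, of_real (e / 2))"
        have "?r ?y < 0" using z e by simp
        moreover have "dist ?y z < e" using e by (simp add: dist_norm)
        ultimately show "\<exists>y\<in>{z. ?r z < 0}. dist y z < e" by blast
      qed
    qed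
  qed
  then have "frontier {z. ?r z < 0} = {z. ?r z \<le> 0} - {z. ?r z < 0}"
    unfolding frontier_def interior_open[OF op] by (simp only:)
  also have "\<dots> = {z. ?r z = 0}" by (rule set_eqI) (simp only: Diff_iff mem_Collect_eq, linarith)
  finally show ?thesis .
qed

theorem mainTheorem1:
  fixes D :: "'m::finite cspace set"
    and J :: "'m cspace \<Rightarrow> 'm cspace \<Rightarrow> 'm cspace"
    and p :: "'m cspace"
    and U :: "'m cspace set"
    and \<rho> :: real
    and f :: "'m cspace \<Rightarrow> 'm cspace"
  assumes "model_domain D J"
    and "p \<in> frontier D"
    and "\<rho> > 0" and "U = ball p \<rho>"
    and "Ck_on 4 U f"
    and "pseudo_holomorphic U J UNIV J f"
    and "f ` (U \<inter> frontier D) \<subseteq> frontier D"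
    and "local_diffeomorphism_at f p"
  shows "\<exists>\<Phi>. J_automorphism D J \<Phi> \<and> (\<forall>z \<in> U \<inter> D. \<Phi> z = f z)"
proof -
  obtain P where J: "model_structure J" and P: "real_homogeneous_quadratic P"
    and D: "D = {z. Re (snd z) + P (fst z) < 0}"
    and spc: "strictly_pseudoconvex_near J (\<lambda>z. Re (snd z) + P (fst z)) 0"
    using assms(1) unfolding model_domain_def by blast
  obtain l where l: "bounded_bilinear l" "\<And>x y. l x (\<i> *s y) = - \<i> * l x y"
    and J_eq: "\<And>z v. J z v = (\<i> *s fst v, \<i> * snd v + l (fst z) (fst v))"
    using model_structure_form[OF J] by metis
  obtain h q where hq: "bounded_bilinear h" "bounded_bilinear q"
    "\<And>x y. h (\<i> *s x) y = \<i> * h x y" "\<And>x y. h x (\<i> *s y) = \<i> * h x y"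
    "\<And>x y. q (\<i> *s x) y = \<i> * q x y" "\<And>x y. q x (\<i> *s y) = - \<i> * q x y"
    and P_eq: "\<And>w. P w = Re (h w w + q w w)"
    using real_homogeneous_quadratic_decomposition[OF P] by blast
  interpret model_data l h q
    by (intro model_data.intro l hq)
  have J0: "J = J0" by (simp add: fun_eq_iff J_eq J0_def)
  have r0: "(\<lambda>z. Re (snd z) + P (fst z)) = r0" by (simp add: fun_eq_iff r0_def P0_def P_eq)
  have "continuous_on UNIV P"
    unfolding P_eq by (intro continuous_intros h.continuous_on q.continuous_on)
  then have fr: "frontier D = {z. r0 z = 0}"
    unfolding D frontier_sublevel_graph[OF \<open>continuous_on UNIV P\<close>] using fun_cong[OF r0] by auto
  have "\<exists>\<Phi>. J_automorphism {z. r0 z < 0} J0 \<Phi> \<and> (\<forall>z\<in>U \<inter> {z. r0 z < 0}. \<Phi> z = f z)"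
  proof (rule model_extension)
    show "Ck_on 2 U f" using assms(5) by (rule Ck_on_mono) simp
    show "r0 (f z) = 0" if "z \<in> U" "r0 z = 0" for z
      using assms(7) that unfolding fr by blast
  qed (use assms spc fr in \<open>auto simp: J0 r0\<close>)
  then show ?thesis unfolding D J0 using fun_cong[OF r0] by simp
qed

end
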